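(* Let $A$ be an associative ring with identity, of characteristic $0$, with torsion-free additive group, and let $F_A(X)$ be a nonabelian free $A$-group with base $X$. Then: (1) elements $x,y\in F_A(X)$ commute if and only if $x=z^a$, $y=z^b$ for some $z\in F_A(X)$ and $a,b\in A$; (2) the centralizer of every nontrivial element of $F_A(X)$ is a free $A$-module of rank $1$ (with respect to the action of $A$ on $F_A(X)$).
   Context: An $A$-group is a group $G$ with a map $G\times A\to G$, $(g,\alpha)\mapsto g^\alpha$, such that for all $g,h\in G$, $\alpha,\beta\in A$: (1) $g^1=g$, $g^0=1$, $1^\alpha=1$; (2) $g^{\alpha+\beta}=g^\alpha g^\beta$, $g^{\alpha\beta}=(g^\alpha)^\beta$; (3) $(h^{-1}gh)^\alpha=h^{-1}g^\alpha h$; (4) $[g,h]=1$ implies $(gh)^\alpha=g^\alpha h^\alpha$. An abelian $A$-group is the same as a (right) $A$-module. An $A$-homomorphism is a group homomorphism $f$ with $f(g^\alpha)=f(g)^\alpha$. A free $A$-group with base $X$ is an $A$-group $F_A(X)$ generated as an $A$-group by $X$ such that every map from $X$ to an $A$-group $G$ extends to an $A$-homomorphism $F_A(X)\to G$; it exists and is unique up to $A$-isomorphism. *)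

theory Defs
  imports "HOL-Algebra.Ring"
begin

locale A_group = R: ring R + G: group G
  for R :: "('a, 'r) ring_scheme" and G :: "('g, 'm) monoid_scheme" +
  fixes act :: "'g \<Rightarrow> 'a \<Rightarrow> 'g"
  assumes act_closed: "g \<in> carrier G \<Longrightarrow> \<alpha> \<in> carrier R \<Longrightarrow> act g \<alpha> \<in> carrier G"
    and act_one: "g \<in> carrier G \<Longrightarrow> act g \<one>\<^bsub>R\<^esub> = g"
    and act_zero: "g \<in> carrier G \<Longrightarrow> act g \<zero>\<^bsub>R\<^esub> = \<one>\<^bsub>G\<^esub>"
    and one_act: "\<alpha> \<in> carrier R \<Longrightarrow> act \<one>\<^bsub>G\<^esub> \<alpha> = \<one>\<^bsub>G\<^esub>"
    and act_add: "g \<in> carrier G \<Longrightarrow> \<alpha> \<in> carrier R \<Longrightarrow> \<beta> \<in> carrier R \<Longrightarrow>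
      act g (\<alpha> \<oplus>\<^bsub>R\<^esub> \<beta>) = act g \<alpha> \<otimes>\<^bsub>G\<^esub> act g \<beta>"
    and act_mult: "g \<in> carrier G \<Longrightarrow> \<alpha> \<in> carrier R \<Longrightarrow> \<beta> \<in> carrier R \<Longrightarrow>
      act g (\<alpha> \<otimes>\<^bsub>R\<^esub> \<beta>) = act (act g \<alpha>) \<beta>"
    and act_conj: "g \<in> carrier G \<Longrightarrow> h \<in> carrier G \<Longrightarrow> \<alpha> \<in> carrier R \<Longrightarrow>
      act (inv\<^bsub>G\<^esub> h \<otimes>\<^bsub>G\<^esub> g \<otimes>\<^bsub>G\<^esub> h) \<alpha> = inv\<^bsub>G\<^esub> h \<otimes>\<^bsub>G\<^esub> act g \<alpha> \<otimes>\<^bsub>G\<^esub> h"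
    and act_commuting: "g \<in> carrier G \<Longrightarrow> h \<in> carrier G \<Longrightarrow> \<alpha> \<in> carrier R \<Longrightarrow>
      g \<otimes>\<^bsub>G\<^esub> h = h \<otimes>\<^bsub>G\<^esub> g \<Longrightarrow> act (g \<otimes>\<^bsub>G\<^esub> h) \<alpha> = act g \<alpha> \<otimes>\<^bsub>G\<^esub> act h \<alpha>"

definition A_subgroup ::
  "('a, 'r) ring_scheme \<Rightarrow> ('g, 'm) monoid_scheme \<Rightarrow> ('g \<Rightarrow> 'a \<Rightarrow> 'g) \<Rightarrow> 'g set \<Rightarrow> bool" where
  "A_subgroup R G act K \<longleftrightarrow> subgroup K G \<and> (\<forall>g\<in>K. \<forall>\<alpha>\<in>carrier R. act g \<alpha> \<in> K)"

definition A_generates ::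
  "('a, 'r) ring_scheme \<Rightarrow> ('g, 'm) monoid_scheme \<Rightarrow> ('g \<Rightarrow> 'a \<Rightarrow> 'g) \<Rightarrow> 'g set \<Rightarrow> bool" where
  "A_generates R G act S \<longleftrightarrow>
     S \<subseteq> carrier G \<and> (\<forall>K. A_subgroup R G act K \<and> S \<subseteq> K \<longrightarrow> K = carrier G)"

definition A_hom ::
  "('a, 'r) ring_scheme \<Rightarrow> ('g, 'm) monoid_scheme \<Rightarrow> ('g \<Rightarrow> 'a \<Rightarrow> 'g) \<Rightarrow>
   ('h, 'n) monoid_scheme \<Rightarrow> ('h \<Rightarrow> 'a \<Rightarrow> 'h) \<Rightarrow> ('g \<Rightarrow> 'h) set" where
  "A_hom R G actG H actH =
     {f \<in> hom G H. \<forall>g\<in>carrier G. \<forall>\<alpha>\<in>carrier R. f (actG g \<alpha>) = actH (f g) \<alpha>}"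

text \<open>A definition cannot quantify over all types, so the universal property of a free
  \<open>A\<close>-group is stated for target groups whose elements lie in the following type of formal
  \<open>A\<close>-group terms. This loses nothing: the image of a base generates an \<open>A\<close>-subgroup of the
  target all of whose elements are values of such terms, and lemma \<open>free_A_group_extends\<close> below
  recovers the universal property for target groups of arbitrary type.\<close>

datatype ('a, 'x) aterm =
    TVar 'x
  | TOne
  | TMult "('a, 'x) aterm" "('a, 'x) aterm"
  | TInv "('a, 'x) aterm"
  | TPow "('a, 'x) aterm" 'a

definition free_A_group ::
  "('a, 'r) ring_scheme \<Rightarrow> ('g, 'm) monoid_scheme \<Rightarrow> ('g \<Rightarrow> 'a \<Rightarrow> 'g) \<Rightarrow> 'g set \<Rightarrow> bool" where
  "free_A_group R F act S \<longleftrightarrow>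
     A_group R F act \<and> A_generates R F act S \<and>
     (\<forall>(H :: ('a, 'g) aterm monoid) actH f.
        A_group R H actH \<and> f \<in> S \<rightarrow> carrier H \<longrightarrow>
        (\<exists>\<phi>\<in>A_hom R F act H actH. \<forall>x\<in>S. \<phi> x = f x))"

definition centralizer :: "('g, 'm) monoid_scheme \<Rightarrow> 'g \<Rightarrow> 'g set" where
  "centralizer G g = {h \<in> carrier G. h \<otimes>\<^bsub>G\<^esub> g = g \<otimes>\<^bsub>G\<^esub> h}"

text \<open>Right \<open>A\<close>-modules are the abelian \<open>A\<close>-groups, written multiplicatively, so that
  \<open>\<Otimes>b. act b (c b)\<close> is the \<open>A\<close>-linear combination of the \<open>b\<close> with coefficients \<open>c b\<close>. In a
  basis every element is such a combination with a unique finitely supported \<open>c\<close>.\<close>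

definition A_module ::
  "('a, 'r) ring_scheme \<Rightarrow> ('g, 'm) monoid_scheme \<Rightarrow> ('g \<Rightarrow> 'a \<Rightarrow> 'g) \<Rightarrow> bool" where
  "A_module R M act \<longleftrightarrow> A_group R M act \<and> comm_group M"

definition A_module_basis ::
  "('a, 'r) ring_scheme \<Rightarrow> ('g, 'm) monoid_scheme \<Rightarrow> ('g \<Rightarrow> 'a \<Rightarrow> 'g) \<Rightarrow> 'g set \<Rightarrow> bool" where
  "A_module_basis R M act B \<longleftrightarrow>
     B \<subseteq> carrier M \<and>
     (\<forall>m\<in>carrier M. \<exists>!c. c \<in> B \<rightarrow>\<^sub>E carrier R \<and> finite {b \<in> B. c b \<noteq> \<zero>\<^bsub>R\<^esub>} \<and>
        m = (\<Otimes>\<^bsub>M\<^esub>b\<in>{b \<in> B. c b \<noteq> \<zero>\<^bsub>R\<^esub>}. act b (c b)))"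

definition free_A_module_of_rank ::
  "('a, 'r) ring_scheme \<Rightarrow> ('g, 'm) monoid_scheme \<Rightarrow> ('g \<Rightarrow> 'a \<Rightarrow> 'g) \<Rightarrow> nat \<Rightarrow> bool" where
  "free_A_module_of_rank R M act n \<longleftrightarrow>
     A_module R M act \<and> (\<exists>B. finite B \<and> card B = n \<and> A_module_basis R M act B)"

definition ring_char_zero :: "('a, 'r) ring_scheme \<Rightarrow> bool" where
  "ring_char_zero R \<longleftrightarrow> (\<forall>n::nat. n > 0 \<longrightarrow> [n] \<cdot>\<^bsub>R\<^esub> \<one>\<^bsub>R\<^esub> \<noteq> \<zero>\<^bsub>R\<^esub>)"

definition additive_torsion_free :: "('a, 'r) ring_scheme \<Rightarrow> bool" where
  "additive_torsion_free R \<longleftrightarrow>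
     (\<forall>n::nat. \<forall>a\<in>carrier R. n > 0 \<and> [n] \<cdot>\<^bsub>R\<^esub> a = \<zero>\<^bsub>R\<^esub> \<longrightarrow> a = \<zero>\<^bsub>R\<^esub>)"

lemma A_group_transport:
  fixes H :: "('h, 'n) monoid_scheme" and r :: "'h \<Rightarrow> 't"
  assumes H: "A_group R H act" and K: "A_subgroup R H act K"
    and e: "\<And>k. k \<in> K \<Longrightarrow> e (r k) = k"
  shows "A_group R \<lparr>carrier = r ` K, mult = (\<lambda>s t. r (e s \<otimes>\<^bsub>H\<^esub> e t)), one = r \<one>\<^bsub>H\<^esub>\<rparr>
           (\<lambda>s \<alpha>. r (act (e s) \<alpha>))" (is "A_group R ?T ?a")
proof -
  interpret H: A_group R H act by (rule H)
  interpret K: subgroup K H using K by (simp add: A_subgroup_def)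
  have Ka: "act g \<alpha> \<in> K" if "g \<in> K" "\<alpha> \<in> carrier R" for g \<alpha>
    using K that by (simp add: A_subgroup_def)
  have inj: "r x = r y \<Longrightarrow> x \<in> K \<Longrightarrow> y \<in> K \<Longrightarrow> x = y" for x y
    by (metis e)
  have T: "group ?T"
  proof (rule groupI)
    fix x assume "x \<in> carrier ?T"
    then obtain k where k: "k \<in> K" "x = r k" by auto
    show "\<exists>y\<in>carrier ?T. y \<otimes>\<^bsub>?T\<^esub> x = \<one>\<^bsub>?T\<^esub>"
      by (rule bexI[of _ "r (inv\<^bsub>H\<^esub> k)"]) (use k in \<open>auto simp: e\<close>)
  qed (auto simp: e H.G.m_assoc)
  have invT: "inv\<^bsub>?T\<^esub> (r k) = r (inv\<^bsub>H\<^esub> k)" if "k \<in> K" for k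
    by (rule group.inv_equality[OF T]) (use that in \<open>auto simp: e\<close>)
  show ?thesis
  proof (intro A_group.intro T A_group_axioms.intro H.R.ring_axioms)
    fix g h \<alpha> assume "g \<in> carrier ?T" "h \<in> carrier ?T" "\<alpha> \<in> carrier R"
      and c: "g \<otimes>\<^bsub>?T\<^esub> h = h \<otimes>\<^bsub>?T\<^esub> g"
    then obtain k l where kl: "k \<in> K" "g = r k" "l \<in> K" "h = r l" by auto
    have "k \<otimes>\<^bsub>H\<^esub> l = l \<otimes>\<^bsub>H\<^esub> k"
      using c kl by (auto simp: e dest: inj)
    then show "?a (g \<otimes>\<^bsub>?T\<^esub> h) \<alpha> = ?a g \<alpha> \<otimes>\<^bsub>?T\<^esub> ?a h \<alpha>"
      using kl \<open>\<alpha> \<in> carrier R\<close> H.act_commuting[of k l \<alpha>] by (simp add: e Ka)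
  qed (auto simp: e Ka invT H.act_one H.act_zero H.one_act H.act_add H.act_mult H.act_conj)
qed

lemma free_A_group_extends:
  fixes F :: "('g, 'm) monoid_scheme" and H :: "('h, 'n) monoid_scheme"
  assumes F: "free_A_group R F act S" and H: "A_group R H actH" and f: "f \<in> S \<rightarrow> carrier H"
  shows "\<exists>\<phi>\<in>A_hom R F act H actH. \<forall>x\<in>S. \<phi> x = f x"
proof -
  interpret H: A_group R H actH by (rule H)
  define e where "e = rec_aterm f \<one>\<^bsub>H\<^esub> (\<lambda>_ _ s t. s \<otimes>\<^bsub>H\<^esub> t) (\<lambda>_ s. inv\<^bsub>H\<^esub> s) (\<lambda>_ \<alpha> s. actH s \<alpha>)"
  have e[simp]: "e (TVar x) = f x" "e TOne = \<one>\<^bsub>H\<^esub>" "e (TMult s t) = e s \<otimes>\<^bsub>H\<^esub> e t"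
    "e (TInv s) = inv\<^bsub>H\<^esub> e s" "e (TPow s \<alpha>) = actH (e s) \<alpha>" for x s t \<alpha>
    by (simp_all add: e_def)
  define W where "W = rec_aterm (\<lambda>x. x \<in> S) True (\<lambda>_ _ s t. s \<and> t) (\<lambda>_ s. s)
    (\<lambda>_ \<alpha> s. s \<and> \<alpha> \<in> carrier R)"
  have W[simp]: "W (TVar x) \<longleftrightarrow> x \<in> S" "W TOne" "W (TMult s t) \<longleftrightarrow> W s \<and> W t"
    "W (TInv s) \<longleftrightarrow> W s" "W (TPow s \<alpha>) \<longleftrightarrow> W s \<and> \<alpha> \<in> carrier R" for x s t \<alpha>
    by (simp_all add: W_def)
  define K where "K = e ` Collect W"
  have eK: "W t \<Longrightarrow> e t \<in> K" for t by (simp add: K_def)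
  have ec: "W t \<Longrightarrow> e t \<in> carrier H" for t
    by (induction t) (use f in \<open>auto intro: H.act_closed\<close>)
  have K: "A_subgroup R H actH K"
    unfolding A_subgroup_def
  proof (intro conjI H.G.subgroupI ballI)
    show "K \<noteq> {}" using eK[of TOne] by auto
  next
    fix a assume "a \<in> K"
    then obtain s where s: "a = e s" "W s" by (auto simp: K_def)
    show "inv\<^bsub>H\<^esub> a \<in> K" using s eK[of "TInv s"] by simp
    fix b assume "b \<in> K"
    then obtain t where t: "b = e t" "W t" by (auto simp: K_def)
    show "a \<otimes>\<^bsub>H\<^esub> b \<in> K" using s t eK[of "TMult s t"] by simp
  next
    fix a \<alpha> assume "a \<in> K" "\<alpha> \<in> carrier R"
    then show "actH a \<alpha> \<in> K" using eK[of "TPow _ \<alpha>"] by (force simp: K_def)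
  qed (auto simp: K_def ec)
  define r where "r = inv_into (Collect W) e"
  have er: "e (r k) = k" if "k \<in> K" for k
    using that by (simp add: r_def K_def f_inv_into_f)
  let ?T = "\<lparr>carrier = r ` K, mult = (\<lambda>s t. r (e s \<otimes>\<^bsub>H\<^esub> e t)), one = r \<one>\<^bsub>H\<^esub>\<rparr>"
  let ?a = "\<lambda>s \<alpha>. r (actH (e s) \<alpha>)"
  have "A_group R ?T ?a" using A_group_transport[OF H K, of e r] er by blast
  moreover have fK: "f x \<in> K" if "x \<in> S" for x using eK[of "TVar x"] that by simp
  then have "(\<lambda>x. r (f x)) \<in> S \<rightarrow> carrier ?T" by auto
  ultimately obtain \<phi> where \<phi>: "\<phi> \<in> A_hom R F act ?T ?a" "\<forall>x\<in>S. \<phi> x = r (f x)"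
    using F unfolding free_A_group_def by blast
  have \<phi>K: "e (\<phi> g) \<in> K" if "g \<in> carrier F" for g
    using \<phi>(1) that er by (auto simp: A_hom_def hom_def Pi_iff)
  interpret K: subgroup K H using K by (simp add: A_subgroup_def)
  have "(\<lambda>g. e (\<phi> g)) \<in> A_hom R F act H actH"
    using \<phi>(1) \<phi>K K by (simp add: A_hom_def hom_def Pi_iff A_subgroup_def er)
  moreover have "\<forall>x\<in>S. e (\<phi> x) = f x"
    using \<phi>(2) fK er by simp
  ultimately show ?thesis by (intro bexI[of _ "\<lambda>g. e (\<phi> g)"])
qed

end

theory Submission
  imports Defs
begin

text \<open>The free \<open>A\<close>-group is rebuilt as the union of a chain of groups. Each stage is a group with a
  family \<open>E\<close> of \<^emph>\<open>axes\<close>: injective homomorphisms from the additive group of \<open>A\<close> whose images are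
  malnormal and pairwise without common conjugates; every nontrivial element is conjugate into an axis
  or into a malnormal infinite cyclic subgroup. The next stage is the amalgamated product which glues,
  to each conjugacy class of those cyclic subgroups \<open>\<langle>u\<rangle>\<close>, a copy of \<open>A\<close> with \<open>u = 1\<close>. Its normal
  forms carry the length function of the action on the Bass--Serre tree. By the four point condition,
  an element of positive translation length has an infinite cyclic malnormal centralizer, and elements
  without translation length lie in conjugates of the factors, so the hypotheses on the stage are
  inherited. In the union every nontrivial element \<open>p e(a) p\<^sup>-\<^sup>1\<close> lies on a conjugate of an axis, which is its
  centralizer, and \<open>(p e(a) p\<^sup>-\<^sup>1)\<^sup>\<alpha> = p e(a\<alpha>) p\<^sup>-\<^sup>1\<close> defines the action of \<open>A\<close>.\<close>

text \<open>The group that is built is never proved to be free. A homomorphism to one fixed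
  \<open>A\<close>-group is carried through all stages, and in the end this target is the given free
  group itself, with its base as the prescribed images. The universal property of the given group
  supplies the map back, and generation on both sides makes the two maps inverse to each other. The
  obstacle is that a stage carries no action of \<open>A\<close>: only elements on conjugates of
  axes have powers with exponents in \<open>A\<close>. Hence compatibility of the homomorphism and
  generation are stated through axes alone. Malnormality keeps this consistent: a nontrivial element
  lies on one conjugate of one axis, so its powers do not depend on how it is written, and commuting
  elements share that conjugate. Characteristic 0 makes the map from \<open>k\<close> to
  \<open>k\<close> times \<open>1\<close> injective, so that an infinite cyclic group embeds in its
  copy of \<open>A\<close>. Torsion-freeness excludes elements of order two; an element inverting a
  power of \<open>u\<close> would be one.\<close>

definition malnormal_cyclic :: "('g, 'm) monoid_scheme \<Rightarrow> 'g \<Rightarrow> bool" where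
  "malnormal_cyclic G u \<longleftrightarrow> u \<in> carrier G \<and> (\<forall>n::int. u [^]\<^bsub>G\<^esub> n = \<one>\<^bsub>G\<^esub> \<longrightarrow> n = 0) \<and>
     (\<forall>q\<in>carrier G. \<forall>(m::int) (k::int). q \<otimes>\<^bsub>G\<^esub> u [^]\<^bsub>G\<^esub> m \<otimes>\<^bsub>G\<^esub> inv\<^bsub>G\<^esub> q = u [^]\<^bsub>G\<^esub> k \<longrightarrow>
        u [^]\<^bsub>G\<^esub> k \<noteq> \<one>\<^bsub>G\<^esub> \<longrightarrow> (\<exists>n::int. q = u [^]\<^bsub>G\<^esub> n))"

section \<open>Conjugation and powers in a group\<close>

context group
begin

lemma inv_commutes:
  assumes "x \<in> carrier G" "y \<in> carrier G" "x \<otimes> y = y \<otimes> x"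
  shows "inv x \<otimes> y = y \<otimes> inv x"
  using assms by (metis inv_closed inv_solve_left inv_solve_right m_assoc m_closed)

lemma conj_int_pow:
  assumes "p \<in> carrier G" "x \<in> carrier G"
  shows "(p \<otimes> x \<otimes> inv p) [^] (n::int) = p \<otimes> x [^] n \<otimes> inv p"
proof -
  have "(\<lambda>x. p \<otimes> x \<otimes> inv p) \<in> hom G G"
    using assms by (auto simp: hom_def m_assoc) (simp add: m_assoc[symmetric])
  from hom_int_pow[OF this assms(2) is_group is_group] show ?thesis by simp
qed

lemma conj_eq_iff:
  assumes "p \<in> carrier G" "x \<in> carrier G" "y \<in> carrier G"
  shows "p \<otimes> x \<otimes> inv p = y \<longleftrightarrow> p \<otimes> x = y \<otimes> p" "x = inv p \<otimes> y \<otimes> p \<longleftrightarrow> p \<otimes> x = y \<otimes> p"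
proof -
  show "p \<otimes> x \<otimes> inv p = y \<longleftrightarrow> p \<otimes> x = y \<otimes> p" using assms by (metis inv_solve_right' m_closed)
  have "inv p \<otimes> y \<otimes> p = inv p \<otimes> (y \<otimes> p)" using assms by (simp add: m_assoc)
  then show "x = inv p \<otimes> y \<otimes> p \<longleftrightarrow> p \<otimes> x = y \<otimes> p" using assms by (metis inv_solve_left m_closed)
qed

end

section \<open>Length functions satisfying the four point condition\<close>

text \<open>\<open>l x\<close> plays the distance from a base point \<open>o\<close> of a tree to
  its translate \<open>x o\<close>. So \<open>l (inv x \<otimes> y)\<close> is the distance of
  \<open>x o\<close> and \<open>y o\<close>, and the last axiom is the four point condition. The
  hypothesis \<open>l (h \<otimes> h) = 2 * l h\<close> with \<open>0 < l h\<close>, which recurs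
  below, says that \<open>h\<close> is hyperbolic and that its axis passes through
  \<open>o\<close>.\<close>

locale tree_length = group G for G (structure) +
  fixes l :: "'a \<Rightarrow> int"
  assumes l_one: "l \<one> = 0"
    and l_nonneg: "x \<in> carrier G \<Longrightarrow> 0 \<le> l x"
    and l_inv: "x \<in> carrier G \<Longrightarrow> l (inv x) = l x"
    and four_point: "x \<in> carrier G \<Longrightarrow> y \<in> carrier G \<Longrightarrow> z \<in> carrier G \<Longrightarrow> w \<in> carrier G \<Longrightarrow>
      l (inv x \<otimes> y) + l (inv z \<otimes> w) \<le>
        max (l (inv x \<otimes> z) + l (inv y \<otimes> w)) (l (inv x \<otimes> w) + l (inv y \<otimes> z))"
begin

lemma l_flip: "x \<in> carrier G \<Longrightarrow> y \<in> carrier G \<Longrightarrow> l (inv x \<otimes> y) = l (inv y \<otimes> x)"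
  by (metis inv_closed inv_inv inv_mult_group l_inv m_closed)

lemma l_mult: assumes "x \<in> carrier G" "y \<in> carrier G" shows "l (x \<otimes> y) \<le> l x + l y"
  using four_point[of "inv x" y "\<one>" "\<one>"] assms by (simp add: l_one l_inv)

text \<open>\<open>o\<close> is the midpoint of the segment from \<open>inv h o\<close> to
  \<open>h o\<close>. The path from \<open>o\<close> to \<open>k o\<close> can follow at most one
  half of it, and together with the other half it forms a geodesic.\<close>

lemma l_commuting_max:
  assumes h: "h \<in> carrier G" "l (h \<otimes> h) = 2 * l h" and k: "k \<in> carrier G"
  shows "max (l (h \<otimes> k)) (l (inv h \<otimes> k)) = l h + l k"
proof -
  have "l (inv \<one> \<otimes> k) + l (inv (inv h) \<otimes> h) \<le>
     max (l (inv \<one> \<otimes> inv h) + l (inv k \<otimes> h)) (l (inv \<one> \<otimes> h) + l (inv k \<otimes> inv h))"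
    by (rule four_point) (use h k in auto)
  moreover have "l (inv k \<otimes> h) = l (inv h \<otimes> k)" "l (inv k \<otimes> inv h) = l (h \<otimes> k)"
    using h k l_flip[of k "inv h"] l_flip[of k h] by auto
  moreover have "l (h \<otimes> k) \<le> l h + l k" "l (inv h \<otimes> k) \<le> l h + l k"
    using l_mult[of h k] l_mult[of "inv h" k] h k by (simp_all add: l_inv)
  ultimately show ?thesis using h k by (simp add: l_inv)
qed

text \<open>As \<open>h\<close> and \<open>k\<close> commute, the points \<open>o\<close>,
  \<open>h o\<close>, \<open>h k o\<close>, \<open>k o\<close> form a parallelogram with sides
  \<open>l h\<close> and \<open>l k\<close>, and its diagonals are the two terms on the left. The
  four point condition bounds their sum by the larger sum of opposite sides.\<close>

lemma l_commuting_sum: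
  assumes h: "h \<in> carrier G" and k: "k \<in> carrier G" and c: "h \<otimes> k = k \<otimes> h"
  shows "l (h \<otimes> k) + l (inv h \<otimes> k) \<le> 2 * max (l h) (l k)"
proof -
  have "l (inv \<one> \<otimes> (h \<otimes> k)) + l (inv h \<otimes> k) \<le>
     max (l (inv \<one> \<otimes> h) + l (inv (h \<otimes> k) \<otimes> k)) (l (inv \<one> \<otimes> k) + l (inv (h \<otimes> k) \<otimes> h))"
    by (rule four_point) (use h k in auto)
  moreover have "l (inv (h \<otimes> k) \<otimes> k) = l h"
    using h k by (simp add: c inv_mult_group m_assoc l_inv)
  moreover have "l (inv (h \<otimes> k) \<otimes> h) = l k"
    using h k by (simp add: inv_mult_group m_assoc l_inv)
  ultimately show ?thesis using h k by simp
qed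

text \<open>Two consecutive powers are treated together because \<open>l_commuting_max\<close>
  yields only the maximum of the lengths of \<open>h^(n+2)\<close> and \<open>h^n\<close>. The known
  length of \<open>h^n\<close> is too small to attain it.\<close>

lemma l_nat_pow:
  assumes h: "h \<in> carrier G" "l (h \<otimes> h) = 2 * l h" "0 < l h"
  shows "l (h [^] (n::nat)) = int n * l h"
proof -
  have "l (h [^] n) = int n * l h \<and> l (h [^] Suc n) = (1 + int n) * l h"
  proof (induction n)
    case 0 then show ?case using h by (simp add: l_one)
  next
    case (Suc n)
    have e: "h \<otimes> h [^] Suc n = h [^] Suc (Suc n)"
      using h nat_pow_Suc2 by presburger
    have "inv h \<otimes> h [^] Suc n = h [^] n"
      using h nat_pow_Suc2[of h n] by (simp add: m_assoc[symmetric] del: nat_pow_Suc)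
    then have "max (l (h [^] Suc (Suc n))) (l (h [^] n)) = l h + l (h [^] Suc n)"
      using l_commuting_max[of h "h [^] Suc n"] h e by (simp del: nat_pow_Suc)
    with Suc h show ?case
      by (auto simp: algebra_simps max_def simp del: nat_pow_Suc split: if_splits)
  qed
  then show ?thesis by simp
qed

lemma l_int_pow:
  assumes "h \<in> carrier G" "l (h \<otimes> h) = 2 * l h" "0 < l h"
  shows "l (h [^] (n::int)) = \<bar>n\<bar> * l h"
  using assms l_nat_pow[OF assms] by (cases n rule: int_cases2) (auto simp: int_pow_int int_pow_neg l_inv)

text \<open>\<open>k o\<close> lies on the axis of \<open>g\<close>, at the signed coordinate
  \<open>s\<close>. With \<open>n\<close> so large that the two points \<open>g^-n o\<close> and
  \<open>g^n o\<close> lie beyond it, the two lengths are its distances from these points.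
  \<open>l_commuting_max\<close> gives the larger one; \<open>l_commuting_sum\<close> and the
  triangle inequality give the other.\<close>

lemma axis_position:
  assumes g: "g \<in> carrier G" "l (g \<otimes> g) = 2 * l g" "0 < l g"
    and k: "k \<in> carrier G" "g \<otimes> k = k \<otimes> g" and n: "l k < int n * l g"
  shows "\<exists>s\<in>{l k, - l k}. l (g [^] n \<otimes> k) = int n * l g + s \<and> l (inv (g [^] n) \<otimes> k) = int n * l g - s"
proof -
  define h where "h = g [^] n"
  have hc: "h \<in> carrier G" using g by (simp add: h_def)
  have lh: "l h = int n * l g" unfolding h_def by (rule l_nat_pow[OF g])
  have lhh: "l (h \<otimes> h) = 2 * l h"
    unfolding h_def using g l_nat_pow[OF g, of "n+n"] l_nat_pow[OF g, of n]
    by (simp add: nat_pow_mult algebra_simps)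
  have hk: "h \<otimes> k = k \<otimes> h" unfolding h_def using g k by (simp add: group_commutes_pow)
  have M: "max (l (h \<otimes> k)) (l (inv h \<otimes> k)) = l h + l k"
    by (rule l_commuting_max[OF hc lhh k(1)])
  have S: "l (h \<otimes> k) + l (inv h \<otimes> k) \<le> 2 * l h"
    using l_commuting_sum[OF hc k(1) hk] lh n by simp
  have "l h \<le> l (h \<otimes> k) + l k" "l h \<le> l (inv h \<otimes> k) + l k"
    using l_mult[of "h \<otimes> k" "inv k"] l_mult[of "inv h \<otimes> k" "inv k"] hc k
    by (simp_all add: m_assoc l_inv)
  with M S show ?thesis unfolding h_def[symmetric] lh[symmetric] by (auto simp: max_def split: if_splits)
qed

lemma l_square_of_commuting:
  assumes g: "g \<in> carrier G" "l (g \<otimes> g) = 2 * l g" "0 < l g"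
    and k: "k \<in> carrier G" "g \<otimes> k = k \<otimes> g"
  shows "l (k \<otimes> k) = 2 * l k"
proof -
  define n where "n = nat (l k) + 1"
  have "l k < int n" by (simp add: n_def)
  also have "int n \<le> int n * l g" using g by (simp add: mult_le_cancel_left1)
  finally have n: "l k < int n * l g" .
  define h where "h = g [^] n"
  have hc: "h \<in> carrier G" using g by (simp add: h_def)
  have hk: "h \<otimes> k = k \<otimes> h" unfolding h_def using g k by (simp add: group_commutes_pow)
  have ihk: "inv h \<otimes> k = k \<otimes> inv h" by (rule inv_commutes[OF hc k(1) hk])
  \<comment> \<open>The factorization is \<open>k y = (k k) (inv k y)\<close>. For
    \<open>y = g^n\<close> or its inverse the lengths of \<open>y k\<close> and
    \<open>inv y k\<close> differ by \<open>2 * l k\<close>, which bounds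
    \<open>l (k \<otimes> k)\<close> from below.\<close>
  have split: "l (y \<otimes> k) \<le> l (k \<otimes> k) + l (inv y \<otimes> k)" if y: "y \<in> carrier G" "y \<otimes> k = k \<otimes> y" for y
  proof -
    have "k \<otimes> y = (k \<otimes> k) \<otimes> (inv k \<otimes> y)" using y k by (simp add: m_assoc inv_solve_left)
      (simp add: m_assoc[symmetric])
    then show ?thesis using l_mult[of "k \<otimes> k" "inv k \<otimes> y"] y k l_flip[of k y] by simp
  qed
  have "l (k \<otimes> k) \<ge> 2 * l k"
    using axis_position[OF g k n] split[of h] split[of "inv h"] hc hk ihk unfolding h_def[symmetric]
    by auto
  then show ?thesis using l_mult[of k k] k by simp
qed

text \<open>Both \<open>h o\<close> and \<open>k o\<close> lie on the axis of \<open>g\<close>. On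
  the same side of \<open>o\<close> their distance is at most the difference of their distances from
  \<open>o\<close>; if they lie on opposite sides, \<open>h\<close> is replaced by its
  inverse.\<close>

lemma axis_distance:
  assumes g: "g \<in> carrier G" "l (g \<otimes> g) = 2 * l g" "0 < l g"
    and h: "h \<in> carrier G" "g \<otimes> h = h \<otimes> g"
    and k: "k \<in> carrier G" "g \<otimes> k = k \<otimes> g"
  shows "l (inv h \<otimes> k) \<le> \<bar>l k - l h\<bar> \<or> l (h \<otimes> k) \<le> \<bar>l k - l h\<bar>"
proof -
  define n where "n = nat (l k) + nat (l h) + 1"
  have "l k < int n" "l h < int n" by (auto simp: n_def)
  moreover have "int n \<le> int n * l g" using g by (simp add: mult_le_cancel_left1)
  ultimately have n: "l k < int n * l g" "l h < int n * l g" by auto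
  define x where "x = g [^] n"
  have x: "x \<in> carrier G" using g by (simp add: x_def)
  have xx: "l (x \<otimes> x) = 2 * int n * l g"
    unfolding x_def using g l_nat_pow[OF g, of "n+n"] by (simp add: nat_pow_mult)
  have sq: "l (inv x \<otimes> inv x) = l (x \<otimes> x)" using x l_inv[of "x \<otimes> x"] by (simp add: inv_mult_group)
  \<comment> \<open>The points \<open>x o\<close> and \<open>inv x o\<close> lie so far out that in
    the four point condition everything cancels except the difference of the coordinates
    \<open>s\<close> and \<open>s'\<close>.\<close>
  have *: "l (inv h \<otimes> k) \<le> \<bar>s - s'\<bar>"
    if "h \<in> carrier G" "l (x \<otimes> k) = int n * l g + s" "l (inv x \<otimes> k) = int n * l g - s"
      "l (x \<otimes> h) = int n * l g + s'" "l (inv x \<otimes> h) = int n * l g - s'" for h s s'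
    using four_point[of x "inv x" h k] that x k xx sq by simp
  have xh: "x \<otimes> h = h \<otimes> x" unfolding x_def using g h by (simp add: group_commutes_pow)
  have "l (x \<otimes> inv h) = l (inv x \<otimes> h)" "l (inv x \<otimes> inv h) = l (x \<otimes> h)"
    using x h xh inv_commutes[OF x h(1) xh] l_inv[of "x \<otimes> h"] l_inv[of "inv x \<otimes> h"]
      inv_commutes[of h x]
    by (auto simp: inv_mult_group)
  then show ?thesis
    using axis_position[OF g k n(1)] axis_position[OF g h n(2)] unfolding x_def[symmetric]
    using *[of h] *[of "inv h"] h by fastforce
qed

text \<open>Euclid's algorithm on lengths: \<open>u\<close> has least positive length among the
  elements that commute with \<open>g\<close>, and multiplication by \<open>u\<close> or its inverse
  shortens any other such element by at least \<open>l u\<close>. The descent ends at length zero,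
  where \<open>free\<close> applies.\<close>

lemma cyclic_centralizer:
  assumes g: "g \<in> carrier G" "l (g \<otimes> g) = 2 * l g" "0 < l g"
    and free: "\<And>k. k \<in> carrier G \<Longrightarrow> g \<otimes> k = k \<otimes> g \<Longrightarrow> l k = 0 \<Longrightarrow> k = \<one>"
  obtains u where "u \<in> carrier G" "l (u \<otimes> u) = 2 * l u" "0 < l u" "g \<otimes> u = u \<otimes> g"
    "\<And>k. k \<in> carrier G \<Longrightarrow> g \<otimes> k = k \<otimes> g \<Longrightarrow> \<exists>n::int. k = u [^] n"
proof -
  let ?Q = "\<lambda>h. h \<in> carrier G \<and> g \<otimes> h = h \<otimes> g"
  let ?P = "\<lambda>h. ?Q h \<and> 0 < l h"
  define u where "u = arg_min (\<lambda>h. nat (l h)) ?P"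
  have u: "?P u" and min: "\<And>h. ?P h \<Longrightarrow> nat (l u) \<le> nat (l h)"
    using arg_min_nat_lemma[of ?P g "\<lambda>h. nat (l h)"] g unfolding u_def by auto
  have uu: "l (u \<otimes> u) = 2 * l u" using l_square_of_commuting[OF g] u by blast
  have Qmult: "?Q (x \<otimes> y)" if "?Q x" "?Q y" for x y using that g by (metis m_assoc m_closed)
  have Qinv: "?Q (inv x)" if "?Q x" for x using that g inv_commutes[of x g] by simp
  have "nat (l k) = n \<Longrightarrow> ?Q k \<Longrightarrow> \<exists>n::int. k = u [^] n" for n k
  proof (induction n arbitrary: k rule: less_induct)
    case (less n)
    show ?case
    proof (cases "k = \<one>")
      case True then show ?thesis by (metis int_pow_0)
    next
      case False
      then have "0 < l k" using free less.prems l_nonneg[of k] by fastforce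
      then have le: "l u \<le> l k" using min[of k] less.prems by simp
      have "\<exists>m::int. l (u [^] m \<otimes> k) \<le> l k - l u"
        using axis_distance[OF g, of u k] u less.prems le int_pow_neg[of u 1] int_pow_one
        by (metis abs_of_nonneg diff_ge_0_iff_ge int_pow_1)
      then obtain m :: int where m: "l (u [^] m \<otimes> k) \<le> l k - l u" ..
      have Qn: "?Q (u [^] i)" for i :: nat
        using u g group_commutes_pow[of u g i] by auto
      have Qm: "?Q (u [^] m)"
        using Qn Qinv[OF Qn] u by (cases m rule: int_cases2) (auto simp: int_pow_int int_pow_neg)
      have "nat (l (u [^] m \<otimes> k)) < n" using m u less.prems \<open>0 < l k\<close> by linarith
      from less.IH[OF this refl Qmult[OF Qm less.prems(2)]]
      obtain i :: int where "u [^] m \<otimes> k = u [^] i" ..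
      then have "k = inv (u [^] m) \<otimes> u [^] i" using u less.prems by (simp add: inv_solve_left)
      also have "\<dots> = u [^] (- m + i)" using u by (simp add: int_pow_mult int_pow_neg del: add_uminus_conv_diff uminus_add_conv_diff)
      finally show ?thesis ..
    qed
  qed
  with u uu that show ?thesis by blast
qed

text \<open>The centralizer of \<open>g\<close> is infinite cyclic, and the point is that its
  generator is malnormal. Lengths of high powers force a conjugation between powers of
  \<open>u\<close> to preserve the absolute value of the exponent, and a change of sign would
  produce an element of order two. \<open>free\<close> speaks of all nontrivial \<open>x\<close>
  commuting with \<open>g\<close> since it is applied to powers of \<open>u\<close> too.\<close>

lemma maximal_cyclic:
  assumes g: "g \<in> carrier G" "l (g \<otimes> g) = 2 * l g" "0 < l g"
    and free: "\<And>x k. x \<in> carrier G \<Longrightarrow> x \<noteq> \<one> \<Longrightarrow> g \<otimes> x = x \<otimes> g \<Longrightarrow> k \<in> carrier G \<Longrightarrow>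
      x \<otimes> k = k \<otimes> x \<Longrightarrow> l k = 0 \<Longrightarrow> k = \<one>"
    and tf: "\<And>x. x \<in> carrier G \<Longrightarrow> x \<otimes> x = \<one> \<Longrightarrow> x = \<one>"
  shows "\<exists>u. malnormal_cyclic G u \<and> (\<exists>n::int. g = u [^] n)"
proof -
  have g1: "g \<noteq> \<one>" using g l_one by auto
  obtain u where u: "u \<in> carrier G" "l (u \<otimes> u) = 2 * l u" "0 < l u" "g \<otimes> u = u \<otimes> g"
    and gen: "\<And>k. k \<in> carrier G \<Longrightarrow> g \<otimes> k = k \<otimes> g \<Longrightarrow> \<exists>n::int. k = u [^] n"
    using cyclic_centralizer[OF g] free[OF g(1) g1 refl] by blast
  have lu: "l (u [^] n) = \<bar>n\<bar> * l u" for n :: int by (rule l_int_pow[OF u(1-3)])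
  have inf: "n = 0" if "u [^] n = \<one>" for n :: int using lu[of n] that l_one u(3) by simp
  obtain i :: int where i: "g = u [^] i" using gen[OF g(1) refl] ..
  have gu: "g \<otimes> u [^] m = u [^] m \<otimes> g" for m :: int
    using u(1) unfolding i by (simp add: int_pow_mult[symmetric] add.commute)
  \<comment> \<open>The centralizer of \<open>u^m\<close> is cyclic as well, hence abelian, and
    contains both \<open>g\<close> and \<open>q\<close>. So \<open>q\<close> commutes with
    \<open>g\<close>.\<close>
  have cent: "\<exists>n::int. q = u [^] n"
    if q: "q \<in> carrier G" "q \<otimes> u [^] m = u [^] m \<otimes> q" and m: "m \<noteq> 0" for q and m :: int
  proof -
    have m1: "u [^] m \<noteq> \<one>" using inf m by blast
    have "l (u [^] m \<otimes> u [^] m) = 2 * l (u [^] m)" "0 < l (u [^] m)"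
      using u m by (simp_all add: int_pow_mult[symmetric] lu)
    then obtain v where v: "v \<in> carrier G"
      and gv: "\<And>k. k \<in> carrier G \<Longrightarrow> u [^] m \<otimes> k = k \<otimes> u [^] m \<Longrightarrow> \<exists>n::int. k = v [^] n"
      using cyclic_centralizer[of "u [^] m"] free[of "u [^] m"] gu u m1 by (metis int_pow_closed)
    obtain a b :: int where "q = v [^] a" "g = v [^] b" using gv q g(1) gu by metis
    then have "g \<otimes> q = q \<otimes> g" using v by (simp add: int_pow_mult[symmetric] add.commute)
    then show ?thesis using gen q by blast
  qed
  have le: "\<bar>k\<bar> \<le> \<bar>m\<bar>"
    if q: "q \<in> carrier G" "q \<otimes> u [^] m \<otimes> inv q = u [^] k" for q and m k :: int
  proof (rule ccontr)
    assume less: "\<not> \<bar>k\<bar> \<le> \<bar>m\<bar>"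
    \<comment> \<open>For the \<open>n\<close>-th powers the length
      \<open>\<bar>k\<bar> * n * l u\<close> is at most
      \<open>2 * l q + \<bar>m\<bar> * n * l u\<close>. This \<open>n\<close> makes the difference
      of the two multiples exceed the constant \<open>2 * l q\<close>.\<close>
    define n where "n = 2 * l q + 1"
    have np: "0 < n" using l_nonneg[OF q(1)] by (simp add: n_def)
    have "q \<otimes> u [^] (m * n) \<otimes> inv q = u [^] (k * n)"
      using conj_int_pow[of q "u [^] m" n] q u by (simp add: int_pow_pow)
    then have "l (u [^] (k * n)) \<le> l q + l (u [^] (m * n)) + l q"
      using l_mult[of "q \<otimes> u [^] (m * n)" "inv q"] l_mult[of q "u [^] (m * n)"] q u
      by (simp add: l_inv)
    then have "\<bar>k\<bar> * n * l u \<le> 2 * l q + \<bar>m\<bar> * n * l u" using np by (simp add: lu abs_mult)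
    moreover have "(\<bar>m\<bar> + 1) * (n * l u) \<le> \<bar>k\<bar> * (n * l u)"
      using less np u by (intro mult_right_mono) auto
    ultimately have "n * l u \<le> 2 * l q" by (simp add: algebra_simps)
    moreover have "n \<le> n * l u" using np u by (simp add: mult_le_cancel_left1)
    ultimately show False by (simp add: n_def)
  qed
  have mal: "\<exists>n::int. q = u [^] n"
    if q: "q \<in> carrier G" "q \<otimes> u [^] m \<otimes> inv q = u [^] k" "u [^] k \<noteq> \<one>" for q and m k :: int
  proof -
    have e: "q \<otimes> u [^] m = u [^] k \<otimes> q" using q u by (simp add: inv_solve_right')
    have "inv q \<otimes> u [^] k \<otimes> q = u [^] m" using e q u by (simp add: m_assoc inv_solve_left')
    then have "\<bar>m\<bar> \<le> \<bar>k\<bar>" using le[of "inv q" k m] q by simp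
    moreover have "\<bar>k\<bar> \<le> \<bar>m\<bar>" using le q by blast
    ultimately have "k = m \<or> k = - m" by arith
    moreover have k0: "k \<noteq> 0" using q by auto
    \<comment> \<open>If \<open>q\<close> inverts \<open>u^m\<close>, then \<open>q q\<close>
      centralizes it and is some \<open>u^s\<close>. Conjugation by \<open>q\<close> fixes
      \<open>u^s\<close> but inverts \<open>u^(m s)\<close>, so \<open>s = 0\<close> and
      \<open>q q\<close> is trivial.\<close>
    moreover have False if k: "k = - m"
    proof -
      have m0: "m \<noteq> 0" using k k0 by simp
      have "q \<otimes> u [^] (- m) \<otimes> inv q = u [^] m"
        using conj_int_pow[of q "u [^] m" "-1"] q u k by (simp add: int_pow_pow)
      then have e': "q \<otimes> u [^] (- m) = u [^] m \<otimes> q" using q u by (simp add: inv_solve_right')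
      have "(q \<otimes> q) \<otimes> u [^] m = u [^] m \<otimes> (q \<otimes> q)"
        using e e' q u k by (simp add: m_assoc) (simp add: m_assoc[symmetric])
      then obtain s :: int where s: "q \<otimes> q = u [^] s" using cent m0 q by blast
      have qs: "q \<otimes> u [^] s \<otimes> inv q = u [^] s"
        unfolding s[symmetric] using q by (simp add: m_assoc)
      have "u [^] (k * s) = q \<otimes> u [^] (m * s) \<otimes> inv q"
        using conj_int_pow[of q "u [^] m" s] q u by (simp add: int_pow_pow)
      also have "\<dots> = u [^] (s * m)"
        using conj_int_pow[of q "u [^] s" m] q qs u by (simp add: int_pow_pow mult.commute)
      finally have "u [^] (k * s - s * m) = \<one>" using u by (simp add: int_pow_diff)
      then have "s = 0" using inf[of "k * s - s * m"] k m0 by simp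
      then have "q \<otimes> q = \<one>" using s by simp
      then have "q = \<one>" by (rule tf[OF q(1)])
      then have "u [^] m = u [^] k" using q(2) u by simp
      then have "u [^] (m - k) = \<one>" using u by (simp add: int_pow_diff)
      then show False using inf[of "m - k"] k m0 by simp
    qed
    ultimately show ?thesis using cent[of q m] e q by blast
  qed
  have "malnormal_cyclic G u"
    unfolding malnormal_cyclic_def
  proof (intro conjI ballI allI impI)
    show "\<exists>n::int. q = u [^] n" if "q \<in> carrier G" "q \<otimes> u [^] m \<otimes> inv q = u [^] k" "u [^] k \<noteq> \<one>"
      for q and m k :: int by (rule mal[OF that])
  qed (use u(1) inf in auto)
  then show ?thesis using i by blast
qed

end

section \<open>The amalgamated product and its normal forms\<close>

definition axial :: "('a, 'r) ring_scheme \<Rightarrow> ('g, 'm) monoid_scheme \<Rightarrow> ('a \<Rightarrow> 'g) set \<Rightarrow> 'g \<Rightarrow> bool" where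
  "axial R G E x \<longleftrightarrow>
     (\<exists>p\<in>carrier G. \<exists>e\<in>E. \<exists>a\<in>carrier R. x = p \<otimes>\<^bsub>G\<^esub> e a \<otimes>\<^bsub>G\<^esub> inv\<^bsub>G\<^esub> p)"

locale axis_family = R: ring R + G: group G
  for R :: "('a, 'r) ring_scheme" and G :: "('g, 'm) monoid_scheme" (structure) +
  fixes E :: "('a \<Rightarrow> 'g) set"
  assumes axis_closed [simp]: "e \<in> E \<Longrightarrow> a \<in> carrier R \<Longrightarrow> e a \<in> carrier G"
    and axis_add: "e \<in> E \<Longrightarrow> a \<in> carrier R \<Longrightarrow> b \<in> carrier R \<Longrightarrow> e (a \<oplus>\<^bsub>R\<^esub> b) = e a \<otimes> e b"
    and axis_inj: "e \<in> E \<Longrightarrow> a \<in> carrier R \<Longrightarrow> e a = \<one> \<Longrightarrow> a = \<zero>\<^bsub>R\<^esub>"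
    and axis_malnormal: "e \<in> E \<Longrightarrow> e' \<in> E \<Longrightarrow> g \<in> carrier G \<Longrightarrow> a \<in> carrier R \<Longrightarrow> b \<in> carrier R \<Longrightarrow>
      g \<otimes> e a \<otimes> inv g = e' b \<Longrightarrow> e' b \<noteq> \<one> \<Longrightarrow> e = e' \<and> (\<exists>c\<in>carrier R. g = e c)"

text \<open>One copy of \<open>R\<close> per index is glued to the centre \<open>G\<close> along
  \<open>C j\<close>, embedded by \<open>\<kappa> j\<close>. The subgroups \<open>C j\<close> may be
  trivial: over the trivial group this is the free product of copies of \<open>R\<close>, the first
  stage. By \<open>cover\<close>, the elements that still lack an axis are conjugate into some
  \<open>C j\<close>, and these receive one.\<close>

locale star_amalgam = axis_family R G E
  for R :: "('a, 'r) ring_scheme" and G :: "('g, 'm) monoid_scheme" (structure) and E +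
  fixes J :: "'j set" and C :: "'j \<Rightarrow> 'g set" and \<kappa> :: "'j \<Rightarrow> 'g \<Rightarrow> 'a"
  assumes C_subgroup: "j \<in> J \<Longrightarrow> subgroup (C j) G"
    and \<kappa>_closed [simp]: "j \<in> J \<Longrightarrow> c \<in> C j \<Longrightarrow> \<kappa> j c \<in> carrier R"
    and \<kappa>_mult: "j \<in> J \<Longrightarrow> c \<in> C j \<Longrightarrow> d \<in> C j \<Longrightarrow> \<kappa> j (c \<otimes> d) = \<kappa> j c \<oplus>\<^bsub>R\<^esub> \<kappa> j d"
    and \<kappa>_inj: "j \<in> J \<Longrightarrow> c \<in> C j \<Longrightarrow> \<kappa> j c = \<zero>\<^bsub>R\<^esub> \<Longrightarrow> c = \<one>"
    and C_malnormal: "j \<in> J \<Longrightarrow> k \<in> J \<Longrightarrow> g \<in> carrier G \<Longrightarrow> c \<in> C j \<Longrightarrow> g \<otimes> c \<otimes> inv g \<in> C k \<Longrightarrow>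
      c \<noteq> \<one> \<Longrightarrow> j = k \<and> g \<in> C j"
    and C_axis: "j \<in> J \<Longrightarrow> e \<in> E \<Longrightarrow> g \<in> carrier G \<Longrightarrow> a \<in> carrier R \<Longrightarrow> g \<otimes> e a \<otimes> inv g \<in> C j \<Longrightarrow> e a = \<one>"
    and cover: "x \<in> carrier G \<Longrightarrow> x \<noteq> \<one> \<Longrightarrow>
      axial R G E x \<or> (\<exists>p\<in>carrier G. \<exists>j\<in>J. \<exists>c\<in>C j. x = p \<otimes> c \<otimes> inv p)"
    and no_two_torsion: "a \<in> carrier R \<Longrightarrow> a \<oplus>\<^bsub>R\<^esub> a = \<zero>\<^bsub>R\<^esub> \<Longrightarrow> a = \<zero>\<^bsub>R\<^esub>"

text \<open>\<open>Nd r j t n\<close> stands for the product \<open>r t n\<close>, where \<open>r\<close> represents a left coset of \<open>C j\<close> in \<open>G\<close> and \<open>t\<close>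
  a nontrivial coset of \<open>C j\<close> in the \<open>j\<close>-th copy of \<open>R\<close>. The nodes of a normal form \<open>x\<close> spell the
  path from \<open>G\<close> to \<open>x G\<close> in the Bass--Serre tree; in \<open>lcp\<close> a shared vertex of type \<open>R\<close> counts
  one half of a shared node, and \<open>dst\<close> is half the distance in the tree.\<close>

datatype ('g, 'j, 'a) nf = Tip 'g | Nd 'g 'j 'a "('g, 'j, 'a) nf"

primrec len :: "('g, 'j, 'a) nf \<Rightarrow> nat" where
  "len (Tip g) = 0"
| "len (Nd r j t n) = Suc (len n)"

fun lcp :: "('g, 'j, 'a) nf \<Rightarrow> ('g, 'j, 'a) nf \<Rightarrow> nat" where
  "lcp (Nd r j t n) (Nd r' j' t' n') =
     (if r = r' \<and> j = j' then if t = t' then 2 + lcp n n' else 1 else 0)"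
| "lcp _ _ = 0"

definition dst :: "('g, 'j, 'a) nf \<Rightarrow> ('g, 'j, 'a) nf \<Rightarrow> int" where
  "dst x y = int (len x) + int (len y) - int (lcp x y)"

lemma lcp_commute: "lcp x y = lcp y x"
  by (induction x y rule: lcp.induct) auto

text \<open>For paths from a common root: what two of them share with a third one they share with
  each other, up to the shorter of the two parts.\<close>

lemma lcp_ultrametric: "min (lcp x y) (lcp y z) \<le> lcp x z"
proof (induction x z arbitrary: y rule: lcp.induct)
  case (1 r j t n r' j' t' n')
  then show ?case by (cases y) auto
next
  case ("2_1" g z) then show ?case by (cases y; cases z) auto
next
  case ("2_2" x g) then show ?case by (cases y; cases x) auto
qed

lemma lcp_same [simp]: "lcp x x = 2 * len x"
  by (induction x) auto

lemma dst_same [simp]: "dst x x = 0"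
  by (simp add: dst_def)

lemma dst_Tip [simp]: "dst (Tip g) y = int (len y)" "dst y (Tip g) = int (len y)"
  by (simp_all add: dst_def lcp_commute[of y])

text \<open>The letters are the six edges of a complete graph on four points, with \<open>a\<close>,
  \<open>b\<close> opposite, and likewise \<open>c\<close>, \<open>d\<close> and \<open>e\<close>,
  \<open>f\<close>. Each group of three hypotheses is a triangle, in which the smallest value occurs
  twice.\<close>

lemma isosceles_four_point:
  fixes a b c d e f :: nat
  assumes "a \<ge> c \<or> a \<ge> f" "c \<ge> a \<or> c \<ge> f" "f \<ge> a \<or> f \<ge> c"
    "a \<ge> e \<or> a \<ge> d" "e \<ge> a \<or> e \<ge> d" "d \<ge> a \<or> d \<ge> e"
    "b \<ge> c \<or> b \<ge> e" "c \<ge> b \<or> c \<ge> e" "e \<ge> b \<or> e \<ge> c"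
    "b \<ge> f \<or> b \<ge> d" "f \<ge> b \<or> f \<ge> d" "d \<ge> b \<or> d \<ge> f"
  shows "c + d \<le> a + b \<or> e + f \<le> a + b"
  using assms by (smt (verit) add_mono add.commute le_trans)

text \<open>Each of the four lengths occurs once in each of the three sums and cancels, so only the
  overlaps are compared.\<close>

lemma dst_four_point: "dst x y + dst z w \<le> max (dst x z + dst y w) (dst x w + dst y z)"
proof -
  have u: "lcp x z \<ge> lcp x y \<or> lcp x z \<ge> lcp y z" for x y z :: "('a, 'b, 'c) nf"
    using lcp_ultrametric[of x y z] by linarith
  have "lcp x z + lcp y w \<le> lcp x y + lcp z w \<or> lcp x w + lcp y z \<le> lcp x y + lcp z w"
    by (rule isosceles_four_point) (metis u lcp_commute)+
  then show ?thesis unfolding dst_def by linarith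
qed

section \<open>Coset representatives and cofactors\<close>

context star_amalgam
begin

lemma C_carrier: "j \<in> J \<Longrightarrow> c \<in> C j \<Longrightarrow> c \<in> carrier G"
  by (rule subgroup.mem_carrier[OF C_subgroup])

lemma C_closed [simp]:
  "j \<in> J \<Longrightarrow> \<one> \<in> C j"
  "j \<in> J \<Longrightarrow> c \<in> C j \<Longrightarrow> inv c \<in> C j"
  "j \<in> J \<Longrightarrow> c \<in> C j \<Longrightarrow> d \<in> C j \<Longrightarrow> c \<otimes> d \<in> C j"
  by (rule subgroup.one_closed[OF C_subgroup] subgroup.m_inv_closed[OF C_subgroup]
      subgroup.m_closed[OF C_subgroup]; assumption)+

lemma \<kappa>_one [simp]: assumes "j \<in> J" shows "\<kappa> j \<one> = \<zero>\<^bsub>R\<^esub>"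
proof -
  have "\<kappa> j (\<one> \<otimes> \<one>) = \<kappa> j \<one> \<oplus>\<^bsub>R\<^esub> \<kappa> j \<one>" using assms by (intro \<kappa>_mult) simp_all
  then show ?thesis using assms R.add.l_cancel_one[of "\<kappa> j \<one>" "\<kappa> j \<one>"] by simp
qed

lemma \<kappa>_inv: "j \<in> J \<Longrightarrow> c \<in> C j \<Longrightarrow> \<kappa> j (inv c) = \<ominus>\<^bsub>R\<^esub> \<kappa> j c"
  using \<kappa>_mult[of j "inv c" c] R.minus_equality[of "\<kappa> j (inv c)" "\<kappa> j c"] C_carrier[of j c] by simp

lemma \<kappa>_eq_iff: assumes "j \<in> J" "c \<in> C j" "d \<in> C j" shows "\<kappa> j c = \<kappa> j d \<longleftrightarrow> c = d"
proof
  assume "\<kappa> j c = \<kappa> j d"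
  then have "\<kappa> j (c \<otimes> inv d) = \<zero>\<^bsub>R\<^esub>" using assms by (simp add: \<kappa>_mult \<kappa>_inv R.r_neg)
  then have "c \<otimes> inv d = \<one>" using \<kappa>_inj assms by simp
  then show "c = d" using assms C_carrier by (metis G.inv_closed G.inv_equality G.inv_inv)
qed simp

text \<open>The coset of \<open>C j\<close> itself is represented by the unit, so a unit
  \<open>r\<close> in a node marks that no letter from \<open>G\<close> precedes \<open>t\<close>.
  The cofactor is the part in \<open>C j\<close> that is left over and will be pushed to the right;
  \<open>arep\<close> and \<open>acof\<close> do the same for the cosets of
  \<open>\<kappa> j\<close> in \<open>R\<close>.\<close>

definition lrep :: "'j \<Rightarrow> 'g \<Rightarrow> 'g" where
  "lrep j g = (if g \<in> C j then \<one> else SOME h. h \<in> carrier G \<and> inv g \<otimes> h \<in> C j)"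

definition lcof :: "'j \<Rightarrow> 'g \<Rightarrow> 'g" where
  "lcof j g = inv (lrep j g) \<otimes> g"

definition arep :: "'j \<Rightarrow> 'a \<Rightarrow> 'a" where
  "arep j a = (if a \<in> \<kappa> j ` C j then \<zero>\<^bsub>R\<^esub> else SOME b. b \<in> carrier R \<and> (\<exists>c\<in>C j. b = a \<oplus>\<^bsub>R\<^esub> \<kappa> j c))"

definition acof :: "'j \<Rightarrow> 'a \<Rightarrow> 'g" where
  "acof j a = (SOME c. c \<in> C j \<and> a = arep j a \<oplus>\<^bsub>R\<^esub> \<kappa> j c)"

lemma lrep_props:
  assumes "j \<in> J" "g \<in> carrier G"
  shows "lrep j g \<in> carrier G" "inv g \<otimes> lrep j g \<in> C j"
proof -
  have "\<exists>h. h \<in> carrier G \<and> inv g \<otimes> h \<in> C j" using assms by (intro exI[of _ g]) simp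
  from someI_ex[OF this] show "lrep j g \<in> carrier G" "inv g \<otimes> lrep j g \<in> C j"
    using assms by (auto simp: lrep_def)
qed

lemma lcof_in [simp]: "j \<in> J \<Longrightarrow> g \<in> carrier G \<Longrightarrow> lcof j g \<in> C j"
  using lrep_props[of j g] C_closed(2)[of j "inv g \<otimes> lrep j g"]
  by (simp add: lcof_def G.inv_mult_group)

lemma lrep_closed [simp]: "j \<in> J \<Longrightarrow> g \<in> carrier G \<Longrightarrow> lrep j g \<in> carrier G"
  using lrep_props by blast

lemma lcof_closed [simp]: "j \<in> J \<Longrightarrow> g \<in> carrier G \<Longrightarrow> lcof j g \<in> carrier G"
  by (simp add: C_carrier)

lemma lrep_lcof: "j \<in> J \<Longrightarrow> g \<in> carrier G \<Longrightarrow> lrep j g \<otimes> lcof j g = g"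
  by (simp add: lcof_def G.m_assoc[symmetric])

lemma C_mult_iff [simp]:
  assumes "j \<in> J" "c \<in> C j" "g \<in> carrier G"
  shows "g \<otimes> c \<in> C j \<longleftrightarrow> g \<in> C j" "c \<otimes> g \<in> C j \<longleftrightarrow> g \<in> C j"
proof -
  have c: "c \<in> carrier G" using assms C_carrier by blast
  have 1: "g \<otimes> c \<otimes> inv c = g" "inv c \<otimes> (c \<otimes> g) = g"
    using assms(3) c by (simp_all add: G.m_assoc G.inv_solve_left')
  show "g \<otimes> c \<in> C j \<longleftrightarrow> g \<in> C j" "c \<otimes> g \<in> C j \<longleftrightarrow> g \<in> C j"
    using 1 C_closed(2)[OF assms(1,2)] C_closed(3)[OF assms(1), of "g \<otimes> c" "inv c"]
      C_closed(3)[OF assms(1), of "inv c" "c \<otimes> g"] C_closed(3)[OF assms(1), of g c]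
      C_closed(3)[OF assms(1), of c g] assms(2) by metis+
qed

text \<open>The predicate under \<open>SOME\<close> depends only on the coset, so the
  representatives are equal and not merely congruent.\<close>

lemma lrep_mult: assumes "j \<in> J" "g \<in> carrier G" "c \<in> C j" shows "lrep j (g \<otimes> c) = lrep j g"
proof -
  have c: "c \<in> carrier G" using assms C_carrier by blast
  have "inv (g \<otimes> c) \<otimes> h \<in> C j \<longleftrightarrow> inv g \<otimes> h \<in> C j" if "h \<in> carrier G" for h
    using assms c that by (simp add: G.inv_mult_group G.m_assoc)
  then have "(\<lambda>h. h \<in> carrier G \<and> inv (g \<otimes> c) \<otimes> h \<in> C j) = (\<lambda>h. h \<in> carrier G \<and> inv g \<otimes> h \<in> C j)"
    by auto
  then show ?thesis unfolding lrep_def using assms by simp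
qed

lemma lrep_idem [simp]: assumes "j \<in> J" "g \<in> carrier G" shows "lrep j (lrep j g) = lrep j g"
  using lrep_mult[of j "lrep j g" "lcof j g"] assms by (simp add: lrep_lcof)

lemma lrep_eqI: "j \<in> J \<Longrightarrow> r \<in> carrier G \<Longrightarrow> lrep j r = r \<Longrightarrow> c \<in> C j \<Longrightarrow> lrep j (r \<otimes> c) = r"
  by (simp add: lrep_mult)

lemma lcof_eqI: "j \<in> J \<Longrightarrow> r \<in> carrier G \<Longrightarrow> lrep j r = r \<Longrightarrow> c \<in> C j \<Longrightarrow> lcof j (r \<otimes> c) = c"
  by (simp add: lcof_def lrep_mult G.m_assoc[symmetric] C_carrier)

lemma lrep_one_iff: "j \<in> J \<Longrightarrow> g \<in> carrier G \<Longrightarrow> lrep j g = \<one> \<longleftrightarrow> g \<in> C j"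
  using lrep_props(2)[of j g] C_closed(2)[of j "inv g"] by (auto simp: lrep_def split: if_splits)

lemma lcof_C: "j \<in> J \<Longrightarrow> c \<in> C j \<Longrightarrow> lcof j c = c"
  using C_carrier by (simp add: lcof_def lrep_def)

lemma arep_props:
  assumes "j \<in> J" "a \<in> carrier R"
  shows "arep j a \<in> carrier R" "\<exists>c\<in>C j. arep j a = a \<oplus>\<^bsub>R\<^esub> \<kappa> j c"
proof -
  have "\<exists>b. b \<in> carrier R \<and> (\<exists>c\<in>C j. b = a \<oplus>\<^bsub>R\<^esub> \<kappa> j c)"
    using assms by (intro exI[of _ a]) (auto intro!: bexI[of _ \<one>])
  note * = someI_ex[OF this]
  have "arep j a \<in> carrier R \<and> (\<exists>c\<in>C j. arep j a = a \<oplus>\<^bsub>R\<^esub> \<kappa> j c)"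
  proof (cases "a \<in> \<kappa> j ` C j")
    case True
    then obtain c where c: "c \<in> C j" "a = \<kappa> j c" by blast
    then have "\<zero>\<^bsub>R\<^esub> = a \<oplus>\<^bsub>R\<^esub> \<kappa> j (inv c)" using assms by (simp add: \<kappa>_inv R.r_neg)
    then show ?thesis using True c assms by (auto simp: arep_def intro!: bexI[of _ "inv c"])
  next
    case False
    then show ?thesis using * by (simp add: arep_def)
  qed
  then show "arep j a \<in> carrier R" "\<exists>c\<in>C j. arep j a = a \<oplus>\<^bsub>R\<^esub> \<kappa> j c" by auto
qed

lemma arep_closed [simp]: "j \<in> J \<Longrightarrow> a \<in> carrier R \<Longrightarrow> arep j a \<in> carrier R"
  using arep_props by blast

lemma acof_props:
  assumes "j \<in> J" "a \<in> carrier R"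
  shows "acof j a \<in> C j" "arep j a \<oplus>\<^bsub>R\<^esub> \<kappa> j (acof j a) = a"
proof -
  obtain c where c: "c \<in> C j" "arep j a = a \<oplus>\<^bsub>R\<^esub> \<kappa> j c" using arep_props assms by blast
  have "inv c \<in> C j \<and> a = arep j a \<oplus>\<^bsub>R\<^esub> \<kappa> j (inv c)"
    using c assms by (simp add: \<kappa>_inv R.a_assoc R.r_neg)
  from someI[of "\<lambda>c. c \<in> C j \<and> a = arep j a \<oplus>\<^bsub>R\<^esub> \<kappa> j c", OF this]
  show "acof j a \<in> C j" "arep j a \<oplus>\<^bsub>R\<^esub> \<kappa> j (acof j a) = a"
    unfolding acof_def by auto
qed

lemma acof_in [simp]: "j \<in> J \<Longrightarrow> a \<in> carrier R \<Longrightarrow> acof j a \<in> C j"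
  using acof_props by blast

lemma acof_closed [simp]: "j \<in> J \<Longrightarrow> a \<in> carrier R \<Longrightarrow> acof j a \<in> carrier G"
  by (simp add: C_carrier)

lemma arep_add: assumes "j \<in> J" "a \<in> carrier R" "c \<in> C j" shows "arep j (a \<oplus>\<^bsub>R\<^esub> \<kappa> j c) = arep j a"
proof -
  have "(\<exists>d\<in>C j. b = a \<oplus>\<^bsub>R\<^esub> \<kappa> j c \<oplus>\<^bsub>R\<^esub> \<kappa> j d) \<longleftrightarrow> (\<exists>d\<in>C j. b = a \<oplus>\<^bsub>R\<^esub> \<kappa> j d)" for b
  proof safe
    fix d assume "d \<in> C j"
    then show "\<exists>d'\<in>C j. a \<oplus>\<^bsub>R\<^esub> \<kappa> j c \<oplus>\<^bsub>R\<^esub> \<kappa> j d = a \<oplus>\<^bsub>R\<^esub> \<kappa> j d'"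
      using assms by (intro bexI[of _ "c \<otimes> d"]) (simp_all add: \<kappa>_mult R.a_assoc)
    show "\<exists>d'\<in>C j. a \<oplus>\<^bsub>R\<^esub> \<kappa> j d = a \<oplus>\<^bsub>R\<^esub> \<kappa> j c \<oplus>\<^bsub>R\<^esub> \<kappa> j d'"
      using assms \<open>d \<in> C j\<close> by (intro bexI[of _ "inv c \<otimes> d"]) (simp_all add: \<kappa>_mult \<kappa>_inv R.a_assoc R.r_neg2)
  qed
  moreover have "a \<oplus>\<^bsub>R\<^esub> \<kappa> j c \<in> \<kappa> j ` C j \<longleftrightarrow> a \<in> \<kappa> j ` C j"
  proof
    assume "a \<oplus>\<^bsub>R\<^esub> \<kappa> j c \<in> \<kappa> j ` C j"
    then obtain d where d: "d \<in> C j" "a \<oplus>\<^bsub>R\<^esub> \<kappa> j c = \<kappa> j d" by auto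
    have "a = a \<oplus>\<^bsub>R\<^esub> \<kappa> j c \<oplus>\<^bsub>R\<^esub> \<kappa> j (inv c)" using assms by (simp add: \<kappa>_inv R.a_assoc R.r_neg)
    also have "\<dots> = \<kappa> j (d \<otimes> inv c)" using d assms by (simp add: \<kappa>_mult)
    finally show "a \<in> \<kappa> j ` C j" using d assms by simp
  next
    assume "a \<in> \<kappa> j ` C j"
    then obtain d where "d \<in> C j" "a = \<kappa> j d" by auto
    then have "a \<oplus>\<^bsub>R\<^esub> \<kappa> j c = \<kappa> j (d \<otimes> c)" using assms by (simp add: \<kappa>_mult)
    then show "a \<oplus>\<^bsub>R\<^esub> \<kappa> j c \<in> \<kappa> j ` C j" using \<open>d \<in> C j\<close> assms by simp
  qed
  ultimately show ?thesis unfolding arep_def by simp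
qed

lemma arep_idem [simp]: assumes "j \<in> J" "a \<in> carrier R" shows "arep j (arep j a) = arep j a"
  using arep_add[of j "arep j a" "acof j a"] assms by (simp add: acof_props)

lemma acof_eqI:
  assumes "j \<in> J" "t \<in> carrier R" "arep j t = t" "c \<in> C j"
  shows "acof j (t \<oplus>\<^bsub>R\<^esub> \<kappa> j c) = c"
proof -
  have "t \<oplus>\<^bsub>R\<^esub> \<kappa> j (acof j (t \<oplus>\<^bsub>R\<^esub> \<kappa> j c)) = t \<oplus>\<^bsub>R\<^esub> \<kappa> j c"
    using acof_props(2)[of j "t \<oplus>\<^bsub>R\<^esub> \<kappa> j c"] assms by (simp add: arep_add)
  then show ?thesis using assms by (simp add: \<kappa>_eq_iff)
qed

lemma arep_\<kappa> [simp]: "j \<in> J \<Longrightarrow> c \<in> C j \<Longrightarrow> arep j (\<kappa> j c) = \<zero>\<^bsub>R\<^esub>"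
  by (simp add: arep_def)

lemma arep_zero [simp]: assumes "j \<in> J" shows "arep j \<zero>\<^bsub>R\<^esub> = \<zero>\<^bsub>R\<^esub>"
  using arep_\<kappa>[of j \<one>] assms by (simp del: arep_\<kappa>)

lemma acof_\<kappa> [simp]: "j \<in> J \<Longrightarrow> c \<in> C j \<Longrightarrow> acof j (\<kappa> j c) = c"
  using acof_eqI[of j "\<zero>\<^bsub>R\<^esub>" c] by simp

section \<open>Normal forms and the actions of the factors on them\<close>

primrec starts :: "'j \<Rightarrow> ('g, 'j, 'a) nf \<Rightarrow> bool" where
  "starts j (Tip g) = False"
| "starts j (Nd r i t n) = (r = \<one> \<and> i = j)"

text \<open>A normal form is \<open>r1 t1 ... rn tn g\<close>: every letter but the last is a chosen
  representative, and the final \<open>g\<close> is arbitrary in \<open>G\<close>. A unit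
  \<open>r\<close> may occur between letters of different copies; \<open>\<not> starts j n\<close>
  forbids it only where two letters of the same copy would meet.\<close>

primrec nf :: "('g, 'j, 'a) nf \<Rightarrow> bool" where
  "nf (Tip g) = (g \<in> carrier G)"
| "nf (Nd r j t n) = (r \<in> carrier G \<and> j \<in> J \<and> lrep j r = r \<and> t \<in> carrier R \<and> arep j t = t \<and>
      t \<noteq> \<zero>\<^bsub>R\<^esub> \<and> nf n \<and> \<not> starts j n)"

text \<open>Left multiplication by \<open>h\<close>: the product \<open>h r\<close> is split into
  representative and cofactor. Inside the abelian copy of \<open>R\<close> the cofactor commutes
  with \<open>t\<close>, so \<open>t\<close> stays and the cofactor passes on to the tail.\<close>

primrec gact :: "'g \<Rightarrow> ('g, 'j, 'a) nf \<Rightarrow> ('g, 'j, 'a) nf" where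
  "gact h (Tip g) = Tip (h \<otimes> g)"
| "gact h (Nd r j t n) = Nd (lrep j (h \<otimes> r)) j t (gact (lcof j (h \<otimes> r)) n)"

text \<open>A form is the product of \<open>top j\<close>, its initial letter from the
  \<open>j\<close>-th copy, and \<open>rest j\<close>. The default zero stands for a missing letter
  and spares \<open>aact\<close> the distinction whether the first letters merge, appear or
  cancel.\<close>

definition top :: "'j \<Rightarrow> ('g, 'j, 'a) nf \<Rightarrow> 'a" where
  "top j x = (case x of Tip g \<Rightarrow> \<zero>\<^bsub>R\<^esub> | Nd r i t n \<Rightarrow> if r = \<one> \<and> i = j then t else \<zero>\<^bsub>R\<^esub>)"

definition rest :: "'j \<Rightarrow> ('g, 'j, 'a) nf \<Rightarrow> ('g, 'j, 'a) nf" where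
  "rest j x = (case x of Tip g \<Rightarrow> x | Nd r i t n \<Rightarrow> if r = \<one> \<and> i = j then n else x)"

definition cons :: "'j \<Rightarrow> 'a \<Rightarrow> ('g, 'j, 'a) nf \<Rightarrow> ('g, 'j, 'a) nf" where
  "cons j t y = (if t = \<zero>\<^bsub>R\<^esub> then y else Nd \<one> j t y)"

definition aact :: "'j \<Rightarrow> 'a \<Rightarrow> ('g, 'j, 'a) nf \<Rightarrow> ('g, 'j, 'a) nf" where
  "aact j a x = cons j (arep j (a \<oplus>\<^bsub>R\<^esub> top j x)) (gact (acof j (a \<oplus>\<^bsub>R\<^esub> top j x)) (rest j x))"

lemma len_gact [simp]: "len (gact h x) = len x"
  by (induction x arbitrary: h) auto

lemma starts_gact:
  assumes "j \<in> J" "c \<in> C j" "nf x" shows "starts j (gact c x) \<longleftrightarrow> starts j x"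
proof (cases x)
  case (Nd r i t n)
  then show ?thesis using assms C_carrier[of j c] lrep_one_iff[of j "c \<otimes> r"] lrep_one_iff[of j r] by auto
qed auto

lemma nf_gact [simp]: "h \<in> carrier G \<Longrightarrow> nf x \<Longrightarrow> nf (gact h x)"
  by (induction x arbitrary: h) (auto simp: starts_gact)

lemma gact_one [simp]: "nf x \<Longrightarrow> gact \<one> x = x"
  by (induction x) (auto simp: lcof_def)

lemma gact_gact: "g \<in> carrier G \<Longrightarrow> h \<in> carrier G \<Longrightarrow> nf x \<Longrightarrow> gact (g \<otimes> h) x = gact g (gact h x)"
proof (induction x arbitrary: g h)
  case (Tip x) then show ?case by (simp add: G.m_assoc)
next
  case (Nd r j t n)
  have j: "j \<in> J" and r: "r \<in> carrier G" using Nd.prems by auto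
  define r1 c1 where "r1 = lrep j (h \<otimes> r)" and "c1 = lcof j (h \<otimes> r)"
  define r2 c2 where "r2 = lrep j (g \<otimes> r1)" and "c2 = lcof j (g \<otimes> r1)"
  have C: "c1 \<in> C j" "c2 \<in> C j" "r1 \<in> carrier G" "r2 \<in> carrier G" "lrep j r2 = r2"
    using j r Nd.prems by (auto simp: c1_def c2_def r1_def r2_def)
  have Cc: "c1 \<in> carrier G" "c2 \<in> carrier G" using C j C_carrier by auto
  have "g \<otimes> h \<otimes> r = g \<otimes> (r1 \<otimes> c1)"
    using lrep_lcof[of j "h \<otimes> r"] j r Nd.prems by (simp add: r1_def c1_def G.m_assoc)
  also have "\<dots> = r2 \<otimes> (c2 \<otimes> c1)"
    using lrep_lcof[of j "g \<otimes> r1"] j r Nd.prems C Cc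
    by (simp add: r2_def[symmetric] c2_def[symmetric] G.m_assoc[symmetric])
  finally have "lrep j (g \<otimes> h \<otimes> r) = r2" "lcof j (g \<otimes> h \<otimes> r) = c2 \<otimes> c1"
    using C j by (simp_all add: lrep_eqI lcof_eqI)
  then show ?case
    using Nd.IH[of c2 c1] Nd.prems Cc by (simp add: r1_def[symmetric] c1_def[symmetric] r2_def c2_def)
qed

lemma cons_top_rest [simp]: "nf x \<Longrightarrow> cons j (top j x) (rest j x) = x"
  by (cases x) (auto simp: cons_def top_def rest_def)

lemma nf_top_rest:
  assumes "nf x" "j \<in> J"
  shows "nf (rest j x)" "\<not> starts j (rest j x)" "top j x \<in> carrier R" "arep j (top j x) = top j x"
  using assms by (cases x; auto simp: top_def rest_def)+

lemma nf_cons: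
  assumes "nf y" "\<not> starts j y" "j \<in> J" "t \<in> carrier R" "arep j t = t"
  shows "nf (cons j t y)" "top j (cons j t y) = t" "rest j (cons j t y) = y"
  using assms by (cases y; auto simp: cons_def top_def rest_def lrep_def)+

lemma aact_cons:
  assumes "nf y" "\<not> starts j y" "j \<in> J" "t \<in> carrier R" "arep j t = t"
  shows "aact j a (cons j t y) = cons j (arep j (a \<oplus>\<^bsub>R\<^esub> t)) (gact (acof j (a \<oplus>\<^bsub>R\<^esub> t)) y)"
  by (simp add: aact_def nf_cons[OF assms])

lemma nf_aact [simp]: "j \<in> J \<Longrightarrow> a \<in> carrier R \<Longrightarrow> nf x \<Longrightarrow> nf (aact j a x)"
  unfolding aact_def by (intro nf_cons) (simp_all add: nf_top_rest starts_gact)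

lemma aact_zero [simp]: "j \<in> J \<Longrightarrow> nf x \<Longrightarrow> aact j \<zero>\<^bsub>R\<^esub> x = x"
  using acof_eqI[of j "top j x" \<one>] by (simp add: aact_def nf_top_rest)

lemma aact_aact:
  assumes j: "j \<in> J" and a: "a \<in> carrier R" and b: "b \<in> carrier R" and x: "nf x"
  shows "aact j (a \<oplus>\<^bsub>R\<^esub> b) x = aact j a (aact j b x)"
proof -
  define t y where "t = top j x" and "y = rest j x"
  have ty: "t \<in> carrier R" "arep j t = t" "nf y" "\<not> starts j y" "cons j t y = x"
    using nf_top_rest x j by (auto simp: t_def y_def)
  define t1 c1 where "t1 = arep j (b \<oplus>\<^bsub>R\<^esub> t)" and "c1 = acof j (b \<oplus>\<^bsub>R\<^esub> t)"
  define t2 c2 where "t2 = arep j (a \<oplus>\<^bsub>R\<^esub> t1)" and "c2 = acof j (a \<oplus>\<^bsub>R\<^esub> t1)"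
  have C: "t1 \<in> carrier R" "c1 \<in> C j" "t2 \<in> carrier R" "arep j t2 = t2" "arep j t1 = t1" "c2 \<in> C j"
    using j a b ty by (auto simp: t1_def c1_def t2_def c2_def)
  have Cc: "c1 \<in> carrier G" "c2 \<in> carrier G" using C j C_carrier by auto
  have "a \<oplus>\<^bsub>R\<^esub> b \<oplus>\<^bsub>R\<^esub> t = a \<oplus>\<^bsub>R\<^esub> (t1 \<oplus>\<^bsub>R\<^esub> \<kappa> j c1)"
    using acof_props[of j "b \<oplus>\<^bsub>R\<^esub> t"] j a b ty by (simp add: t1_def c1_def R.a_assoc)
  also have "\<dots> = t2 \<oplus>\<^bsub>R\<^esub> \<kappa> j c2 \<oplus>\<^bsub>R\<^esub> \<kappa> j c1"
    using acof_props[of j "a \<oplus>\<^bsub>R\<^esub> t1"] j a b ty C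
    by (simp add: t2_def[symmetric] c2_def[symmetric] R.a_assoc)
  also have "\<dots> = t2 \<oplus>\<^bsub>R\<^esub> \<kappa> j (c2 \<otimes> c1)" using C j by (simp add: \<kappa>_mult R.a_assoc)
  finally have *: "arep j (a \<oplus>\<^bsub>R\<^esub> b \<oplus>\<^bsub>R\<^esub> t) = t2" "acof j (a \<oplus>\<^bsub>R\<^esub> b \<oplus>\<^bsub>R\<^esub> t) = c2 \<otimes> c1"
    using C j by (simp_all add: arep_add acof_eqI)
  have "aact j (a \<oplus>\<^bsub>R\<^esub> b) (cons j t y) = cons j t2 (gact c2 (gact c1 y))"
    using ty(1-4) j Cc by (simp add: aact_cons * gact_gact)
  also have "\<dots> = aact j a (cons j t1 (gact c1 y))"
    using ty(1-4) j Cc C by (simp add: aact_cons starts_gact t2_def c2_def)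
  also have "\<dots> = aact j a (aact j b (cons j t y))"
    using ty(1-4) j by (simp add: aact_cons t1_def c1_def)
  finally show ?thesis using ty by simp
qed

lemma lrep_C: "c \<in> C j \<Longrightarrow> lrep j c = \<one>"
  by (simp add: lrep_def)

text \<open>The two actions agree on the amalgamated subgroup, which is the relation that the
  product must respect. It holds because the image of \<open>c\<close> in \<open>R\<close> commutes
  with the top letter and passes it unchanged.\<close>

lemma aact_\<kappa>:
  assumes "j \<in> J" "c \<in> C j" "nf x"
  shows "aact j (\<kappa> j c) x = gact c x"
proof -
  have "\<kappa> j c \<oplus>\<^bsub>R\<^esub> top j x = top j x \<oplus>\<^bsub>R\<^esub> \<kappa> j c" using assms by (simp add: nf_top_rest R.a_comm)
  then have "aact j (\<kappa> j c) x = cons j (top j x) (gact c (rest j x))"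
    using assms by (simp add: aact_def arep_add acof_eqI nf_top_rest)
  also have "\<dots> = gact c (cons j (top j x) (rest j x))"
    using assms C_carrier[of j c] by (auto simp: cons_def lcof_C lrep_C)
  finally show ?thesis using assms by simp
qed

lemma dst_gact: "h \<in> carrier G \<Longrightarrow> nf x \<Longrightarrow> nf y \<Longrightarrow> dst (gact h x) (gact h y) = dst x y"
proof -
  have "lcp (gact h x) (gact h y) = lcp x y" if "h \<in> carrier G" "nf x" "nf y"
    using that
  proof (induction x y arbitrary: h rule: lcp.induct)
    case (1 r j t n r' j' t' n')
    \<comment> \<open>Left translation permutes the cosets of \<open>C j\<close>, so equal
      representatives after the translation come from equal ones before it.\<close>
    have "r = r'" if e: "lrep j (h \<otimes> r) = lrep j (h \<otimes> r')" "j = j'"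
    proof -
      have j: "j \<in> J" and c: "r \<in> carrier G" "r' \<in> carrier G" "lrep j r = r" "lrep j r' = r'"
        using 1 e by auto
      define c c' where "c = lcof j (h \<otimes> r)" and "c' = lcof j (h \<otimes> r')"
      have C: "c \<in> C j" "c' \<in> C j" "c \<in> carrier G" "c' \<in> carrier G"
        using j c 1 by (auto simp: c_def c'_def)
      have "h \<otimes> r \<otimes> inv c = lrep j (h \<otimes> r)" "h \<otimes> r' \<otimes> inv c' = lrep j (h \<otimes> r')"
        using lrep_lcof[of j "h \<otimes> r"] lrep_lcof[of j "h \<otimes> r'"] j c 1(2) C
        by (simp_all add: G.inv_solve_right' c_def c'_def)
      then have "h \<otimes> (r \<otimes> inv c) = h \<otimes> (r' \<otimes> inv c')" using e c C 1(2) by (simp add: G.m_assoc)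
      then have "r \<otimes> inv c = r' \<otimes> inv c'" using c C 1(2) by simp
      then have "lrep j (r \<otimes> inv c) = lrep j (r' \<otimes> inv c')" by simp
      then show "r = r'" using c C j by (simp add: lrep_mult)
    qed
    then show ?case using 1 by auto
  qed auto
  then show "h \<in> carrier G \<Longrightarrow> nf x \<Longrightarrow> nf y \<Longrightarrow> dst (gact h x) (gact h y) = dst x y"
    by (simp add: dst_def)
qed

text \<open>For different letters the value is the same whether or not one of them is zero: two
  nonzero letters add two nodes with overlap 1, and if one is zero, a single node is added with
  overlap 0, because the stripped form does not start with \<open>j\<close>.\<close>

lemma dst_cons:
  assumes "nf y" "\<not> starts j y" "nf y'" "\<not> starts j y'"
  shows "dst (cons j t y) (cons j t' y') =
    (if t = t' then dst y y' else int (len y) + int (len y') + 1)"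
  using assms by (cases y; cases y'; auto simp: cons_def dst_def)

lemma dst_aact:
  assumes j: "j \<in> J" and a: "a \<in> carrier R" and x: "nf x" and x': "nf x'"
  shows "dst (aact j a x) (aact j a x') = dst x x'"
proof -
  define t y t' y' where "t = top j x" and "y = rest j x" and "t' = top j x'" and "y' = rest j x'"
  have ty: "t \<in> carrier R" "arep j t = t" "nf y" "\<not> starts j y" "cons j t y = x"
    and ty': "t' \<in> carrier R" "arep j t' = t'" "nf y'" "\<not> starts j y'" "cons j t' y' = x'"
    using nf_top_rest x x' j by (auto simp: t_def y_def t'_def y'_def)
  have inj: "t = t'" if e: "arep j (a \<oplus>\<^bsub>R\<^esub> t) = arep j (a \<oplus>\<^bsub>R\<^esub> t')"
  proof -
    obtain c where c: "c \<in> C j" "arep j (a \<oplus>\<^bsub>R\<^esub> t) = a \<oplus>\<^bsub>R\<^esub> t \<oplus>\<^bsub>R\<^esub> \<kappa> j c"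
      using arep_props[of j "a \<oplus>\<^bsub>R\<^esub> t"] j a ty by auto
    obtain c' where c': "c' \<in> C j" "arep j (a \<oplus>\<^bsub>R\<^esub> t') = a \<oplus>\<^bsub>R\<^esub> t' \<oplus>\<^bsub>R\<^esub> \<kappa> j c'"
      using arep_props[of j "a \<oplus>\<^bsub>R\<^esub> t'"] j a ty' by auto
    have "a \<oplus>\<^bsub>R\<^esub> (t \<oplus>\<^bsub>R\<^esub> \<kappa> j c) = a \<oplus>\<^bsub>R\<^esub> (t' \<oplus>\<^bsub>R\<^esub> \<kappa> j c')"
      using e c c' j a ty ty' by (simp add: R.a_assoc)
    then have "t \<oplus>\<^bsub>R\<^esub> \<kappa> j c = t' \<oplus>\<^bsub>R\<^esub> \<kappa> j c'"
      using c c' j a ty ty' by simp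
    then have "arep j (t \<oplus>\<^bsub>R\<^esub> \<kappa> j c) = arep j (t' \<oplus>\<^bsub>R\<^esub> \<kappa> j c')" by simp
    then show ?thesis using c c' j ty ty' by (simp add: arep_add)
  qed
  have "dst (aact j a (cons j t y)) (aact j a (cons j t' y')) = dst (cons j t y) (cons j t' y')"
    using j a ty ty' inj by (auto simp: aact_cons dst_cons starts_gact dst_gact)
  then show ?thesis using ty ty' by simp
qed

text \<open>Van der Waerden's method: the letters of the left factor act one after the other on the
  right factor. Associativity then follows from the laws of the two actions, and no rewriting of
  words has to be shown confluent.\<close>

primrec mul :: "('g, 'j, 'a) nf \<Rightarrow> ('g, 'j, 'a) nf \<Rightarrow> ('g, 'j, 'a) nf" where
  "mul (Tip g) x = gact g x"
| "mul (Nd r j t n) x = gact r (aact j t (mul n x))"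

lemma nf_mul [simp]: "nf n \<Longrightarrow> nf x \<Longrightarrow> nf (mul n x)"
  by (induction n) auto

text \<open>On one side the cofactor \<open>c1\<close> has moved behind \<open>t\<close>, on the
  other it acts in front of \<open>t\<close>. The orders agree because both letters act through the
  abelian \<open>R\<close>.\<close>

lemma mul_gact:
  "h \<in> carrier G \<Longrightarrow> nf n \<Longrightarrow> nf x \<Longrightarrow> mul (gact h n) x = gact h (mul n x)"
proof (induction n arbitrary: h)
  case (Tip g) then show ?case by (simp add: gact_gact)
next
  case (Nd r j t n)
  define r1 c1 where "r1 = lrep j (h \<otimes> r)" and "c1 = lcof j (h \<otimes> r)"
  have j: "j \<in> J" and c: "c1 \<in> C j" "c1 \<in> carrier G" "r1 \<in> carrier G" "h \<otimes> r = r1 \<otimes> c1"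
    using Nd.prems lrep_lcof[of j "h \<otimes> r"] by (auto simp: r1_def c1_def)
  have m: "nf (mul n x)" using Nd.prems by simp
  have "mul (gact h (Nd r j t n)) x = gact r1 (aact j t (gact c1 (mul n x)))"
    using Nd.IH[of c1] Nd.prems c(1-3) by (simp add: r1_def[symmetric] c1_def[symmetric])
  also have "\<dots> = gact r1 (aact j (t \<oplus>\<^bsub>R\<^esub> \<kappa> j c1) (mul n x))"
    using Nd.prems c m by (simp add: aact_aact aact_\<kappa>)
  also have "\<dots> = gact r1 (aact j (\<kappa> j c1 \<oplus>\<^bsub>R\<^esub> t) (mul n x))"
    using Nd.prems c by (simp add: R.a_comm)
  also have "\<dots> = gact r1 (gact c1 (aact j t (mul n x)))"
    using Nd.prems c m by (simp add: aact_aact aact_\<kappa>)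
  also have "\<dots> = gact (h \<otimes> r) (aact j t (mul n x))"
    using Nd.prems c m by (simp add: gact_gact)
  also have "\<dots> = gact h (mul (Nd r j t n) x)"
    using Nd.prems m by (simp add: gact_gact)
  finally show ?case .
qed

lemma mul_cons:
  "j \<in> J \<Longrightarrow> nf y \<Longrightarrow> nf x \<Longrightarrow> mul (cons j t y) x = aact j t (mul y x)" if "t \<in> carrier R"
  using that by (simp add: cons_def)

lemma mul_aact:
  assumes j: "j \<in> J" and a: "a \<in> carrier R" and n: "nf n" and x: "nf x"
  shows "mul (aact j a n) x = aact j a (mul n x)"
proof -
  define t y where "t = top j n" and "y = rest j n"
  have ty: "t \<in> carrier R" "arep j t = t" "nf y" "\<not> starts j y" "cons j t y = n"
    using nf_top_rest n j by (auto simp: t_def y_def)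
  define s where "s = a \<oplus>\<^bsub>R\<^esub> t"
  have s: "s \<in> carrier R" using a ty by (simp add: s_def)
  have "mul (aact j a n) x = aact j (arep j s) (gact (acof j s) (mul y x))"
    using aact_cons[OF ty(3,4) j ty(1,2), of a] ty j s x
    by (simp add: s_def[symmetric] mul_cons mul_gact)
  also have "\<dots> = aact j (arep j s \<oplus>\<^bsub>R\<^esub> \<kappa> j (acof j s)) (mul y x)"
    using j s ty x by (simp add: aact_aact aact_\<kappa>)
  also have "\<dots> = aact j a (aact j t (mul y x))"
    using j s ty x a by (simp add: acof_props) (simp add: s_def aact_aact)
  also have "\<dots> = aact j a (mul (cons j t y) x)" using ty(1-4) j x by (simp add: mul_cons)
  finally show ?thesis using ty by simp
qed

lemma mul_assoc: "nf x \<Longrightarrow> nf y \<Longrightarrow> nf z \<Longrightarrow> mul (mul x y) z = mul x (mul y z)"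
  by (induction x) (simp_all add: mul_gact mul_aact)

lemma mul_one: "nf x \<Longrightarrow> mul x (Tip \<one>) = x"
proof (induction x)
  case (Nd r j t n)
  have "aact j t n = Nd \<one> j t n"
    using aact_cons[of n j "\<zero>\<^bsub>R\<^esub>" t] acof_eqI[of j t \<one>] Nd.prems by (auto simp: cons_def)
  moreover have "lcof j r = \<one>" using Nd.prems by (simp add: lcof_def)
  ultimately show ?case using Nd by simp
qed simp

definition amalgam :: "('g, 'j, 'a) nf monoid" where
  "amalgam = \<lparr>carrier = Collect nf, mult = mul, one = Tip \<one>\<rparr>"

lemma group_amalgam: "group amalgam"
proof (rule groupI)
  fix x assume "x \<in> carrier amalgam"
  then have "nf x" by (simp add: amalgam_def)
  then have "\<exists>y. nf y \<and> mul y x = Tip \<one>"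
  proof (induction x)
    case (Tip g) then show ?case by (intro exI[of _ "Tip (inv g)"]) simp
  next
    case (Nd r j t n)
    then obtain y where y: "nf y" "mul y n = Tip \<one>" by auto
    have "mul (mul y (aact j (\<ominus>\<^bsub>R\<^esub> t) (Tip (inv r)))) (Nd r j t n)
        = mul y (aact j (\<ominus>\<^bsub>R\<^esub> t) (gact (inv r) (mul (Nd r j t n) (Tip \<one>))))"
      using y Nd.prems by (simp only: mul_one) (simp add: mul_assoc mul_aact)
    also have "\<dots> = mul y (aact j (\<ominus>\<^bsub>R\<^esub> t \<oplus>\<^bsub>R\<^esub> t) n)"
      using y Nd.prems by (simp add: mul_one aact_aact gact_gact[symmetric])
    also have "\<dots> = Tip \<one>" using y Nd.prems by (simp add: R.l_neg)
    finally show ?case using y Nd.prems by (intro exI[of _ "mul y (aact j (\<ominus>\<^bsub>R\<^esub> t) (Tip (inv r)))"]) simp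
  qed
  then show "\<exists>y\<in>carrier amalgam. y \<otimes>\<^bsub>amalgam\<^esub> x = \<one>\<^bsub>amalgam\<^esub>" by (auto simp: amalgam_def)
qed (auto simp: amalgam_def mul_assoc)

lemma dst_mul: "nf p \<Longrightarrow> nf x \<Longrightarrow> nf y \<Longrightarrow> dst (mul p x) (mul p y) = dst x y"
  by (induction p) (auto simp: dst_gact dst_aact)

end

context axis_family
begin

lemma axis_zero [simp]: assumes "e \<in> E" shows "e \<zero>\<^bsub>R\<^esub> = \<one>"
proof -
  have "e (\<zero>\<^bsub>R\<^esub> \<oplus>\<^bsub>R\<^esub> \<zero>\<^bsub>R\<^esub>) = e \<zero>\<^bsub>R\<^esub> \<otimes> e \<zero>\<^bsub>R\<^esub>" by (rule axis_add) (use assms in auto)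
  then show ?thesis using assms G.l_cancel_one[of "e \<zero>\<^bsub>R\<^esub>" "e \<zero>\<^bsub>R\<^esub>"] by simp
qed

text \<open>Conjugated back by \<open>p\<close>, an element commuting with \<open>x\<close>
  conjugates \<open>e a\<close> to itself, and malnormality puts it on the axis
  \<open>e\<close>.\<close>

lemma axis_centralizer:
  assumes p: "p \<in> carrier G" and e: "e \<in> E" and a: "a \<in> carrier R" and x: "x = p \<otimes> e a \<otimes> inv p" "x \<noteq> \<one>"
    and y: "y \<in> carrier G" "x \<otimes> y = y \<otimes> x"
  obtains c where "c \<in> carrier R" "y = p \<otimes> e c \<otimes> inv p"
proof -
  have ea: "e a \<in> carrier G" using e a by simp
  define z where "z = inv p \<otimes> y \<otimes> p"
  have z: "z \<in> carrier G" "p \<otimes> z = y \<otimes> p" using p y G.conj_eq_iff(2)[of p z y] by (simp_all add: z_def)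
  have yz: "y = p \<otimes> z \<otimes> inv p" using z p y G.conj_eq_iff(1)[of p z y] by simp
  have cancel: "inv p \<otimes> (p \<otimes> w) = w" if "w \<in> carrier G" for w
    using p that by (simp add: G.m_assoc[symmetric])
  have "p \<otimes> (e a \<otimes> z) \<otimes> inv p = p \<otimes> (z \<otimes> e a) \<otimes> inv p"
  proof -
    have "p \<otimes> (e a \<otimes> z) \<otimes> inv p = x \<otimes> y"
      unfolding x(1) yz using p z(1) ea by (simp add: G.m_assoc cancel)
    also have "\<dots> = p \<otimes> (z \<otimes> e a) \<otimes> inv p"
      unfolding y(2) unfolding x(1) yz using p z(1) ea by (simp add: G.m_assoc cancel)
    finally show ?thesis .
  qed
  then have "e a \<otimes> z = z \<otimes> e a" using p z ea by simp
  then have "z \<otimes> e a \<otimes> inv z = e a" using z ea G.conj_eq_iff(1)[of z "e a" "e a"] by simp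
  moreover have "e a \<noteq> \<one>" using x p by auto
  ultimately obtain c where "c \<in> carrier R" "z = e c"
    using axis_malnormal[OF e e z(1) a a] by blast
  then show ?thesis using that yz by blast
qed

end

section \<open>Length function and axes of the amalgam\<close>

context star_amalgam
begin

sublocale P: group amalgam by (rule group_amalgam)

lemma amalgam_simps [simp]:
  "carrier amalgam = Collect nf" "x \<otimes>\<^bsub>amalgam\<^esub> y = mul x y" "\<one>\<^bsub>amalgam\<^esub> = Tip \<one>"
  by (simp_all add: amalgam_def)

definition axis :: "'j \<Rightarrow> 'a \<Rightarrow> ('g, 'j, 'a) nf" where
  "axis j a = aact j a (Tip \<one>)"

definition amalgam_axes :: "('a \<Rightarrow> ('g, 'j, 'a) nf) set" where
  "amalgam_axes = (\<lambda>e a. Tip (e a)) ` E \<union> axis ` J"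

lemma nf_inv [simp]: "nf x \<Longrightarrow> nf (inv\<^bsub>amalgam\<^esub> x)"
  using P.inv_closed[of x] by simp

lemma mul_inv [simp]:
  "nf x \<Longrightarrow> mul x (inv\<^bsub>amalgam\<^esub> x) = Tip \<one>" "nf x \<Longrightarrow> mul (inv\<^bsub>amalgam\<^esub> x) x = Tip \<one>"
  using P.r_inv[of x] P.l_inv[of x] by simp_all

lemma mul_inv_cancel [simp]:
  "nf x \<Longrightarrow> nf y \<Longrightarrow> mul x (mul (inv\<^bsub>amalgam\<^esub> x) y) = y"
  "nf x \<Longrightarrow> nf y \<Longrightarrow> mul (inv\<^bsub>amalgam\<^esub> x) (mul x y) = y"
  by (simp_all add: mul_assoc[symmetric])

lemma mul_cancel: "nf p \<Longrightarrow> nf x \<Longrightarrow> nf y \<Longrightarrow> mul p x = mul p y \<longleftrightarrow> x = y"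
  by (metis mul_inv_cancel(2))

lemma inv_Tip [simp]: "g \<in> carrier G \<Longrightarrow> inv\<^bsub>amalgam\<^esub> (Tip g) = Tip (inv g)"
  by (rule P.inv_equality) simp_all

text \<open>Left translations preserve \<open>dst\<close>. This turns the four point condition for
  \<open>dst\<close> into the axiom of \<open>tree_length\<close> for \<open>len\<close>.\<close>

lemma mul_dst: "nf x \<Longrightarrow> nf y \<Longrightarrow> int (len (mul (inv\<^bsub>amalgam\<^esub> x) y)) = dst x y"
  using dst_mul[of "inv\<^bsub>amalgam\<^esub> x" x y] by simp

lemma len_inv [simp]: "nf x \<Longrightarrow> len (inv\<^bsub>amalgam\<^esub> x) = len x"
  using mul_dst[of x "Tip \<one>"] by (simp add: mul_one)

lemma dst_mul_right: "nf p \<Longrightarrow> nf x \<Longrightarrow> dst p (mul p x) = int (len x)"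
  using dst_mul[of p "Tip \<one>" x] by (simp add: mul_one)

sublocale T: tree_length amalgam "\<lambda>x. int (len x)"
  by unfold_locales (use dst_four_point in \<open>auto simp: mul_dst\<close>)

lemma nf_axis [simp]: "j \<in> J \<Longrightarrow> a \<in> carrier R \<Longrightarrow> nf (axis j a)"
  by (simp add: axis_def)

lemma mul_axis: "j \<in> J \<Longrightarrow> a \<in> carrier R \<Longrightarrow> nf x \<Longrightarrow> mul (axis j a) x = aact j a x"
  by (simp add: axis_def mul_aact)

lemma aact_stripped:
  assumes "j \<in> J" "a \<in> carrier R" "nf y" "\<not> starts j y"
  shows "aact j a y = cons j (arep j a) (gact (acof j a) y)"
  using aact_cons[of y j "\<zero>\<^bsub>R\<^esub>" a] assms by (simp add: cons_def)

lemma axis_eq: "j \<in> J \<Longrightarrow> a \<in> carrier R \<Longrightarrow> axis j a = cons j (arep j a) (Tip (acof j a))"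
  by (simp add: axis_def aact_stripped)

lemma len_axis: "j \<in> J \<Longrightarrow> a \<in> carrier R \<Longrightarrow> len (axis j a) \<le> Suc 0"
  by (simp add: axis_eq cons_def)

lemma axis_\<kappa>: "j \<in> J \<Longrightarrow> c \<in> C j \<Longrightarrow> axis j (\<kappa> j c) = Tip c"
  using C_carrier by (simp add: axis_def aact_\<kappa>)

lemma axis_plus: "j \<in> J \<Longrightarrow> a \<in> carrier R \<Longrightarrow> b \<in> carrier R \<Longrightarrow>
    axis j (a \<oplus>\<^bsub>R\<^esub> b) = mul (axis j a) (axis j b)"
  by (simp add: mul_axis) (simp add: axis_def aact_aact)

lemma axis_Tip:
  assumes "j \<in> J" "a \<in> carrier R" "axis j a = Tip g" shows "g \<in> C j" "a = \<kappa> j g"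
proof -
  have "arep j a = \<zero>\<^bsub>R\<^esub>" "acof j a = g" using assms by (auto simp: axis_eq cons_def split: if_splits)
  then show "g \<in> C j" "a = \<kappa> j g" using assms acof_props[of j a] by auto
qed

lemma strip:
  assumes "j \<in> J" "nf p"
  obtains s y where "s \<in> carrier R" "nf y" "\<not> starts j y" "p = mul (axis j s) y"
proof -
  have t: "nf (rest j p)" "\<not> starts j (rest j p)" "top j p \<in> carrier R" "arep j (top j p) = top j p"
    using nf_top_rest assms by auto
  have "acof j (top j p) = \<one>" using acof_eqI[of j "top j p" \<one>] t assms by simp
  then have "p = mul (axis j (top j p)) (rest j p)"
    using t assms by (simp add: mul_axis aact_stripped)
  then show ?thesis using that t by blast
qed

text \<open>\<open>x\<close> fixes the base vertex and, not lying in the conjugate of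
  \<open>C j\<close> by \<open>r\<close>, moves the first vertex of type \<open>R\<close> on the
  path. The path and its translate then share only the base vertex.\<close>

lemma dst_gact_far:
  assumes "nf (Nd r j t n)" "x \<in> carrier G" "inv r \<otimes> x \<otimes> r \<notin> C j"
  shows "dst (Nd r j t n) (gact x (Nd r j t n)) = 2 * int (len (Nd r j t n))"
proof -
  have "lrep j (x \<otimes> r) \<noteq> r"
  proof
    assume *: "lrep j (x \<otimes> r) = r"
    have "inv r \<otimes> (x \<otimes> r) = lcof j (x \<otimes> r)" using * by (simp add: lcof_def)
    then show False using assms by (simp add: G.m_assoc)
  qed
  then show ?thesis by (simp add: dst_def)
qed

text \<open>The equation says that \<open>e' b\<close> moves the vertex of \<open>p\<close> by at
  most 1, whereas a conjugator with nodes would be moved far. So, up to a factor from the axis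
  itself, the conjugator lies in \<open>G\<close>, where the hypotheses on \<open>G\<close>
  decide.\<close>

lemma amalgam_malnormal:
  assumes ee: "e \<in> amalgam_axes" "e' \<in> amalgam_axes" and p: "nf p"
    and ab: "a \<in> carrier R" "b \<in> carrier R"
    and eq: "mul p (e a) = mul (e' b) p" and ne: "e' b \<noteq> Tip \<one>"
  shows "e = e' \<and> (\<exists>c\<in>carrier R. p = e c)"
proof -
  \<comment> \<open>If \<open>x\<close> moves the path of \<open>q\<close> off at its first vertex,
    then \<open>2 * len q = dst q (gact x q) = len y \<le> 1\<close>, so \<open>q\<close> has no
    node.\<close>
  have Tip_case: "\<exists>g\<in>carrier G. q = Tip g"
    if q: "nf q" "nf y" "len y \<le> 1" "mul q y = gact x q" and x: "x \<in> carrier G"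
      and "\<And>r j. r \<in> carrier G \<Longrightarrow> j \<in> J \<Longrightarrow> inv r \<otimes> x \<otimes> r \<in> C j \<Longrightarrow> (\<exists>t n. q = Nd r j t n) \<Longrightarrow> False"
    for q y x
  proof (cases q)
    case (Tip g) then show ?thesis using q by simp
  next
    case (Nd r j t n)
    then have "dst q (gact x q) = 2 * int (len q)" using dst_gact_far[of r j t n x] that by auto
    moreover have "dst q (gact x q) \<le> 1" using dst_mul_right[of q y] q by simp
    ultimately show ?thesis using Nd by simp
  qed
  have EC: False if "f \<in> E" "d \<in> carrier R" "f d \<noteq> \<one>" "r \<in> carrier G" "j \<in> J" "inv r \<otimes> f d \<otimes> r \<in> C j" for f d r j
    using C_axis[of j f "inv r" d] that by simp
  \<comment> \<open>No nontrivial element of an old axis is conjugate into a new one: the conjugator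
    would lie in \<open>G\<close>, and an element of some \<open>C j\<close> would be conjugate in
    \<open>G\<close> to a nontrivial element of an axis.\<close>
  have axis_E: False
    if j: "j \<in> J" and f: "f \<in> E" and q: "nf q" and ab: "a \<in> carrier R" "b \<in> carrier R"
      and eq: "mul q (axis j a) = mul (Tip (f b)) q" and ne: "f b \<noteq> \<one>" for j f q a b
  proof -
    have "\<exists>g\<in>carrier G. q = Tip g"
      by (rule Tip_case[of q "axis j a" "f b"]) (use EC j f q ab eq ne in \<open>auto simp: len_axis\<close>)
    then obtain g where g: "g \<in> carrier G" "q = Tip g" by blast
    have "mul (Tip g) (axis j a) = mul (Tip g) (Tip (inv g \<otimes> f b \<otimes> g))"
      using eq g f ab by (simp add: G.m_assoc) (simp add: G.m_assoc[symmetric])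
    then have "axis j a = Tip (inv g \<otimes> f b \<otimes> g)"
      using mul_cancel[of "Tip g" "axis j a" "Tip (inv g \<otimes> f b \<otimes> g)"] g j ab f by simp
    then show False using axis_Tip(1)[OF j ab(1)] EC f ab ne g j by blast
  qed
  from ee consider
      (EE) f f' where "f \<in> E" "f' \<in> E" "e = (\<lambda>a. Tip (f a))" "e' = (\<lambda>a. Tip (f' a))"
    | (JE) j f' where "j \<in> J" "f' \<in> E" "e = axis j" "e' = (\<lambda>a. Tip (f' a))"
    | (EJ) f k where "f \<in> E" "k \<in> J" "e = (\<lambda>a. Tip (f a))" "e' = axis k"
    | (JJ) j k where "j \<in> J" "k \<in> J" "e = axis j" "e' = axis k"
    unfolding amalgam_axes_def by blast
  then show ?thesis
  proof cases
    case EE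
    have "\<exists>g\<in>carrier G. p = Tip g"
      by (rule Tip_case[of p "Tip (f a)" "f' b"]) (use EC EE p ab eq ne in auto)
    then obtain g where g: "g \<in> carrier G" "p = Tip g" by blast
    have "g \<otimes> f a \<otimes> inv g = f' b" using eq g EE ab G.conj_eq_iff(1)[of g "f a" "f' b"] by simp
    then have "f = f' \<and> (\<exists>c\<in>carrier R. g = f c)"
      using axis_malnormal[of f f' g a b] EE g ab ne by auto
    then show ?thesis using EE g by auto
  next
    case JE
    then show ?thesis using axis_E[of j f' p a b] p ab eq ne by auto
  next
    case EJ
    \<comment> \<open>The equation is turned around, so that the new axis is the one being
      conjugated and the previous case applies.\<close>
    define q where "q = inv\<^bsub>amalgam\<^esub> p"
    have q: "nf q" using p by (simp add: q_def)
    have "mul q (axis k b) = mul q (mul (mul (axis k b) p) q)"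
      using p EJ ab q by (simp add: mul_assoc) (simp add: q_def mul_one)
    also have "\<dots> = mul q (mul (mul p (Tip (f a))) q)" using eq EJ by simp
    also have "\<dots> = mul (Tip (f a)) q" using p EJ ab q by (simp only: mul_assoc nf_mul nf.simps axis_closed) (simp add: q_def)
    finally have *: "mul q (axis k b) = mul (Tip (f a)) q" .
    have "f a \<noteq> \<one>"
    proof
      assume "f a = \<one>"
      then have "mul (axis k b) p = p" using eq EJ p by (simp add: mul_one)
      then have "mul (mul (axis k b) p) q = mul p q" by simp
      then show False using p q EJ ab ne by (simp add: mul_assoc) (simp add: q_def mul_one)
    qed
    then show ?thesis using axis_E[OF EJ(2,1) q ab(2,1) *] by simp
  next
    case JJ
    \<comment> \<open>An initial letter of \<open>p\<close> from the \<open>k\<close>-th copy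
      commutes with \<open>axis k b\<close> and is cancelled. What remains does not start with
      \<open>k\<close>.\<close>
    obtain s y where s: "s \<in> carrier R" "nf y" "\<not> starts k y" "p = mul (axis k s) y"
      using strip[OF JJ(2) p] .
    have "mul (axis k s) (mul y (axis j a)) = mul (axis k s) (mul (axis k b) y)"
    proof -
      have "mul (axis k s) (mul y (axis j a)) = mul (axis k b) (mul (axis k s) y)"
        using eq s JJ ab by (simp add: mul_assoc)
      also have "\<dots> = mul (axis k (b \<oplus>\<^bsub>R\<^esub> s)) y" using s JJ ab by (simp add: axis_plus mul_assoc)
      also have "\<dots> = mul (axis k (s \<oplus>\<^bsub>R\<^esub> b)) y" using s ab by (simp add: R.a_comm)
      also have "\<dots> = mul (axis k s) (mul (axis k b) y)" using s JJ ab by (simp add: axis_plus mul_assoc)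
      finally show ?thesis .
    qed
    then have eqy: "mul y (axis j a) = mul (axis k b) y" using s JJ ab by (simp add: mul_cancel)
    have "\<exists>g\<in>carrier G. y = Tip g"
    proof (cases "arep k b = \<zero>\<^bsub>R\<^esub>")
      case True
      \<comment> \<open>Here \<open>b\<close> comes from an element \<open>c\<close> of
        \<open>C k\<close>. If \<open>c\<close> fixed the first vertex of type \<open>R\<close> on
        the path of \<open>y\<close>, malnormality of the family \<open>C\<close> would make it the
        vertex of \<open>C k\<close> itself, which the stripped \<open>y\<close> does not visit
        first.\<close>
      define c where "c = acof k b"
      have c: "c \<in> C k" "b = \<kappa> k c" "c \<in> carrier G"
        using acof_props[of k b] True JJ ab by (auto simp: c_def)
      have bc: "axis k b = Tip c" using c JJ by (simp add: axis_\<kappa>)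
      show ?thesis
      proof (rule Tip_case[of y "axis j a" c])
        show "mul y (axis j a) = gact c y" using eqy bc by simp
        fix r i assume r: "r \<in> carrier G" "i \<in> J" "inv r \<otimes> c \<otimes> r \<in> C i" "\<exists>t n. y = Nd r i t n"
        then have "k = i \<and> inv r \<in> C k"
          using C_malnormal[of k i "inv r" c] c JJ ne bc by auto
        then have "k = i" "inv (inv r) \<in> C k" using C_closed(2) JJ(2) by blast+
        then have "r \<in> C k" using r(1) by simp
        then have "r = \<one>" using r(4) s(2) \<open>k = i\<close> lrep_C[of r k] by auto
        then show False using r(4) s(3) \<open>k = i\<close> by auto
      qed (use s(2) JJ(1) ab(1) c(3) in \<open>simp_all add: len_axis\<close>)
    next
      case False
      then have "mul (axis k b) y = Nd \<one> k (arep k b) (gact (acof k b) y)"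
        using s JJ ab by (simp add: mul_axis aact_stripped cons_def)
      moreover have "lcp y (Nd \<one> k t' z) = 0" for t' z using s by (cases y) auto
      ultimately have "dst y (mul (axis k b) y) = 2 * int (len y) + 1" by (simp add: dst_def)
      moreover have "dst y (mul (axis k b) y) \<le> 1"
        using dst_mul_right[of y "axis j a"] len_axis[of j a] s JJ ab eqy by simp
      ultimately show ?thesis using s by (cases y) auto
    qed
    then obtain g where g: "g \<in> carrier G" "y = Tip g" by blast
    have eqg: "gact g (cons j (arep j a) (Tip (acof j a))) = cons k (arep k b) (Tip (acof k b \<otimes> g))"
      using eqy g JJ ab by (simp add: mul_axis aact_stripped) (simp add: axis_eq)
    \<comment> \<open>Both sides of \<open>eqg\<close> have at most one node. If there is one,
      comparing the nodes suffices; otherwise both sides lie in \<open>G\<close> and malnormality of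
      the family \<open>C\<close> decides.\<close>
    have "j = k \<and> g \<in> C j"
    proof (cases "arep j a = \<zero>\<^bsub>R\<^esub>")
      case True
      then have b0: "arep k b = \<zero>\<^bsub>R\<^esub>" and e: "g \<otimes> acof j a = acof k b \<otimes> g"
        using eqg by (auto simp: cons_def split: if_splits)
      have "acof k b \<noteq> \<one>" using ne b0 JJ ab by (auto simp: axis_eq cons_def)
      moreover have e': "g \<otimes> acof j a \<otimes> inv g = acof k b"
        using e g JJ ab G.conj_eq_iff(1)[of g "acof j a" "acof k b"] by simp
      ultimately have "acof j a \<noteq> \<one>" using g by auto
      moreover have "g \<otimes> acof j a \<otimes> inv g \<in> C k" using e' JJ ab by simp
      ultimately show ?thesis using C_malnormal[OF JJ(1,2) g(1) acof_in[OF JJ(1) ab(1)]] by blast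
    next
      case False
      then have "j = k \<and> lrep j g = \<one>" using eqg g(1) by (auto simp: cons_def split: if_splits)
      then show ?thesis using lrep_one_iff[OF JJ(1) g(1)] by blast
    qed
    then have jk: "j = k" and gC: "g \<in> C k" by auto
    then have "y = axis k (\<kappa> k g)" using g JJ by (simp add: axis_\<kappa>)
    then have "p = axis k (s \<oplus>\<^bsub>R\<^esub> \<kappa> k g)" using s JJ gC by (simp add: axis_plus)
    then show ?thesis using JJ jk gC s(1) by auto
  qed
qed

sublocale A: axis_family R amalgam amalgam_axes
proof unfold_locales
  fix e a assume "e \<in> amalgam_axes" "a \<in> carrier R"
  then show "e a \<in> carrier amalgam" by (auto simp: amalgam_axes_def)
next
  fix e a b assume "e \<in> amalgam_axes" "a \<in> carrier R" "b \<in> carrier R"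
  then show "e (a \<oplus>\<^bsub>R\<^esub> b) = e a \<otimes>\<^bsub>amalgam\<^esub> e b" by (auto simp: amalgam_axes_def axis_add axis_plus)
next
  fix e a assume e: "e \<in> amalgam_axes" "a \<in> carrier R" "e a = \<one>\<^bsub>amalgam\<^esub>"
  then consider f where "f \<in> E" "f a = \<one>" | j where "j \<in> J" "axis j a = Tip \<one>"
    by (auto simp: amalgam_axes_def)
  then show "a = \<zero>\<^bsub>R\<^esub>"
  proof cases
    case 1 then show ?thesis using axis_inj e by blast
  next
    case 2 then show ?thesis using axis_Tip(2)[of j a \<one>] e by simp
  qed
next
  fix e e' g a b
  assume *: "e \<in> amalgam_axes" "e' \<in> amalgam_axes" "g \<in> carrier amalgam" "a \<in> carrier R" "b \<in> carrier R"
    "g \<otimes>\<^bsub>amalgam\<^esub> e a \<otimes>\<^bsub>amalgam\<^esub> inv\<^bsub>amalgam\<^esub> g = e' b" "e' b \<noteq> \<one>\<^bsub>amalgam\<^esub>"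
  have n: "nf (e a)" "nf (e' b)" "nf g" using * by (auto simp: amalgam_axes_def)
  have "mul g (e a) = mul (e' b) g"
    using *(6)[symmetric] n by (simp add: mul_assoc) (simp add: mul_one)
  then show "e = e' \<and> (\<exists>c\<in>carrier R. g = e c)"
    using amalgam_malnormal[of e e' g a b] * by auto
qed

section \<open>Elliptic and hyperbolic elements of the amalgamated product\<close>

text \<open>Right multiplication by \<open>G\<close> alters only the tip, so no cofactor has to
  move. This lets conjugation carry the first letter of a form to its end.\<close>

lemma mul_Tip:
  assumes "nf (Nd r j t n)" "g \<in> carrier G"
  shows "mul (Nd r j t n) (Tip g) = Nd r j t (mul n (Tip g))" "\<not> starts j (mul n (Tip g))"
proof -
  have "mul (Nd r j t n) (Tip g) = Nd r j t (mul n (Tip g)) \<and> \<not> starts j (mul n (Tip g))"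
    using assms(1)
  proof (induction n arbitrary: r j t)
    case (Tip h)
    have "aact j t (Tip (h \<otimes> g)) = Nd \<one> j t (Tip (h \<otimes> g))"
      using Tip assms aact_stripped[of j t "Tip (h \<otimes> g)"] acof_eqI[of j t \<one>] by (simp add: cons_def)
    then show ?case using Tip assms(2) by (simp add: lcof_def)
  next
    case (Nd r' j' t' n')
    let ?m = "mul (Nd r' j' t' n') (Tip g)"
    have m: "?m = Nd r' j' t' (mul n' (Tip g))" using Nd by simp
    then have ns: "\<not> starts j ?m" using Nd.prems by (simp del: mul.simps)
    moreover have "nf ?m" using Nd.prems assms by (intro nf_mul) simp_all
    ultimately have "aact j t ?m = Nd \<one> j t ?m"
      using Nd.prems acof_eqI[of j t \<one>] by (simp add: aact_stripped cons_def del: mul.simps)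
    then have "mul (Nd r j t (Nd r' j' t' n')) (Tip g) = Nd r j t ?m"
      using Nd.prems \<open>nf ?m\<close> by (subst mul.simps) (simp add: lcof_def del: mul.simps)
    then show ?case using ns by blast
  qed
  then show "mul (Nd r j t n) (Tip g) = Nd r j t (mul n (Tip g))" "\<not> starts j (mul n (Tip g))" by auto
qed

lemma axial_conj:
  assumes "nf q" "nf x" "axial R amalgam amalgam_axes (mul (mul q x) (inv\<^bsub>amalgam\<^esub> q))"
  shows "axial R amalgam amalgam_axes x"
proof -
  obtain p e a where p: "nf p" "e \<in> amalgam_axes" "a \<in> carrier R"
    "mul (mul q x) (inv\<^bsub>amalgam\<^esub> q) = mul (mul p (e a)) (inv\<^bsub>amalgam\<^esub> p)"
    using assms(3) by (auto simp: axial_def)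
  have e: "nf (e a)" using A.axis_closed p by simp
  have "x = mul (inv\<^bsub>amalgam\<^esub> q) (mul (mul (mul q x) (inv\<^bsub>amalgam\<^esub> q)) q)"
    using assms by (simp add: mul_assoc mul_one)
  also have "\<dots> = mul (mul (mul (inv\<^bsub>amalgam\<^esub> q) p) (e a)) (inv\<^bsub>amalgam\<^esub> (mul (inv\<^bsub>amalgam\<^esub> q) p))"
    using p e assms P.inv_mult_group[of "inv\<^bsub>amalgam\<^esub> q" p] by (simp add: mul_assoc)
  finally show ?thesis using p assms unfolding axial_def amalgam_simps
    by (intro bexI[of _ "mul (inv\<^bsub>amalgam\<^esub> q) p"] bexI[of _ e] bexI[of _ a]) simp_all
qed

lemma axial_axis: "j \<in> J \<Longrightarrow> a \<in> carrier R \<Longrightarrow> axial R amalgam amalgam_axes (axis j a)"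
  unfolding axial_def amalgam_simps
  by (intro bexI[of _ "Tip \<one>"] bexI[of _ "axis j"] bexI[of _ a]) (simp_all add: amalgam_axes_def mul_one)

text \<open>By \<open>cover\<close> such an element is on a conjugate of an old axis or is conjugate
  into some \<open>C j\<close>, and \<open>C j\<close> is contained in the new axis
  \<open>axis j\<close>.\<close>

lemma axial_Tip:
  assumes x: "x \<in> carrier G" "x \<noteq> \<one>"
  shows "axial R amalgam amalgam_axes (Tip x)"
proof -
  consider p e a where "p \<in> carrier G" "e \<in> E" "a \<in> carrier R" "x = p \<otimes> e a \<otimes> inv p"
    | p j c where "p \<in> carrier G" "j \<in> J" "c \<in> C j" "x = p \<otimes> c \<otimes> inv p"
    using cover[OF x] unfolding axial_def by blast
  then show ?thesis
  proof cases
    case 1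
    then show ?thesis unfolding axial_def amalgam_simps
      by (intro bexI[of _ "Tip p"] bexI[of _ "\<lambda>a. Tip (e a)"] bexI[of _ a])
        (simp_all add: amalgam_axes_def)
  next
    case 2
    then show ?thesis unfolding axial_def amalgam_simps
      by (intro bexI[of _ "Tip p"] bexI[of _ "axis j"] bexI[of _ "\<kappa> j c"])
        (simp_all add: amalgam_axes_def axis_\<kappa> C_carrier)
  qed
qed

text \<open>Cyclic reduction: conjugation carries the first letter \<open>r\<close> to the end and
  leaves \<open>t m\<close>. If the inverse of this element does not start with \<open>j\<close>,
  its square has no cancellation and it is hyperbolic. If it does, the element lies in the
  \<open>j\<close>-th copy, or \<open>t\<close> is carried to the end too and merges there, which
  shortens the form.\<close>

lemma axial_or_hyperbolic:
  assumes "nf x" "x \<noteq> Tip \<one>"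
  shows "axial R amalgam amalgam_axes x \<or>
    (\<exists>q y. nf q \<and> nf y \<and> y = mul (mul q x) (inv\<^bsub>amalgam\<^esub> q) \<and> 0 < len y \<and> len (mul y y) = 2 * len y)"
  using assms
proof (induction "len x" arbitrary: x rule: less_induct)
  case less
  let ?A = "axial R amalgam amalgam_axes"
  let ?H = "\<lambda>x. \<exists>q y. nf q \<and> nf y \<and> y = mul (mul q x) (inv\<^bsub>amalgam\<^esub> q) \<and> 0 < len y \<and> len (mul y y) = 2 * len y"
  have transfer: "?A x \<or> ?H x"
    if q: "nf q" "z = mul (mul q x) (inv\<^bsub>amalgam\<^esub> q)" and z: "?A z \<or> ?H z" for q z
    using z
  proof
    assume "?A z" then show ?thesis using axial_conj q less.prems by blast
  next
    assume "?H z"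
    then obtain q' y where "nf q'" "nf y" "y = mul (mul q' z) (inv\<^bsub>amalgam\<^esub> q')" "0 < len y" "len (mul y y) = 2 * len y"
      by blast
    moreover from this have "y = mul (mul (mul q' q) x) (inv\<^bsub>amalgam\<^esub> (mul q' q))"
      using q less.prems P.inv_mult_group[of q' q] by (simp add: mul_assoc)
    ultimately have "?H x" using q by (intro exI[of _ "mul q' q"] exI[of _ y]) simp
    then show ?thesis ..
  qed
  show ?case
  proof (cases x)
    case (Tip g)
    then show ?thesis using less.prems axial_Tip by auto
  next
    case (Nd r j t n)
    then have r: "r \<in> carrier G" and j: "j \<in> J" and t: "t \<in> carrier R" "arep j t = t" "t \<noteq> \<zero>\<^bsub>R\<^esub>" and n: "nf n"
      and nn: "nf (Nd \<one> j t n)"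
      using less.prems by (auto simp: lrep_C)
    define m where "m = mul n (Tip r)"
    define x' where "x' = Nd \<one> j t m"
    define q where "q = inv\<^bsub>amalgam\<^esub> x'"
    have m: "nf m" "\<not> starts j m" "mul (Nd \<one> j t n) (Tip r) = x'"
      using mul_Tip[OF nn r] r n by (simp_all add: m_def x'_def del: mul.simps)
    have x': "nf x'" using nn m by (simp add: x'_def)
    have "gact (inv r) x = Nd \<one> j t n"
      using Nd less.prems r by (simp add: lrep_C lcof_C)
    then have conj: "x' = mul (mul (Tip (inv r)) x) (inv\<^bsub>amalgam\<^esub> (Tip (inv r)))"
      using m r by simp
    have len_m: "len m = len n" unfolding m_def
      using dst_mul_right[of "inv\<^bsub>amalgam\<^esub> n" ] mul_dst[of "inv\<^bsub>amalgam\<^esub> n" "Tip r"] n r by simp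
    have lenx: "len x = Suc (len m)" "len x' = Suc (len m)" using Nd len_m by (simp_all add: x'_def)
    have xq: "nf q" "len q = len x'" using x' by (simp_all add: q_def)
    have ax: "axis j t = Nd \<one> j t (Tip \<one>)"
      using axis_eq[of j t] acof_eqI[of j t \<one>] j t by (simp add: cons_def)
    have x'_ax: "x' = mul (axis j t) m"
      using m j t acof_eqI[of j t \<one>] by (simp add: mul_axis aact_stripped cons_def x'_def)
    show ?thesis
    proof (cases "starts j q")
      case False
      then have "lcp q x' = 0" by (cases q) (auto simp: x'_def)
      then have "len (mul x' x') = 2 * len x'"
        using mul_dst[of q x'] x' xq by (simp add: q_def[symmetric] dst_def) (simp add: q_def)
      then have "?H x"
        using conj x' lenx r by (intro exI[of _ "Tip (inv r)"] exI[of _ x']) simp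
      then show ?thesis ..
    next
      case True
      have im: "inv\<^bsub>amalgam\<^esub> m = mul q (axis j t)"
      proof -
        have "q = mul (inv\<^bsub>amalgam\<^esub> m) (inv\<^bsub>amalgam\<^esub> (axis j t))"
          using P.inv_mult_group[of "axis j t" m] m j t by (simp add: q_def x'_ax)
        then show ?thesis using m j t by (simp add: mul_assoc mul_one)
      qed
      show ?thesis
      proof (cases "len m")
        case 0
        then obtain g where g: "m = Tip g" "g \<in> carrier G" using m by (cases m) auto
        have "q = mul (Tip (inv g)) (axis j (\<ominus>\<^bsub>R\<^esub> t))"
        proof -
          have "mul (axis j (\<ominus>\<^bsub>R\<^esub> t)) (axis j t) = Tip \<one>"
            using j t axis_plus[of j "\<ominus>\<^bsub>R\<^esub> t" t] by (simp add: R.l_neg) (simp add: axis_def)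
          then have "inv\<^bsub>amalgam\<^esub> (axis j t) = axis j (\<ominus>\<^bsub>R\<^esub> t)"
            using j t by (intro P.inv_equality) simp_all
          then show ?thesis
            using P.inv_mult_group[of "axis j t" m] m j t g by (simp add: q_def x'_ax)
        qed
        then have "starts j (gact (inv g) (axis j (\<ominus>\<^bsub>R\<^esub> t)))" using True by simp
        \<comment> \<open>The inverse \<open>q\<close> is \<open>inv g\<close> times the letter
          \<open>\<ominus> t\<close>; it starts with \<open>j\<close> only if the coset of
          \<open>inv g\<close> is the trivial one.\<close>
        then have "lrep j (inv g) = \<one>"
          using j t g by (auto simp: axis_eq cons_def split: if_splits)
        then have gC: "g \<in> C j" using lrep_one_iff[of j "inv g"] C_closed(2)[of j "inv g"] j g by simp
        then have "x' = axis j (t \<oplus>\<^bsub>R\<^esub> \<kappa> j g)"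
          using x'_ax g j t by (simp add: axis_plus axis_\<kappa>)
        then have "?A x'" using axial_axis j t gC by simp
        then show ?thesis using r by (intro transfer[OF _ conj]) simp_all
      next
        case (Suc l)
        define z where "z = mul m (axis j t)"
        have z: "nf z" using m j t by (simp add: z_def)
        \<comment> \<open>\<open>inv m\<close> differs from \<open>q\<close> by one letter on the
          right. As \<open>m\<close> has a node, the two paths begin alike and \<open>inv m\<close>
          starts with \<open>j\<close> as well, so \<open>m\<close> and \<open>t\<close> merge in
          \<open>z\<close>.\<close>
        have "dst q (inv\<^bsub>amalgam\<^esub> m) = 1"
          using dst_mul_right[OF xq(1) nf_axis[OF j t(1)]] by (simp add: im ax)
        then have "lcp q (inv\<^bsub>amalgam\<^esub> m) > 0"
          using m xq lenx Suc unfolding dst_def by simp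
        then have "starts j (inv\<^bsub>amalgam\<^esub> m)"
          using True by (cases q; cases "inv\<^bsub>amalgam\<^esub> m") (auto split: if_splits)
        then have "lcp (inv\<^bsub>amalgam\<^esub> m) (axis j t) > 0"
          by (cases "inv\<^bsub>amalgam\<^esub> m") (auto simp: ax)
        then have "len z < len x"
          using mul_dst[OF nf_inv[OF m(1)] nf_axis[OF j t(1)]] m(1) lenx unfolding z_def dst_def by (simp add: ax)
        define p where "p = mul (inv\<^bsub>amalgam\<^esub> (axis j t)) (Tip (inv r))"
        have p: "nf p" using j t r by (simp add: p_def)
        have zc: "z = mul (mul p x) (inv\<^bsub>amalgam\<^esub> p)"
        proof -
          have "z = mul (inv\<^bsub>amalgam\<^esub> (axis j t)) (mul x' (axis j t))"
            using m j t by (simp add: z_def x'_ax mul_assoc)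
          also have "\<dots> = mul (mul p x) (inv\<^bsub>amalgam\<^esub> p)"
            unfolding conj p_def using j t r less.prems P.inv_mult_group[of "inv\<^bsub>amalgam\<^esub> (axis j t)" "Tip (inv r)"]
            by (simp add: mul_assoc del: mul.simps)
          finally show ?thesis .
        qed
        have "z \<noteq> Tip \<one>"
        proof
          assume "z = Tip \<one>"
          then have "mul p x = p" using zc p less.prems by (metis P.inv_closed amalgam_simps(1,2) mem_Collect_eq mul.simps(1) mul_assoc mul_inv(2) mul_one nf_mul gact_one)
          then have "mul (inv\<^bsub>amalgam\<^esub> p) (mul p x) = mul (inv\<^bsub>amalgam\<^esub> p) p" by simp
          then show False using p less.prems by simp
        qed
        then have "?A z \<or> ?H z" using less.hyps[OF \<open>len z < len x\<close> z] by blast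
        then show ?thesis by (rule transfer[OF p zc])
      qed
    qed
  qed
qed

text \<open>An axial square root of the unit gives \<open>a \<oplus> a = \<zero>\<close> in
  \<open>R\<close>; in the hyperbolic case the square has positive length.
  \<open>maximal_cyclic\<close> needs this to exclude inversions.\<close>

lemma amalgam_no_two_torsion:
  assumes "nf x" "mul x x = Tip \<one>" shows "x = Tip \<one>"
proof (rule ccontr)
  assume ne: "x \<noteq> Tip \<one>"
  from axial_or_hyperbolic[OF assms(1) ne] show False
  proof
    assume "axial R amalgam amalgam_axes x"
    then obtain p e a where p: "nf p" "e \<in> amalgam_axes" "a \<in> carrier R"
      "x = mul (mul p (e a)) (inv\<^bsub>amalgam\<^esub> p)" by (auto simp: axial_def)
    have ea: "nf (e a)" using A.axis_closed p by simp
    have "mul x x = mul (mul p (e (a \<oplus>\<^bsub>R\<^esub> a))) (inv\<^bsub>amalgam\<^esub> p)"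
      using p ea by (simp add: A.axis_add mul_assoc)
    then have "mul p (e (a \<oplus>\<^bsub>R\<^esub> a)) = mul (Tip \<one>) p"
      using P.conj_eq_iff(1)[of p "e (a \<oplus>\<^bsub>R\<^esub> a)" "Tip \<one>"] A.axis_closed[of e "a \<oplus>\<^bsub>R\<^esub> a"] p assms by simp
    then have "mul p (e (a \<oplus>\<^bsub>R\<^esub> a)) = mul p (Tip \<one>)" using p by (simp add: mul_one)
    then have "e (a \<oplus>\<^bsub>R\<^esub> a) = Tip \<one>"
      using mul_cancel[of p "e (a \<oplus>\<^bsub>R\<^esub> a)" "Tip \<one>"] A.axis_closed[of e "a \<oplus>\<^bsub>R\<^esub> a"] p(1-3) by simp
    then have "a \<oplus>\<^bsub>R\<^esub> a = \<zero>\<^bsub>R\<^esub>" using A.axis_inj[OF p(2), of "a \<oplus>\<^bsub>R\<^esub> a"] p(3) by simp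
    then have "a = \<zero>\<^bsub>R\<^esub>" by (rule no_two_torsion[OF p(3)])
    then have "x = Tip \<one>" using A.axis_zero[OF p(2)] p(1,4) by (simp add: mul_one)
    then show False using ne by simp
  next
    assume "\<exists>q y. nf q \<and> nf y \<and> y = mul (mul q x) (inv\<^bsub>amalgam\<^esub> q) \<and> 0 < len y \<and> len (mul y y) = 2 * len y"
    then obtain q y where y: "nf q" "nf y" "y = mul (mul q x) (inv\<^bsub>amalgam\<^esub> q)" "0 < len y" "len (mul y y) = 2 * len y"
      by blast
    have "mul y y = mul (mul q (mul x x)) (inv\<^bsub>amalgam\<^esub> q)"
      unfolding y(3) using y(1) assms(1) by (simp add: mul_assoc)
    then have "mul y y = Tip \<one>" using assms y(1) by (simp add: mul_one)
    then show False using y by simp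
  qed
qed

lemma amalgam_cover:
  assumes x: "nf x" "x \<noteq> Tip \<one>" and nax: "\<not> axial R amalgam amalgam_axes x"
  shows "\<exists>q u. \<exists>k::int. nf q \<and> malnormal_cyclic amalgam u \<and>
    x = mul (mul q (u [^]\<^bsub>amalgam\<^esub> k)) (inv\<^bsub>amalgam\<^esub> q)"
proof -
  obtain q y where y: "nf q" "nf y" "y = mul (mul q x) (inv\<^bsub>amalgam\<^esub> q)" "0 < len y" "len (mul y y) = 2 * len y"
    using axial_or_hyperbolic[OF x] nax by blast
  have nay: "\<not> axial R amalgam amalgam_axes y" using nax axial_conj y x by blast
  \<comment> \<open>A nontrivial \<open>k\<close> of length zero lies in \<open>G\<close> and so on
    a conjugate of an axis. Commuting with \<open>k\<close> puts \<open>h\<close> on the same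
    conjugate, and commuting with \<open>h\<close> puts \<open>y\<close> there, although
    \<open>y\<close> is not axial.\<close>
  have free: "k = Tip \<one>"
    if h: "nf h" "h \<noteq> Tip \<one>" "mul y h = mul h y" and k: "nf k" "mul h k = mul k h" "len k = 0" for h k
  proof (rule ccontr)
    assume "k \<noteq> Tip \<one>"
    then have "axial R amalgam amalgam_axes k" using k axial_Tip by (cases k) auto
    then obtain p e a where p: "nf p" "e \<in> amalgam_axes" "a \<in> carrier R"
      "k = mul (mul p (e a)) (inv\<^bsub>amalgam\<^esub> p)" by (auto simp: axial_def)
    obtain c where c: "c \<in> carrier R" "h = mul (mul p (e c)) (inv\<^bsub>amalgam\<^esub> p)"
      using A.axis_centralizer[of p e a k h] p \<open>k \<noteq> Tip \<one>\<close> h k by auto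
    obtain d where d: "d \<in> carrier R" "y = mul (mul p (e d)) (inv\<^bsub>amalgam\<^esub> p)"
      using A.axis_centralizer[of p e c h y] p c h y by auto
    then show False using nay p by (auto simp: axial_def)
  qed
  have free': "k = \<one>\<^bsub>amalgam\<^esub>"
    if "h \<in> carrier amalgam" "h \<noteq> \<one>\<^bsub>amalgam\<^esub>" "y \<otimes>\<^bsub>amalgam\<^esub> h = h \<otimes>\<^bsub>amalgam\<^esub> y" "k \<in> carrier amalgam"
      "h \<otimes>\<^bsub>amalgam\<^esub> k = k \<otimes>\<^bsub>amalgam\<^esub> h" "int (len k) = 0" for h k
    using free[of h k] that by simp
  have tf: "h = \<one>\<^bsub>amalgam\<^esub>" if "h \<in> carrier amalgam" "h \<otimes>\<^bsub>amalgam\<^esub> h = \<one>\<^bsub>amalgam\<^esub>" for h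
    using amalgam_no_two_torsion[of h] that by simp
  have y1: "y \<in> carrier amalgam" and y2: "int (len (y \<otimes>\<^bsub>amalgam\<^esub> y)) = 2 * int (len y)"
    and y3: "0 < int (len y)"
    using y(2,4,5) by simp_all
  have "\<exists>u. malnormal_cyclic amalgam u \<and> (\<exists>n::int. y = u [^]\<^bsub>amalgam\<^esub> n)"
    by (rule T.maximal_cyclic[OF y1 y2 y3 free' tf])
  then obtain u where "malnormal_cyclic amalgam u" and u: "\<exists>n::int. y = u [^]\<^bsub>amalgam\<^esub> n"
    by blast
  moreover have "x = mul (mul (inv\<^bsub>amalgam\<^esub> q) y) (inv\<^bsub>amalgam\<^esub> (inv\<^bsub>amalgam\<^esub> q))"
    unfolding y(3) using y(1) x by (simp add: mul_assoc mul_one)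
  ultimately show ?thesis using u y(1) by (metis nf_inv)
qed

end

context axis_family
begin

lemma axial_conjugate:
  assumes q: "q \<in> carrier G" and x: "axial R G E x"
  shows "axial R G E (q \<otimes> x \<otimes> inv q)"
proof -
  obtain p e a where p: "p \<in> carrier G" "e \<in> E" "a \<in> carrier R" "x = p \<otimes> e a \<otimes> inv p"
    using x by (auto simp: axial_def)
  then have "q \<otimes> x \<otimes> inv q = (q \<otimes> p) \<otimes> e a \<otimes> inv (q \<otimes> p)"
    using q by (simp add: G.m_assoc G.inv_mult_group)
  then show ?thesis using p q unfolding axial_def by blast
qed

end

section \<open>Stages of the construction\<close>

locale star_amalgam_map = star_amalgam R G E J C \<kappa> + B: A_group R B actB
  for R :: "('a, 'r) ring_scheme" and G :: "('g, 'm) monoid_scheme" (structure) and E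
    and J :: "'j set" and C \<kappa> and B :: "('b, 'n) monoid_scheme" and actB +
  fixes f :: "'g \<Rightarrow> 'b" and b :: "'j \<Rightarrow> 'b"
  assumes f_hom: "f \<in> hom G B"
    and b_closed [simp]: "j \<in> J \<Longrightarrow> b j \<in> carrier B"
    and f_C: "j \<in> J \<Longrightarrow> c \<in> C j \<Longrightarrow> f c = actB (b j) (\<kappa> j c)"
    and f_axis: "e \<in> E \<Longrightarrow> a \<in> carrier R \<Longrightarrow> f (e a) = actB (f (e \<one>\<^bsub>R\<^esub>)) a"
begin

text \<open>\<open>b j\<close> is the prescribed image of the element \<open>\<one>\<close> of the
  \<open>j\<close>-th copy. Compatibility with the action then forces the copy to map by
  \<open>actB (b j)\<close>, and \<open>f_C\<close> makes this agree with \<open>f\<close> on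
  \<open>C j\<close>.\<close>

primrec extension :: "('g, 'j, 'a) nf \<Rightarrow> 'b" where
  "extension (Tip g) = f g"
| "extension (Nd r j t n) = f r \<otimes>\<^bsub>B\<^esub> (actB (b j) t \<otimes>\<^bsub>B\<^esub> extension n)"

lemma f_closed [simp]: "g \<in> carrier G \<Longrightarrow> f g \<in> carrier B"
  using f_hom by (auto simp: hom_def)

lemma f_mult [simp]: "g \<in> carrier G \<Longrightarrow> h \<in> carrier G \<Longrightarrow> f (g \<otimes> h) = f g \<otimes>\<^bsub>B\<^esub> f h"
  using f_hom by (auto simp: hom_def)

lemma f_one [simp]: "f \<one> = \<one>\<^bsub>B\<^esub>"
  using hom_one[OF f_hom G.is_group B.G.is_group] .

lemma actB_closed [simp]: "j \<in> J \<Longrightarrow> a \<in> carrier R \<Longrightarrow> actB (b j) a \<in> carrier B"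
  using B.act_closed by simp

lemma extension_closed [simp]: "nf x \<Longrightarrow> extension x \<in> carrier B"
  by (induction x) auto

lemma extension_gact:
  "h \<in> carrier G \<Longrightarrow> nf x \<Longrightarrow> extension (gact h x) = f h \<otimes>\<^bsub>B\<^esub> extension x"
proof (induction x arbitrary: h)
  case (Nd r j t n)
  define r1 c1 where "r1 = lrep j (h \<otimes> r)" and "c1 = lcof j (h \<otimes> r)"
  have j: "j \<in> J" and c: "c1 \<in> C j" "c1 \<in> carrier G" "r1 \<in> carrier G" "h \<otimes> r = r1 \<otimes> c1"
    using Nd.prems lrep_lcof[of j "h \<otimes> r"] by (auto simp: r1_def c1_def)
  have "f h \<otimes>\<^bsub>B\<^esub> f r = f r1 \<otimes>\<^bsub>B\<^esub> f c1"
    using c Nd.prems f_mult[of h r] f_mult[of r1 c1] by simp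
  then have 1: "f h \<otimes>\<^bsub>B\<^esub> (f r \<otimes>\<^bsub>B\<^esub> z) = f r1 \<otimes>\<^bsub>B\<^esub> (f c1 \<otimes>\<^bsub>B\<^esub> z)" if "z \<in> carrier B" for z
    using c Nd.prems that by (simp add: B.G.m_assoc[symmetric])
  \<comment> \<open>\<open>C j\<close> and the \<open>j\<close>-th copy both map to powers of
    \<open>b j\<close>, so the cofactor passes the letter \<open>t\<close> in \<open>B\<close> as it
    does in \<open>gact\<close>.\<close>
  have "actB (b j) t \<otimes>\<^bsub>B\<^esub> f c1 = f c1 \<otimes>\<^bsub>B\<^esub> actB (b j) t"
    using Nd.prems c(1) by (simp add: f_C[OF j c(1)] B.act_add[symmetric] R.a_comm)
  then have 2: "actB (b j) t \<otimes>\<^bsub>B\<^esub> (f c1 \<otimes>\<^bsub>B\<^esub> z) = f c1 \<otimes>\<^bsub>B\<^esub> (actB (b j) t \<otimes>\<^bsub>B\<^esub> z)" if "z \<in> carrier B" for z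
    using c Nd.prems that by (simp add: B.G.m_assoc[symmetric])
  show ?case
    using Nd.IH[of c1] Nd.prems c(2,3) 1 2 by (simp add: r1_def[symmetric] c1_def[symmetric])
qed (simp add: hom_mult)

lemma extension_cons:
  "j \<in> J \<Longrightarrow> t \<in> carrier R \<Longrightarrow> nf y \<Longrightarrow> extension (cons j t y) = actB (b j) t \<otimes>\<^bsub>B\<^esub> extension y"
  using B.act_zero[of "b j"] by (simp add: cons_def)

lemma extension_aact:
  assumes j: "j \<in> J" and a: "a \<in> carrier R" and x: "nf x"
  shows "extension (aact j a x) = actB (b j) a \<otimes>\<^bsub>B\<^esub> extension x"
proof -
  define t y where "t = top j x" and "y = rest j x"
  have ty: "t \<in> carrier R" "arep j t = t" "nf y" "\<not> starts j y" "cons j t y = x"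
    using nf_top_rest x j by (auto simp: t_def y_def)
  define s where "s = a \<oplus>\<^bsub>R\<^esub> t"
  have s: "s \<in> carrier R" using a ty by (simp add: s_def)
  have "extension (aact j a x) = actB (b j) (arep j s) \<otimes>\<^bsub>B\<^esub> (f (acof j s) \<otimes>\<^bsub>B\<^esub> extension y)"
    using aact_cons[OF ty(3,4) j ty(1,2), of a] ty(3,5) j s
    by (simp add: s_def[symmetric] extension_cons extension_gact)
  also have "\<dots> = actB (b j) (arep j s \<oplus>\<^bsub>R\<^esub> \<kappa> j (acof j s)) \<otimes>\<^bsub>B\<^esub> extension y"
    using j s ty(3) by (simp add: B.act_add f_C[OF j acof_in[OF j s]] B.G.m_assoc)
  also have "\<dots> = actB (b j) a \<otimes>\<^bsub>B\<^esub> (actB (b j) t \<otimes>\<^bsub>B\<^esub> extension y)"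
    using j s a ty(1,3) by (simp add: acof_props) (simp add: s_def B.act_add B.G.m_assoc)
  also have "actB (b j) t \<otimes>\<^bsub>B\<^esub> extension y = extension x"
    using extension_cons[OF j ty(1,3)] ty(5) by simp
  finally show ?thesis .
qed

lemma extension_mul:
  "nf x \<Longrightarrow> nf y \<Longrightarrow> extension (mul x y) = extension x \<otimes>\<^bsub>B\<^esub> extension y"
  by (induction x) (simp_all add: extension_gact extension_aact B.G.m_assoc)

lemma extension_hom: "extension \<in> hom amalgam B"
  by (auto simp: hom_def extension_mul)

lemma extension_axis: "j \<in> J \<Longrightarrow> a \<in> carrier R \<Longrightarrow> extension (axis j a) = actB (b j) a"
  by (simp add: axis_def extension_aact)

lemma extension_amalgam_axes:
  assumes "e \<in> amalgam_axes" "a \<in> carrier R"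
  shows "extension (e a) = actB (extension (e \<one>\<^bsub>R\<^esub>)) a"
proof -
  from assms(1) consider d where "d \<in> E" "e = (\<lambda>a. Tip (d a))" | j where "j \<in> J" "e = axis j"
    by (auto simp: amalgam_axes_def)
  then show ?thesis
  proof cases
    case 1
    then show ?thesis using f_axis[OF 1(1) assms(2)] by (simp only: extension.simps)
  next
    case 2
    then show ?thesis using assms(2) by (simp add: extension_axis B.act_one)
  qed
qed

end

context star_amalgam
begin

lemma amalgam_generated:
  assumes K: "subgroup K amalgam" and T: "\<And>g. g \<in> carrier G \<Longrightarrow> Tip g \<in> K"
    and A: "\<And>j a. j \<in> J \<Longrightarrow> a \<in> carrier R \<Longrightarrow> axis j a \<in> K"
  shows "nf x \<Longrightarrow> x \<in> K"
proof (induction x)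
  case (Tip g) then show ?case using T by simp
next
  case (Nd r j t n)
  have "aact j t n = Nd \<one> j t n"
    using aact_stripped[of j t n] acof_eqI[of j t \<one>] Nd.prems by (auto simp: cons_def)
  then have "Nd r j t n = mul (Tip r) (mul (axis j t) n)"
    using Nd.prems by (simp add: mul_axis lcof_def)
  moreover have "mul (axis j t) n \<in> K"
    using subgroup.m_closed[OF K A[of j t] Nd.IH] Nd.prems by simp
  moreover have "r \<in> carrier G" using Nd.prems by simp
  ultimately show ?case using subgroup.m_closed[OF K T, of r "mul (axis j t) n"] by simp
qed

end

text \<open>The last clause is the form in which \<open>cover\<close> is inherited: cyclic subgroups
  occur without a choice of representatives, which is made only when the next stage is
  built.\<close>

definition stage ::
  "('a, 'r) ring_scheme \<Rightarrow> ('b, 'n) monoid_scheme \<Rightarrow> ('b \<Rightarrow> 'a \<Rightarrow> 'b) \<Rightarrow>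
   ('g, 'm) monoid_scheme \<Rightarrow> ('a \<Rightarrow> 'g) set \<Rightarrow> ('g \<Rightarrow> 'b) \<Rightarrow> bool" where
  "stage R B actB G E f \<longleftrightarrow>
     axis_family R G E \<and> f \<in> hom G B \<and>
     (\<forall>e\<in>E. \<forall>a\<in>carrier R. f (e a) = actB (f (e \<one>\<^bsub>R\<^esub>)) a) \<and>
     (\<forall>x\<in>carrier G. x \<noteq> \<one>\<^bsub>G\<^esub> \<longrightarrow> axial R G E x \<or>
        (\<exists>q\<in>carrier G. \<exists>u. \<exists>k::int. malnormal_cyclic G u \<and>
           x = q \<otimes>\<^bsub>G\<^esub> u [^]\<^bsub>G\<^esub> k \<otimes>\<^bsub>G\<^esub> inv\<^bsub>G\<^esub> q))"

lemma (in star_amalgam_map) stage_amalgam: "stage R B actB amalgam amalgam_axes extension"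
  unfolding stage_def
proof (intro conjI ballI impI)
  fix x assume "x \<in> carrier amalgam" "x \<noteq> \<one>\<^bsub>amalgam\<^esub>"
  then have x: "nf x" "x \<noteq> Tip \<one>" by simp_all
  show "axial R amalgam amalgam_axes x \<or> (\<exists>q\<in>carrier amalgam. \<exists>u. \<exists>k::int. malnormal_cyclic amalgam u \<and>
      x = q \<otimes>\<^bsub>amalgam\<^esub> u [^]\<^bsub>amalgam\<^esub> k \<otimes>\<^bsub>amalgam\<^esub> inv\<^bsub>amalgam\<^esub> q)"
    using amalgam_cover[OF x] unfolding amalgam_simps mem_Collect_eq by blast
qed (rule A.axis_family_axioms extension_hom extension_amalgam_axes; assumption)+

section \<open>Transport of stages along isomorphisms\<close>

locale group_iso = P: group P + Q: group Q
  for P :: "('p, 'm) monoid_scheme" and Q :: "('q, 'n) monoid_scheme" +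
  fixes h :: "'p \<Rightarrow> 'q"
  assumes h_hom: "h \<in> hom P Q" and h_bij: "bij_betw h (carrier P) (carrier Q)"
begin

lemma h_closed [simp]: "x \<in> carrier P \<Longrightarrow> h x \<in> carrier Q"
  and h_mult: "x \<in> carrier P \<Longrightarrow> y \<in> carrier P \<Longrightarrow> h (x \<otimes>\<^bsub>P\<^esub> y) = h x \<otimes>\<^bsub>Q\<^esub> h y"
  using h_hom by (auto simp: hom_def)

lemma h_one: "h \<one>\<^bsub>P\<^esub> = \<one>\<^bsub>Q\<^esub>"
  using hom_one[OF h_hom P.is_group Q.is_group] .

lemma h_conj: "p \<in> carrier P \<Longrightarrow> x \<in> carrier P \<Longrightarrow>
    h (p \<otimes>\<^bsub>P\<^esub> x \<otimes>\<^bsub>P\<^esub> inv\<^bsub>P\<^esub> p) = h p \<otimes>\<^bsub>Q\<^esub> h x \<otimes>\<^bsub>Q\<^esub> inv\<^bsub>Q\<^esub> (h p)"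
  using group_hom.hom_inv[of P Q h p] h_hom
  by (simp add: h_mult group_hom_def group_hom_axioms_def P.is_group Q.is_group)

lemma h_pow: "x \<in> carrier P \<Longrightarrow> h (x [^]\<^bsub>P\<^esub> (n::int)) = h x [^]\<^bsub>Q\<^esub> n"
  using hom_int_pow[OF h_hom _ P.is_group Q.is_group] .

lemma h_eq_iff: "x \<in> carrier P \<Longrightarrow> y \<in> carrier P \<Longrightarrow> h x = h y \<longleftrightarrow> x = y"
  using h_bij by (auto simp: bij_betw_def inj_on_def)

lemma h_surj: assumes "y \<in> carrier Q" obtains x where "x \<in> carrier P" "y = h x"
  using h_bij assms by (auto simp: bij_betw_def)

lemma malnormal_cyclic_iso:
  assumes "malnormal_cyclic P u" shows "malnormal_cyclic Q (h u)"
  unfolding malnormal_cyclic_def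
proof (intro conjI ballI allI impI)
  have u: "u \<in> carrier P" using assms by (simp add: malnormal_cyclic_def)
  show "h u \<in> carrier Q" using u by simp
  show "n = 0" if "h u [^]\<^bsub>Q\<^esub> n = \<one>\<^bsub>Q\<^esub>" for n :: int
  proof -
    have "h (u [^]\<^bsub>P\<^esub> n) = h \<one>\<^bsub>P\<^esub>" using that u by (simp add: h_pow h_one)
    then have "u [^]\<^bsub>P\<^esub> n = \<one>\<^bsub>P\<^esub>" using u by (subst (asm) h_eq_iff) simp_all
    then show ?thesis using assms by (simp add: malnormal_cyclic_def)
  qed
  fix q and m k :: int
  assume q: "q \<in> carrier Q" "q \<otimes>\<^bsub>Q\<^esub> h u [^]\<^bsub>Q\<^esub> m \<otimes>\<^bsub>Q\<^esub> inv\<^bsub>Q\<^esub> q = h u [^]\<^bsub>Q\<^esub> k" "h u [^]\<^bsub>Q\<^esub> k \<noteq> \<one>\<^bsub>Q\<^esub>"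
  obtain p where p: "p \<in> carrier P" "q = h p" using h_surj q(1) .
  have "h (p \<otimes>\<^bsub>P\<^esub> u [^]\<^bsub>P\<^esub> m \<otimes>\<^bsub>P\<^esub> inv\<^bsub>P\<^esub> p) = h (u [^]\<^bsub>P\<^esub> k)"
    using q p u by (simp add: h_conj h_pow)
  then have "p \<otimes>\<^bsub>P\<^esub> u [^]\<^bsub>P\<^esub> m \<otimes>\<^bsub>P\<^esub> inv\<^bsub>P\<^esub> p = u [^]\<^bsub>P\<^esub> k"
    using p u by (subst (asm) h_eq_iff) simp_all
  moreover have "u [^]\<^bsub>P\<^esub> k \<noteq> \<one>\<^bsub>P\<^esub>" using q(3) u by (metis h_one h_pow)
  ultimately obtain n :: int where "p = u [^]\<^bsub>P\<^esub> n"
    using assms p(1) unfolding malnormal_cyclic_def by blast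
  then show "\<exists>n::int. q = h u [^]\<^bsub>Q\<^esub> n" using p u by (auto simp: h_pow)
qed

lemma axial_iso:
  assumes "axis_family R P E" "axial R P E x"
  shows "axial R Q ((\<lambda>e a. h (e a)) ` E) (h x)"
proof -
  obtain p e a where p: "p \<in> carrier P" "e \<in> E" "a \<in> carrier R" "x = p \<otimes>\<^bsub>P\<^esub> e a \<otimes>\<^bsub>P\<^esub> inv\<^bsub>P\<^esub> p"
    using assms by (auto simp: axial_def)
  then have "h x = h p \<otimes>\<^bsub>Q\<^esub> h (e a) \<otimes>\<^bsub>Q\<^esub> inv\<^bsub>Q\<^esub> (h p)"
    using axis_family.axis_closed[OF assms(1)] by (simp add: h_conj)
  then show ?thesis using p unfolding axial_def
    by (intro bexI[of _ "h p"] bexI[of _ "\<lambda>a. h (e a)"] bexI[of _ a]) simp_all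
qed

lemma axis_family_iso:
  assumes "axis_family R P E" shows "axis_family R Q ((\<lambda>e a. h (e a)) ` E)"
proof -
  interpret F: axis_family R P E by (rule assms)
  show ?thesis
  proof unfold_locales
    fix e a assume "e \<in> (\<lambda>e a. h (e a)) ` E" "a \<in> carrier R"
    then show "e a \<in> carrier Q" by auto
  next
    fix e a b assume "e \<in> (\<lambda>e a. h (e a)) ` E" "a \<in> carrier R" "b \<in> carrier R"
    then show "e (a \<oplus>\<^bsub>R\<^esub> b) = e a \<otimes>\<^bsub>Q\<^esub> e b" by (auto simp: F.axis_add h_mult)
  next
    fix e a assume "e \<in> (\<lambda>e a. h (e a)) ` E" and a: "a \<in> carrier R" "e a = \<one>\<^bsub>Q\<^esub>"
    then obtain e' where e: "e' \<in> E" "e a = h (e' a)" by blast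
    have "h (e' a) = h \<one>\<^bsub>P\<^esub>" using a e by (simp add: h_one)
    then have "e' a = \<one>\<^bsub>P\<^esub>" using e a by (subst (asm) h_eq_iff) simp_all
    then show "a = \<zero>\<^bsub>R\<^esub>" using F.axis_inj e a by blast
  next
    fix e e' g a b
    assume "e \<in> (\<lambda>e a. h (e a)) ` E" "e' \<in> (\<lambda>e a. h (e a)) ` E" and g: "g \<in> carrier Q"
      and a: "a \<in> carrier R" "b \<in> carrier R"
      and eq: "g \<otimes>\<^bsub>Q\<^esub> e a \<otimes>\<^bsub>Q\<^esub> inv\<^bsub>Q\<^esub> g = e' b" "e' b \<noteq> \<one>\<^bsub>Q\<^esub>"
    then obtain d d' where d: "d \<in> E" "d' \<in> E" "e = (\<lambda>a. h (d a))" "e' = (\<lambda>a. h (d' a))" by blast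
    obtain p where p: "p \<in> carrier P" "g = h p" using h_surj g .
    have "h (p \<otimes>\<^bsub>P\<^esub> d a \<otimes>\<^bsub>P\<^esub> inv\<^bsub>P\<^esub> p) = h (d' b)" using eq p d a by (simp add: h_conj)
    then have "p \<otimes>\<^bsub>P\<^esub> d a \<otimes>\<^bsub>P\<^esub> inv\<^bsub>P\<^esub> p = d' b" using p d a by (subst (asm) h_eq_iff) simp_all
    moreover have "d' b \<noteq> \<one>\<^bsub>P\<^esub>" using eq(2) d h_one by auto
    ultimately have "d = d' \<and> (\<exists>c\<in>carrier R. p = d c)"
      using F.axis_malnormal[of d d' p a b] p d a by blast
    then show "e = e' \<and> (\<exists>c\<in>carrier R. g = e c)" using p d by auto
  qed
qed

lemma stage_iso:
  assumes st: "stage R B actB P E f" and k: "\<And>x. x \<in> carrier P \<Longrightarrow> k (h x) = x"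
  shows "stage R B actB Q ((\<lambda>e a. h (e a)) ` E) (\<lambda>y. f (k y))"
proof -
  have F: "axis_family R P E" using st by (simp add: stage_def)
  interpret F: axis_family R P E by (rule F)
  show ?thesis
    unfolding stage_def
  proof (intro conjI ballI impI)
    show "axis_family R Q ((\<lambda>e a. h (e a)) ` E)" by (rule axis_family_iso[OF F])
    show "(\<lambda>y. f (k y)) \<in> hom Q B"
    proof (rule homI)
      fix x y assume "x \<in> carrier Q" "y \<in> carrier Q"
      then obtain x' y' where "x' \<in> carrier P" "x = h x'" "y' \<in> carrier P" "y = h y'" by (metis h_surj)
      then show "f (k (x \<otimes>\<^bsub>Q\<^esub> y)) = f (k x) \<otimes>\<^bsub>B\<^esub> f (k y)"
        using st k by (simp add: stage_def hom_def h_mult[symmetric])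
    next
      fix x assume "x \<in> carrier Q"
      then obtain x' where "x' \<in> carrier P" "x = h x'" by (metis h_surj)
      then show "f (k x) \<in> carrier B" using st k by (auto simp: stage_def hom_def)
    qed
    show "f (k (e a)) = actB (f (k (e \<one>\<^bsub>R\<^esub>))) a" if "e \<in> (\<lambda>e a. h (e a)) ` E" "a \<in> carrier R" for e a
    proof -
      obtain d where d: "d \<in> E" "e = (\<lambda>a. h (d a))" using \<open>e \<in> _\<close> by blast
      then have kd: "k (e c) = d c" if "c \<in> carrier R" for c using k that by simp
      have "f (d a) = actB (f (d \<one>\<^bsub>R\<^esub>)) a" using st d(1) that(2) unfolding stage_def by blast
      then show ?thesis using kd that(2) by simp
    qed
    fix y assume y: "y \<in> carrier Q" "y \<noteq> \<one>\<^bsub>Q\<^esub>"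
    obtain x where x: "x \<in> carrier P" "y = h x" using h_surj y(1) .
    have "x \<noteq> \<one>\<^bsub>P\<^esub>" using x y h_one by auto
    then have "axial R P E x \<or> (\<exists>q\<in>carrier P. \<exists>u. \<exists>k::int. malnormal_cyclic P u \<and>
           x = q \<otimes>\<^bsub>P\<^esub> u [^]\<^bsub>P\<^esub> k \<otimes>\<^bsub>P\<^esub> inv\<^bsub>P\<^esub> q)"
      using st x unfolding stage_def by blast
    then show "axial R Q ((\<lambda>e a. h (e a)) ` E) y \<or> (\<exists>q\<in>carrier Q. \<exists>u. \<exists>k::int. malnormal_cyclic Q u \<and>
           y = q \<otimes>\<^bsub>Q\<^esub> u [^]\<^bsub>Q\<^esub> k \<otimes>\<^bsub>Q\<^esub> inv\<^bsub>Q\<^esub> q)"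
    proof
      assume "axial R P E x" then show ?thesis using axial_iso[OF F] x by blast
    next
      assume "\<exists>q\<in>carrier P. \<exists>u. \<exists>k::int. malnormal_cyclic P u \<and> x = q \<otimes>\<^bsub>P\<^esub> u [^]\<^bsub>P\<^esub> k \<otimes>\<^bsub>P\<^esub> inv\<^bsub>P\<^esub> q"
      then obtain q u and k :: int where q: "q \<in> carrier P" "malnormal_cyclic P u"
        "x = q \<otimes>\<^bsub>P\<^esub> u [^]\<^bsub>P\<^esub> k \<otimes>\<^bsub>P\<^esub> inv\<^bsub>P\<^esub> q" by blast
      moreover from this have "u \<in> carrier P" by (simp add: malnormal_cyclic_def)
      ultimately have "y = h q \<otimes>\<^bsub>Q\<^esub> h u [^]\<^bsub>Q\<^esub> k \<otimes>\<^bsub>Q\<^esub> inv\<^bsub>Q\<^esub> (h q)"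
        using x by (simp add: h_conj h_pow)
      with malnormal_cyclic_iso[OF q(2)] h_closed[OF q(1)] show ?thesis by blast
    qed
  qed
qed

end

text \<open>All stages live in one type: an element that is new at stage \<open>n\<close> is tagged with \<open>n\<close>, so that
  every stage is literally contained in the next.\<close>

datatype ('x, 'a) univ = Base "'x option" | Enc nat "(('x, 'a) univ, ('x, 'a) univ, 'a) nf"

text \<open>No element tagged \<open>Enc n\<close> is in \<open>below n\<close>, so the tag
  \<open>n\<close> creates elements that are fresh for a group inside \<open>below n\<close>.
  \<open>Base\<close> elements belong to every level.\<close>

definition below :: "nat \<Rightarrow> ('x, 'a) univ set" where
  "below n = {u. \<forall>m y. u = Enc m y \<longrightarrow> m < n}"

definition extends ::
  "'g monoid \<Rightarrow> ('a \<Rightarrow> 'g) set \<Rightarrow> ('g \<Rightarrow> 'b) \<Rightarrow> 'g monoid \<Rightarrow> ('a \<Rightarrow> 'g) set \<Rightarrow> ('g \<Rightarrow> 'b) \<Rightarrow> bool" where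
  "extends G E f G' E' f' \<longleftrightarrow> carrier G \<subseteq> carrier G' \<and> \<one>\<^bsub>G'\<^esub> = \<one>\<^bsub>G\<^esub> \<and> E \<subseteq> E' \<and>
     (\<forall>x\<in>carrier G. f' x = f x) \<and>
     (\<forall>x\<in>carrier G. \<forall>y\<in>carrier G. x \<otimes>\<^bsub>G'\<^esub> y = x \<otimes>\<^bsub>G\<^esub> y)"

lemma univ_extension:
  fixes R :: "('a, 'r) ring_scheme" and G :: "('x, 'a) univ monoid" and J :: "('x, 'a) univ set"
  assumes "star_amalgam_map R G E J C \<kappa> B actB f b" and n: "carrier G \<subseteq> below n"
  shows "\<exists>G' E' f' ax. stage R B actB G' E' f' \<and> extends G E f G' E' f' \<and> carrier G' \<subseteq> below (Suc n) \<and>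
    (\<forall>x\<in>carrier G. x \<noteq> \<one>\<^bsub>G\<^esub> \<longrightarrow> axial R G' E' x) \<and>
    (\<forall>j\<in>J. ax j \<in> E' \<and> (\<forall>c\<in>C j. ax j (\<kappa> j c) = c) \<and> (\<forall>a\<in>carrier R. f' (ax j a) = actB (b j) a)) \<and>
    (\<forall>K. subgroup K G' \<and> carrier G \<subseteq> K \<and> (\<forall>j\<in>J. \<forall>a\<in>carrier R. ax j a \<in> K) \<longrightarrow> carrier G' \<subseteq> K)"
proof -
  interpret star_amalgam_map R G E J C \<kappa> B actB f b by (rule assms)
  define h :: "(('x, 'a) univ, ('x, 'a) univ, 'a) nf \<Rightarrow> ('x, 'a) univ"
    where "h x = (case x of Tip g \<Rightarrow> g | Nd _ _ _ _ \<Rightarrow> Enc n x)" for x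
  have h_Tip [simp]: "h (Tip g) = g" for g by (simp add: h_def)
  have inj: "inj_on h (Collect nf)"
  proof (rule inj_onI)
    fix x y assume "x \<in> Collect nf" "y \<in> Collect nf" "h x = h y"
    then show "x = y" using n by (cases x; cases y) (auto simp: h_def below_def)
  qed
  define k where "k = inv_into (Collect nf) h"
  have kh: "k (h x) = x" if "nf x" for x using inj that by (simp add: k_def)
  define Q where "Q = \<lparr>carrier = h ` Collect nf, mult = (\<lambda>x y. h (mul (k x) (k y))), one = h (Tip \<one>\<^bsub>G\<^esub>)\<rparr>"
  have Q [simp]: "carrier Q = h ` Collect nf" "\<one>\<^bsub>Q\<^esub> = \<one>\<^bsub>G\<^esub>" "x \<otimes>\<^bsub>Q\<^esub> y = h (mul (k x) (k y))" for x y
    by (simp_all add: Q_def)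
  have gQ: "group Q"
  proof (rule groupI)
    fix x assume "x \<in> carrier Q"
    then obtain y where y: "nf y" "x = h y" by auto
    then show "\<exists>z\<in>carrier Q. z \<otimes>\<^bsub>Q\<^esub> x = \<one>\<^bsub>Q\<^esub>"
      by (intro bexI[of _ "h (inv\<^bsub>amalgam\<^esub> y)"]) (simp_all add: kh)
    have "k \<one>\<^bsub>G\<^esub> = Tip \<one>\<^bsub>G\<^esub>" using kh[of "Tip \<one>\<^bsub>G\<^esub>"] by simp
    then show "\<one>\<^bsub>Q\<^esub> \<otimes>\<^bsub>Q\<^esub> x = x" using y by (simp add: kh)
  next
    show "\<one>\<^bsub>Q\<^esub> \<in> carrier Q" using image_eqI[of "\<one>\<^bsub>G\<^esub>" h "Tip \<one>\<^bsub>G\<^esub>"] by simp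
  qed (auto simp: kh mul_assoc)
  interpret group_iso amalgam Q h
  proof (intro group_iso.intro group_iso_axioms.intro group_amalgam gQ)
    show "h \<in> hom amalgam Q" by (auto simp: hom_def kh)
    show "bij_betw h (carrier amalgam) (carrier Q)" using inj by (simp add: bij_betw_def)
  qed
  let ?E = "(\<lambda>e a. h (e a)) ` amalgam_axes" and ?f = "\<lambda>y. extension (k y)" and ?ax = "\<lambda>j a. h (axis j a)"
  have kT: "k g = Tip g" if "g \<in> carrier G" for g using kh[of "Tip g"] that by simp
  have "stage R B actB Q ?E ?f" by (rule stage_iso[OF stage_amalgam]) (simp add: kh)
  moreover have "extends G E f Q ?E ?f"
    unfolding extends_def
  proof (intro conjI ballI)
    show "carrier G \<subseteq> carrier Q" using image_eqI[of _ h "Tip _"] by fastforce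
    show "E \<subseteq> ?E" by (force simp: amalgam_axes_def image_iff)
  qed (simp_all add: kT)
  moreover have "carrier Q \<subseteq> below (Suc n)"
  proof
    fix u assume "u \<in> carrier Q"
    then obtain x where "nf x" "u = h x" by auto
    then show "u \<in> below (Suc n)" using n by (cases x) (auto simp: h_def below_def less_Suc_eq)
  qed
  moreover have "\<forall>x\<in>carrier G. x \<noteq> \<one>\<^bsub>G\<^esub> \<longrightarrow> axial R Q ?E x"
    using axial_iso[OF A.axis_family_axioms axial_Tip] by simp
  moreover have "\<forall>j\<in>J. ?ax j \<in> ?E \<and> (\<forall>c\<in>C j. ?ax j (\<kappa> j c) = c) \<and> (\<forall>a\<in>carrier R. ?f (?ax j a) = actB (b j) a)"
    by (auto simp: amalgam_axes_def axis_\<kappa> kh extension_axis)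
  moreover have "\<forall>K. subgroup K Q \<and> carrier G \<subseteq> K \<and> (\<forall>j\<in>J. \<forall>a\<in>carrier R. ?ax j a \<in> K) \<longrightarrow> carrier Q \<subseteq> K"
  proof (intro allI impI subsetI, elim conjE)
    fix K u assume K: "subgroup K Q" "carrier G \<subseteq> K" "\<forall>j\<in>J. \<forall>a\<in>carrier R. ?ax j a \<in> K" and "u \<in> carrier Q"
    then obtain x where x: "nf x" "u = h x" by auto
    let ?K = "{y. nf y \<and> h y \<in> K}"
    have "subgroup ?K amalgam"
    proof (rule P.subgroupI)
      fix y assume y: "y \<in> ?K"
      have "h (inv\<^bsub>amalgam\<^esub> y) = inv\<^bsub>Q\<^esub> (h y)"
        using y by (intro Q.inv_equality[symmetric]) (auto simp: kh)
      then show "inv\<^bsub>amalgam\<^esub> y \<in> ?K" using y subgroup.m_inv_closed[OF K(1), of "h y"] by simp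
      fix z assume "z \<in> ?K"
      then show "y \<otimes>\<^bsub>amalgam\<^esub> z \<in> ?K" using y subgroup.m_closed[OF K(1), of "h y" "h z"] by (simp add: kh)
    next
      have "Tip \<one>\<^bsub>G\<^esub> \<in> ?K" using subgroup.one_closed[OF K(1)] by simp
      then show "?K \<noteq> {}" by blast
    qed auto
    then have "x \<in> ?K"
    proof (rule amalgam_generated[OF _ _ _ x(1)])
      show "Tip g \<in> ?K" if "g \<in> carrier G" for g using K(2) that by auto
      show "axis j a \<in> ?K" if "j \<in> J" "a \<in> carrier R" for j a using K(3) that by simp
    qed
    then show "u \<in> K" using x by simp
  qed
  ultimately show ?thesis
    by (intro exI[of _ Q] exI[of _ ?E] exI[of _ ?f] exI[of _ ?ax] conjI)
qed

lemma (in A_group) act_int: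
  assumes "g \<in> carrier G"
  shows "act g (add_pow R (k::int) \<one>\<^bsub>R\<^esub>) = g [^]\<^bsub>G\<^esub> k"
proof -
  have "act g \<in> hom (add_monoid R) G"
    using assms by (auto simp: hom_def act_closed act_add)
  from hom_int_pow[OF this _ R.a_group G.is_group, of "\<one>\<^bsub>R\<^esub>" k]
  show ?thesis using assms by (simp add: act_one add_pow_def)
qed

lemma (in ring) add_pow_one_inj:
  assumes "ring_char_zero R" "add_pow R (k::int) \<one> = \<zero>" shows "k = 0"
proof (rule ccontr)
  assume "k \<noteq> 0"
  then consider n :: nat where "k = int n" "n > 0" | n :: nat where "k = - int n" "n > 0"
    by (cases k rule: int_cases2) auto
  then show False
  proof cases
    case 1
    then show ?thesis using assms by (simp add: ring_char_zero_def add_pow_int_ge)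
  next
    case 2
    then have "\<ominus> ([n] \<cdot> \<one>) = \<zero>" using assms add_pow_int_lt[of k R \<one>] by simp
    then have "[n] \<cdot> \<one> = \<zero>" by (metis add.inv_eq_1_iff add.nat_pow_closed one_closed)
    then show ?thesis using assms 2 by (simp add: ring_char_zero_def)
  qed
qed

section \<open>Conjugacy of malnormal cyclic subgroups\<close>

context group
begin

lemma malnormal_cyclic_inv:
  assumes "malnormal_cyclic G u" "q \<in> carrier G" "q \<otimes> u [^] (m::int) \<otimes> inv q = u [^] (k::int)" "u [^] k \<noteq> \<one>"
  shows "\<exists>n::int. q = u [^] n"
  using assms unfolding malnormal_cyclic_def by blast

text \<open>For elements of infinite order this is conjugacy of the cyclic subgroups they generate,
  since such a subgroup has exactly two generators.\<close>

definition conj_or_inv :: "'a \<Rightarrow> 'a \<Rightarrow> bool" where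
  "conj_or_inv u v \<longleftrightarrow> (\<exists>g\<in>carrier G. v = g \<otimes> u \<otimes> inv g \<or> v = inv (g \<otimes> u \<otimes> inv g))"

lemma conj_inv: "g \<in> carrier G \<Longrightarrow> u \<in> carrier G \<Longrightarrow> inv (g \<otimes> u \<otimes> inv g) = g \<otimes> inv u \<otimes> inv g"
  by (simp add: inv_mult_group m_assoc)

lemma conj_conj: "g \<in> carrier G \<Longrightarrow> h \<in> carrier G \<Longrightarrow> u \<in> carrier G \<Longrightarrow>
    h \<otimes> (g \<otimes> u \<otimes> inv g) \<otimes> inv h = (h \<otimes> g) \<otimes> u \<otimes> inv (h \<otimes> g)"
  by (simp add: inv_mult_group m_assoc)

lemma conj_cancel: "g \<in> carrier G \<Longrightarrow> u \<in> carrier G \<Longrightarrow> inv g \<otimes> (g \<otimes> u \<otimes> inv g) \<otimes> inv (inv g) = u"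
  using conj_conj[of g "inv g" u] by simp

lemma conj_or_inv_refl: "u \<in> carrier G \<Longrightarrow> conj_or_inv u u"
  unfolding conj_or_inv_def by (intro bexI[of _ \<one>]) simp_all

lemma conj_or_inv_sym: assumes "u \<in> carrier G" "conj_or_inv u v" shows "conj_or_inv v u"
proof -
  obtain g where g: "g \<in> carrier G" "v = g \<otimes> u \<otimes> inv g \<or> v = inv (g \<otimes> u \<otimes> inv g)"
    using assms unfolding conj_or_inv_def by blast
  have "u = inv g \<otimes> v \<otimes> inv (inv g) \<or> u = inv (inv g \<otimes> v \<otimes> inv (inv g))"
    using g assms conj_cancel[of g u] conj_cancel[of g "inv u"] by (auto simp: conj_inv simp del: inv_inv)
  then show ?thesis using g unfolding conj_or_inv_def by (metis inv_closed)
qed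

lemma conj_or_inv_trans:
  assumes "u \<in> carrier G" "conj_or_inv u v" "conj_or_inv v w" shows "conj_or_inv u w"
proof -
  obtain g where g: "g \<in> carrier G" "v = g \<otimes> u \<otimes> inv g \<or> v = inv (g \<otimes> u \<otimes> inv g)"
    using assms unfolding conj_or_inv_def by blast
  then have v: "v = g \<otimes> u \<otimes> inv g \<or> v = g \<otimes> inv u \<otimes> inv g" using assms by (simp add: conj_inv)
  obtain h where h: "h \<in> carrier G" "w = h \<otimes> v \<otimes> inv h \<or> w = inv (h \<otimes> v \<otimes> inv h)"
    using assms unfolding conj_or_inv_def by blast
  have "w = (h \<otimes> g) \<otimes> u \<otimes> inv (h \<otimes> g) \<or> w = inv ((h \<otimes> g) \<otimes> u \<otimes> inv (h \<otimes> g))"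
    using v h(2)
    by (elim disjE) (use g(1) h(1) assms(1) in \<open>simp_all only: conj_conj conj_inv inv_closed m_closed inv_inv simp_thms\<close>)
  then show ?thesis using g h unfolding conj_or_inv_def by (metis m_closed)
qed

text \<open>The conjugate \<open>w\<close> of \<open>u\<close> commutes with its own power, which is
  a power of \<open>v\<close>; malnormality makes \<open>w\<close> a power of \<open>v\<close>.
  Symmetrically \<open>inv g v g\<close> is a power of \<open>u\<close>. The two exponents have
  product 1, so they are both 1 or both -1.\<close>

lemma malnormal_cyclic_conj_powers:
  assumes u: "malnormal_cyclic G u" and v: "malnormal_cyclic G v" and g: "g \<in> carrier G"
    and eq: "g \<otimes> u [^] (m::int) \<otimes> inv g = v [^] (k::int)" and ne: "v [^] k \<noteq> \<one>"
  shows "conj_or_inv u v"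
proof -
  have uc: "u \<in> carrier G" and vc: "v \<in> carrier G" using u v by (auto simp: malnormal_cyclic_def)
  define w where "w = g \<otimes> u \<otimes> inv g"
  have w: "w \<in> carrier G" using g uc by (simp add: w_def)
  have wm: "w [^] m = v [^] k" using conj_int_pow[OF g uc, of m] eq by (simp add: w_def)
  have "w \<otimes> w [^] m = w [^] m \<otimes> w"
    using w int_pow_mult[of w 1 m] int_pow_mult[of w m 1] by (simp add: add.commute)
  then have "w \<otimes> v [^] k \<otimes> inv w = v [^] k" using w vc wm by (simp add: inv_solve_right')
  then obtain n :: int where n: "w = v [^] n" using malnormal_cyclic_inv[OF v w _ ne] by blast
  define x where "x = inv g \<otimes> v \<otimes> g"
  have x: "x \<in> carrier G" using g vc by (simp add: x_def)
  have xk: "x [^] k = u [^] m"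
  proof -
    have "x [^] k = inv g \<otimes> v [^] k \<otimes> g" using conj_int_pow[of "inv g" v k] g vc by (simp add: x_def)
    also have "\<dots> = u [^] m" using conj_cancel[of g "u [^] m"] g uc eq by simp
    finally show ?thesis .
  qed
  have "x \<otimes> x [^] k = x [^] k \<otimes> x"
    using x int_pow_mult[of x 1 k] int_pow_mult[of x k 1] by (simp add: add.commute)
  then have "x \<otimes> u [^] m \<otimes> inv x = u [^] m" using x uc xk by (simp add: inv_solve_right')
  moreover have "u [^] m \<noteq> \<one>" using eq ne g by auto
  ultimately obtain n' :: int where n': "x = u [^] n'" using malnormal_cyclic_inv[OF u x] by blast
  have "v = g \<otimes> x \<otimes> inv g"
    using conj_cancel[of "inv g" v] g vc by (simp add: x_def)
  also have "\<dots> = v [^] (n * n')"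
    using conj_int_pow[OF g uc, of n'] n vc unfolding n' w_def[symmetric] by (simp add: int_pow_pow)
  finally have "v [^] (n * n' - 1) = \<one>" using vc by (simp add: int_pow_diff)
  then have "n * n' = 1" using v unfolding malnormal_cyclic_def by (metis eq_iff_diff_eq_0)
  then have "n = 1 \<or> n = -1" by (auto simp: zmult_eq_1_iff)
  then have "v = w \<or> v = inv w" using n vc by (auto simp: int_pow_neg)
  then show ?thesis unfolding conj_or_inv_def w_def using g by blast
qed

end

text \<open>One copy of \<open>R\<close> is glued per conjugacy class of malnormal cyclic subgroups
  off the axes, since two conjugate ones would violate \<open>C_malnormal\<close>. In the last
  clause an axis belongs to \<open>K\<close> as soon as its point \<open>e \<one>\<close> does; this
  replaces closure under an action that does not exist yet.\<close>

lemma stage_step: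
  fixes R :: "('a, 'r) ring_scheme" and G :: "('x, 'a) univ monoid"
  assumes st: "stage R B actB G E f" and B: "A_group R B actB"
    and char: "ring_char_zero R" and tf: "additive_torsion_free R" and n: "carrier G \<subseteq> below n"
  shows "\<exists>G' E' f'. stage R B actB G' E' f' \<and> extends G E f G' E' f' \<and> carrier G' \<subseteq> below (Suc n) \<and>
    (\<forall>x\<in>carrier G. x \<noteq> \<one>\<^bsub>G\<^esub> \<longrightarrow> axial R G' E' x) \<and>
    (\<forall>K. subgroup K G' \<and> carrier G \<subseteq> K \<and> (\<forall>e\<in>E'. e \<one>\<^bsub>R\<^esub> \<in> K \<longrightarrow> (\<forall>a\<in>carrier R. e a \<in> K)) \<longrightarrow>
       carrier G' \<subseteq> K)"
proof -
  interpret axis_family R G E using st by (simp add: stage_def)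
  interpret B: A_group R B actB by (rule B)
  have f: "f \<in> hom G B" using st by (simp add: stage_def)
  define M where "M = {u. malnormal_cyclic G u \<and> \<not> axial R G E u}"
  define rep where "rep u = (SOME v. v \<in> M \<and> G.conj_or_inv u v)" for u
  define J where "J = rep ` M"
  define C where "C u = range (\<lambda>k::int. u [^]\<^bsub>G\<^esub> k)" for u
  define ix where "ix u c = (SOME k::int. c = u [^]\<^bsub>G\<^esub> k)" for u c
  \<comment> \<open>\<open>u\<close> becomes the point \<open>\<one>\<close> of its axis. For
    \<open>u \<in> J\<close> the exponent is recovered by \<open>ix\<close> because \<open>u\<close>
    has infinite order.\<close>
  define \<kappa> where "\<kappa> u c = add_pow R (ix u c) \<one>\<^bsub>R\<^esub>" for u c
  have Mc: "u \<in> carrier G" "malnormal_cyclic G u" "\<not> axial R G E u" if "u \<in> M" for u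
    using that by (auto simp: M_def malnormal_cyclic_def)
  have rep: "rep u \<in> M \<and> G.conj_or_inv u (rep u)" if "u \<in> M" for u
    unfolding rep_def
    by (rule someI[of "\<lambda>v. v \<in> M \<and> G.conj_or_inv u v" u])
      (use that G.conj_or_inv_refl[OF Mc(1)[OF that]] in blast)
  \<comment> \<open>Equivalent elements are related to the same \<open>w\<close>, so
    \<open>SOME\<close> is applied to the same predicate.\<close>
  have rep_eq: "rep u = rep v" if "u \<in> M" "v \<in> M" "G.conj_or_inv u v" for u v
  proof -
    have "G.conj_or_inv u w \<longleftrightarrow> G.conj_or_inv v w" for w
      using that(3) G.conj_or_inv_trans[OF Mc(1)[OF that(1)]] G.conj_or_inv_trans[OF Mc(1)[OF that(2)]]
        G.conj_or_inv_sym[OF Mc(1)[OF that(1)]] by blast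
    then show ?thesis by (simp add: rep_def)
  qed
  have J: "u \<in> M" "rep u = u" if u: "u \<in> J" for u
  proof -
    obtain v where v: "v \<in> M" "u = rep v" using u unfolding J_def by blast
    then show "u \<in> M" using rep[OF v(1)] by blast
    then show "rep u = u" using rep_eq[OF v(1), of u] rep[OF v(1)] v(2) by metis
  qed
  have inj: "u [^]\<^bsub>G\<^esub> k = u [^]\<^bsub>G\<^esub> m \<longleftrightarrow> k = m" if "u \<in> J" for u and k m :: int
  proof
    assume "u [^]\<^bsub>G\<^esub> k = u [^]\<^bsub>G\<^esub> m"
    then have "u [^]\<^bsub>G\<^esub> (k - m) = \<one>\<^bsub>G\<^esub>" using J that Mc by (simp add: G.int_pow_diff)
    then have "k - m = 0" using Mc(2)[OF J(1)[OF that]] unfolding malnormal_cyclic_def by blast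
    then show "k = m" by simp
  qed simp
  have ix: "ix u (u [^]\<^bsub>G\<^esub> k) = k" if "u \<in> J" for u and k :: int
    unfolding ix_def using inj[OF that] by simp
  have \<kappa>: "\<kappa> u (u [^]\<^bsub>G\<^esub> k) = add_pow R k \<one>\<^bsub>R\<^esub>" if "u \<in> J" for u and k :: int
    using ix that by (simp add: \<kappa>_def)
  \<comment> \<open>\<open>u\<close> commutes with its powers, so it lies on every conjugate of an
    axis that contains a nontrivial one, contrary to \<open>u \<in> M\<close>.\<close>
  have not_axial_pow: "u [^]\<^bsub>G\<^esub> k = \<one>\<^bsub>G\<^esub>" if u: "u \<in> M" and ax: "axial R G E (u [^]\<^bsub>G\<^esub> k)" for u and k :: int
  proof (rule ccontr)
    assume ne: "u [^]\<^bsub>G\<^esub> k \<noteq> \<one>\<^bsub>G\<^esub>"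
    have uc: "u \<in> carrier G" using u Mc by blast
    obtain p e a where p: "p \<in> carrier G" "e \<in> E" "a \<in> carrier R"
      "u [^]\<^bsub>G\<^esub> k = p \<otimes>\<^bsub>G\<^esub> e a \<otimes>\<^bsub>G\<^esub> inv\<^bsub>G\<^esub> p" using ax by (auto simp: axial_def)
    have "u [^]\<^bsub>G\<^esub> k \<otimes>\<^bsub>G\<^esub> u = u \<otimes>\<^bsub>G\<^esub> u [^]\<^bsub>G\<^esub> k"
      using uc G.int_pow_mult[of u 1 k] G.int_pow_mult[of u k 1] by (simp add: add.commute)
    then obtain c where "c \<in> carrier R" "u = p \<otimes>\<^bsub>G\<^esub> e c \<otimes>\<^bsub>G\<^esub> inv\<^bsub>G\<^esub> p"
      using axis_centralizer[OF p(1-4) ne uc] by blast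
    then show False using p Mc(3)[OF u] by (auto simp: axial_def)
  qed
  have axial_pow: "axial R G E (u [^]\<^bsub>G\<^esub> k)" if u: "u \<in> carrier G" "axial R G E u" for u and k :: int
  proof (cases "u = \<one>\<^bsub>G\<^esub>")
    case True then show ?thesis using u by simp
  next
    case False
    obtain p e a where p: "p \<in> carrier G" "e \<in> E" "a \<in> carrier R"
      "u = p \<otimes>\<^bsub>G\<^esub> e a \<otimes>\<^bsub>G\<^esub> inv\<^bsub>G\<^esub> p" using u(2) by (auto simp: axial_def)
    have "u \<otimes>\<^bsub>G\<^esub> u [^]\<^bsub>G\<^esub> k = u [^]\<^bsub>G\<^esub> k \<otimes>\<^bsub>G\<^esub> u"
      using u G.int_pow_mult[of u 1 k] G.int_pow_mult[of u k 1] by (simp add: add.commute)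
    then obtain c where "c \<in> carrier R" "u [^]\<^bsub>G\<^esub> k = p \<otimes>\<^bsub>G\<^esub> e c \<otimes>\<^bsub>G\<^esub> inv\<^bsub>G\<^esub> p"
      using axis_centralizer[OF p(1-4) False, of "u [^]\<^bsub>G\<^esub> k"] u by auto
    then show ?thesis using p by (auto simp: axial_def)
  qed
  \<comment> \<open>\<open>f\<close> occurs twice: an index \<open>j\<close> is itself an element of
    \<open>G\<close> and becomes the point \<open>\<one>\<close> of its copy of \<open>R\<close>, so
    the prescribed image of that point is \<open>f j\<close>.\<close>
  have "star_amalgam_map R G E J C \<kappa> B actB f f"
  proof (intro star_amalgam_map.intro star_amalgam.intro star_amalgam_axioms.intro
      star_amalgam_map_axioms.intro axis_family_axioms B)
    fix j assume j: "j \<in> J"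
    then have jc: "j \<in> carrier G" using J Mc by blast
    show "subgroup (C j) G"
    proof (rule G.subgroupI, goal_cases)
      case 1 then show ?case using jc by (auto simp: C_def)
    next
      case 2 then show ?case by (simp add: C_def)
    next
      case (3 a) then show ?case using jc by (auto simp: C_def G.int_pow_neg[symmetric])
    next
      case (4 a b) then show ?case using jc by (auto simp: C_def G.int_pow_mult[symmetric])
    qed
    show "f j \<in> carrier B" using jc f by (auto simp: hom_def)
    fix c assume "c \<in> C j"
    then obtain k :: int where k: "c = j [^]\<^bsub>G\<^esub> k" by (auto simp: C_def)
    show "\<kappa> j c \<in> carrier R" by (simp add: \<kappa>_def)
    show "f c = actB (f j) (\<kappa> j c)"
      using hom_int_pow[OF f jc G.is_group B.G.is_group, of k] jc f j
      by (simp add: k \<kappa> B.act_int hom_in_carrier)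
    show "c = \<one>\<^bsub>G\<^esub>" if "\<kappa> j c = \<zero>\<^bsub>R\<^esub>"
      using that R.add_pow_one_inj[OF char, of k] by (simp add: k \<kappa> j)
    fix d assume "d \<in> C j"
    then obtain m :: int where m: "d = j [^]\<^bsub>G\<^esub> m" by (auto simp: C_def)
    show "\<kappa> j (c \<otimes>\<^bsub>G\<^esub> d) = \<kappa> j c \<oplus>\<^bsub>R\<^esub> \<kappa> j d"
      using j jc by (simp add: k m G.int_pow_mult[symmetric] \<kappa> R.add.int_pow_mult)
  next
    fix j k g c assume j: "j \<in> J" "k \<in> J" and g: "g \<in> carrier G" and c: "c \<in> C j" "g \<otimes>\<^bsub>G\<^esub> c \<otimes>\<^bsub>G\<^esub> inv\<^bsub>G\<^esub> g \<in> C k" "c \<noteq> \<one>\<^bsub>G\<^esub>"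
    then obtain m l :: int where m: "c = j [^]\<^bsub>G\<^esub> m" "g \<otimes>\<^bsub>G\<^esub> j [^]\<^bsub>G\<^esub> m \<otimes>\<^bsub>G\<^esub> inv\<^bsub>G\<^esub> g = k [^]\<^bsub>G\<^esub> l"
      by (auto simp: C_def)
    have jM: "j \<in> M" "k \<in> M" using j J by auto
    have ne: "k [^]\<^bsub>G\<^esub> l \<noteq> \<one>\<^bsub>G\<^esub>"
    proof
      assume "k [^]\<^bsub>G\<^esub> l = \<one>\<^bsub>G\<^esub>"
      then have "g \<otimes>\<^bsub>G\<^esub> j [^]\<^bsub>G\<^esub> m = \<one>\<^bsub>G\<^esub> \<otimes>\<^bsub>G\<^esub> g"
        using m g Mc(1)[OF jM(1)] G.conj_eq_iff(1)[of g "j [^]\<^bsub>G\<^esub> m" "\<one>\<^bsub>G\<^esub>"] by simp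
      then show False using m(1) c(3) g Mc(1)[OF jM(1)] by simp
    qed
    have "G.conj_or_inv j k"
      using G.malnormal_cyclic_conj_powers[OF Mc(2)[OF jM(1)] Mc(2)[OF jM(2)] g m(2) ne] .
    then have "rep j = rep k" using rep_eq jM by blast
    then have jk: "j = k" using J j by simp
    then obtain i :: int where "g = j [^]\<^bsub>G\<^esub> i"
      using G.malnormal_cyclic_inv[OF Mc(2)[OF jM(1)] g] m(2) ne by blast
    then show "j = k \<and> g \<in> C j" using jk by (auto simp: C_def)
  next
    fix j e g a assume *: "j \<in> J" "e \<in> E" "g \<in> carrier G" "a \<in> carrier R" "g \<otimes>\<^bsub>G\<^esub> e a \<otimes>\<^bsub>G\<^esub> inv\<^bsub>G\<^esub> g \<in> C j"
    then obtain k :: int where k: "g \<otimes>\<^bsub>G\<^esub> e a \<otimes>\<^bsub>G\<^esub> inv\<^bsub>G\<^esub> g = j [^]\<^bsub>G\<^esub> k" by (auto simp: C_def)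
    then have "axial R G E (j [^]\<^bsub>G\<^esub> k)" using * unfolding axial_def by metis
    then have "j [^]\<^bsub>G\<^esub> k = \<one>\<^bsub>G\<^esub>" using not_axial_pow J * by blast
    then have "g \<otimes>\<^bsub>G\<^esub> e a = \<one>\<^bsub>G\<^esub> \<otimes>\<^bsub>G\<^esub> g" using k * G.conj_eq_iff(1)[of g "e a" "\<one>\<^bsub>G\<^esub>"] by simp
    then show "e a = \<one>\<^bsub>G\<^esub>" using * by simp
  next
    fix x assume x: "x \<in> carrier G" "x \<noteq> \<one>\<^bsub>G\<^esub>"
    show "axial R G E x \<or> (\<exists>p\<in>carrier G. \<exists>j\<in>J. \<exists>c\<in>C j. x = p \<otimes>\<^bsub>G\<^esub> c \<otimes>\<^bsub>G\<^esub> inv\<^bsub>G\<^esub> p)"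
    proof (cases "axial R G E x")
      case False
      then obtain q u and k :: int where q: "q \<in> carrier G" "malnormal_cyclic G u"
        "x = q \<otimes>\<^bsub>G\<^esub> u [^]\<^bsub>G\<^esub> k \<otimes>\<^bsub>G\<^esub> inv\<^bsub>G\<^esub> q"
        using st x unfolding stage_def by blast
      have uc: "u \<in> carrier G" using q by (simp add: malnormal_cyclic_def)
      have "\<not> axial R G E u" using False axial_conjugate[OF q(1) axial_pow[OF uc]] q(3) by blast
      then have uM: "u \<in> M" using q by (simp add: M_def)
      define v where "v = rep u"
      have v: "v \<in> J" "v \<in> M" "G.conj_or_inv v u" "v \<in> carrier G"
        using rep[OF uM] uM Mc G.conj_or_inv_sym[OF uc] by (auto simp: v_def J_def)
      then obtain g where g: "g \<in> carrier G" "u = g \<otimes>\<^bsub>G\<^esub> v \<otimes>\<^bsub>G\<^esub> inv\<^bsub>G\<^esub> g \<or> u = g \<otimes>\<^bsub>G\<^esub> inv\<^bsub>G\<^esub> v \<otimes>\<^bsub>G\<^esub> inv\<^bsub>G\<^esub> g"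
        unfolding G.conj_or_inv_def using G.conj_inv[OF _ v(4)] by auto
      \<comment> \<open>\<open>s\<close> is 1 or -1, since \<open>u\<close> is a conjugate of its
        representative \<open>v\<close> or of the inverse of \<open>v\<close>.\<close>
      then obtain s :: int where "u = g \<otimes>\<^bsub>G\<^esub> v [^]\<^bsub>G\<^esub> s \<otimes>\<^bsub>G\<^esub> inv\<^bsub>G\<^esub> g"
        using v(4) by (metis G.int_pow_1 G.int_pow_neg)
      then have "x = (q \<otimes>\<^bsub>G\<^esub> g) \<otimes>\<^bsub>G\<^esub> v [^]\<^bsub>G\<^esub> (s * k) \<otimes>\<^bsub>G\<^esub> inv\<^bsub>G\<^esub> (q \<otimes>\<^bsub>G\<^esub> g)"
        using q g v(4) by (simp add: G.conj_int_pow G.int_pow_pow G.conj_conj)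
      then show ?thesis using q g v unfolding C_def by (intro disjI2 bexI[of _ "q \<otimes>\<^bsub>G\<^esub> g"] bexI[of _ v] bexI[of _ "v [^]\<^bsub>G\<^esub> (s * k)"]) auto
    qed simp
  next
    fix a assume a: "a \<in> carrier R" "a \<oplus>\<^bsub>R\<^esub> a = \<zero>\<^bsub>R\<^esub>"
    have "add_pow R (2::nat) a = a \<oplus>\<^bsub>R\<^esub> a" using a by (simp add: numeral_2_eq_2)
    then show "a = \<zero>\<^bsub>R\<^esub>" using a tf unfolding additive_torsion_free_def by (metis zero_less_numeral)
  next
    show "f (e a) = actB (f (e \<one>\<^bsub>R\<^esub>)) a" if "e \<in> E" "a \<in> carrier R" for e a
      using st that unfolding stage_def by blast
  qed (rule f)
  from univ_extension[OF this n] obtain G' E' f' ax where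
    1: "stage R B actB G' E' f'" "extends G E f G' E' f'" "carrier G' \<subseteq> below (Suc n)"
      "\<forall>x\<in>carrier G. x \<noteq> \<one>\<^bsub>G\<^esub> \<longrightarrow> axial R G' E' x"
    and ax: "\<forall>j\<in>J. ax j \<in> E' \<and> (\<forall>c\<in>C j. ax j (\<kappa> j c) = c) \<and> (\<forall>a\<in>carrier R. f' (ax j a) = actB (f j) a)"
    and gen: "\<forall>K. subgroup K G' \<and> carrier G \<subseteq> K \<and> (\<forall>j\<in>J. \<forall>a\<in>carrier R. ax j a \<in> K) \<longrightarrow> carrier G' \<subseteq> K"
    by (elim exE conjE) (rule that; assumption)
  have "\<forall>K. subgroup K G' \<and> carrier G \<subseteq> K \<and> (\<forall>e\<in>E'. e \<one>\<^bsub>R\<^esub> \<in> K \<longrightarrow> (\<forall>a\<in>carrier R. e a \<in> K)) \<longrightarrow>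
       carrier G' \<subseteq> K"
  proof (intro allI impI, elim conjE)
    fix K assume K: "subgroup K G'" "carrier G \<subseteq> K" "\<forall>e\<in>E'. e \<one>\<^bsub>R\<^esub> \<in> K \<longrightarrow> (\<forall>a\<in>carrier R. e a \<in> K)"
    have "ax j a \<in> K" if j: "j \<in> J" and a: "a \<in> carrier R" for j a
    proof -
      have jc: "j \<in> carrier G" using J Mc j by blast
      have "j \<in> C j" using G.int_pow_1[OF jc] unfolding C_def by (metis rangeI)
      moreover have "\<kappa> j j = \<one>\<^bsub>R\<^esub>" using \<kappa>[OF j, of 1] jc by simp
      ultimately have "ax j \<one>\<^bsub>R\<^esub> = j" using ax j by metis
      then show ?thesis using K ax j jc a by auto
    qed
    then show "carrier G' \<subseteq> K" using gen K by blast
  qed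
  with 1 show ?thesis by (intro exI[of _ G'] exI[of _ E'] exI[of _ f'] conjI)
qed

text \<open>This is the free product of copies of \<open>R\<close> indexed by \<open>S\<close>,
  obtained as the amalgam over the trivial group with trivial \<open>C j\<close>. The element
  \<open>\<gamma> x\<close> is the point \<open>\<one>\<close> of the copy labelled
  \<open>Base (Some x)\<close>.\<close>

lemma stage_base:
  fixes R :: "('a, 'r) ring_scheme" and S :: "'x set"
  assumes B: "A_group R B actB" and tf: "additive_torsion_free R" and s: "s \<in> S \<rightarrow> carrier B"
  shows "\<exists>(G :: ('x, 'a) univ monoid) E f \<gamma>. stage R B actB G E f \<and> carrier G \<subseteq> below (Suc 0) \<and>
    (\<forall>x\<in>S. \<gamma> x \<in> carrier G \<and> f (\<gamma> x) = s x) \<and>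
    (\<forall>K. subgroup K G \<and> \<gamma> ` S \<subseteq> K \<and> (\<forall>e\<in>E. e \<one>\<^bsub>R\<^esub> \<in> K \<longrightarrow> (\<forall>a\<in>carrier R. e a \<in> K)) \<longrightarrow>
       carrier G \<subseteq> K)"
proof -
  interpret B: A_group R B actB by (rule B)
  let ?o = "Base None :: ('x, 'a) univ"
  define T where "T = \<lparr>carrier = {?o}, mult = (\<lambda>_ _. ?o), one = ?o\<rparr>"
  have T [simp]: "carrier T = {?o}" "x \<otimes>\<^bsub>T\<^esub> y = ?o" "\<one>\<^bsub>T\<^esub> = ?o" for x y by (simp_all add: T_def)
  have gT: "group T" by (rule groupI) auto
  define J where "J = (\<lambda>x. Base (Some x) :: ('x, 'a) univ) ` S"
  define b where "b j = (case j of Base (Some x) \<Rightarrow> s x | _ \<Rightarrow> \<one>\<^bsub>B\<^esub>)" for j :: "('x, 'a) univ"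
  have af: "axis_family R T {}"
    by (intro axis_family.intro axis_family_axioms.intro gT B.R.ring_axioms) auto
  have "star_amalgam_map R T {} J (\<lambda>_. {?o}) (\<lambda>_ _. \<zero>\<^bsub>R\<^esub>) B actB (\<lambda>_. \<one>\<^bsub>B\<^esub>) b"
  proof (intro star_amalgam_map.intro star_amalgam.intro star_amalgam_axioms.intro
      star_amalgam_map_axioms.intro af B)
    show "subgroup {?o} T" using group.triv_subgroup[OF gT] by simp
    fix a assume a: "a \<in> carrier R" "a \<oplus>\<^bsub>R\<^esub> a = \<zero>\<^bsub>R\<^esub>"
    have "add_pow R (2::nat) a = a \<oplus>\<^bsub>R\<^esub> a" using a by (simp add: numeral_2_eq_2)
    then show "a = \<zero>\<^bsub>R\<^esub>" using a tf unfolding additive_torsion_free_def by (metis zero_less_numeral)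
  next
    fix j assume "j \<in> J"
    then obtain x where x: "x \<in> S" "j = Base (Some x)" by (auto simp: J_def)
    then show bj: "b j \<in> carrier B" using s by (auto simp: b_def)
    then show "\<one>\<^bsub>B\<^esub> = actB (b j) \<zero>\<^bsub>R\<^esub>" by (simp add: B.act_zero)
  qed (auto simp: hom_def)
  moreover have "carrier T \<subseteq> below 0" by (simp add: below_def)
  ultimately obtain G' E' f' ax where
    1: "stage R B actB G' E' f'" and ext: "extends T {} (\<lambda>_. \<one>\<^bsub>B\<^esub>) G' E' f'" and lev: "carrier G' \<subseteq> below (Suc 0)"
    and ax: "\<forall>j\<in>J. ax j \<in> E' \<and> (\<forall>c\<in>{?o}. ax j \<zero>\<^bsub>R\<^esub> = c) \<and> (\<forall>a\<in>carrier R. f' (ax j a) = actB (b j) a)"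
    and gen: "\<forall>K. subgroup K G' \<and> carrier T \<subseteq> K \<and> (\<forall>j\<in>J. \<forall>a\<in>carrier R. ax j a \<in> K) \<longrightarrow> carrier G' \<subseteq> K"
    using univ_extension[of R T "{}" J "\<lambda>_. {?o}" "\<lambda>_ _. \<zero>\<^bsub>R\<^esub>" B actB "\<lambda>_. \<one>\<^bsub>B\<^esub>" b 0]
    by (elim impE meta_impE exE conjE) (assumption | rule that)+
  interpret F: axis_family R G' E' using 1 by (simp add: stage_def)
  define \<gamma> where "\<gamma> x = ax (Base (Some x)) \<one>\<^bsub>R\<^esub>" for x
  have J: "Base (Some x) \<in> J" "b (Base (Some x)) = s x" if "x \<in> S" for x
    using that by (simp_all add: J_def b_def)
  have "\<gamma> x \<in> carrier G' \<and> f' (\<gamma> x) = s x" if "x \<in> S" for x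
    using ax J[OF that] s that B.act_one[of "s x"] F.axis_closed[of "ax (Base (Some x))" "\<one>\<^bsub>R\<^esub>"]
    by (auto simp: \<gamma>_def)
  moreover have "carrier G' \<subseteq> K"
    if K: "subgroup K G'" "\<gamma> ` S \<subseteq> K" "\<forall>e\<in>E'. e \<one>\<^bsub>R\<^esub> \<in> K \<longrightarrow> (\<forall>a\<in>carrier R. e a \<in> K)" for K
  proof -
    have "carrier T \<subseteq> K" using subgroup.one_closed[OF K(1)] ext by (simp add: extends_def)
    moreover have "ax j a \<in> K" if "j \<in> J" "a \<in> carrier R" for j a
    proof -
      obtain x where x: "x \<in> S" "j = Base (Some x)" using \<open>j \<in> J\<close> by (auto simp: J_def)
      then have "ax j \<one>\<^bsub>R\<^esub> \<in> K" using K(2) by (auto simp: \<gamma>_def)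
      then show ?thesis using K(3) ax that by blast
    qed
    ultimately show ?thesis using gen K(1) by blast
  qed
  ultimately show ?thesis using 1 lev
    by (intro exI[of _ G'] exI[of _ E'] exI[of _ f'] exI[of _ \<gamma>]) simp
qed

lemma extends_refl: "extends G E f G E f"
  by (simp add: extends_def)

lemma extends_trans:
  assumes "extends G E f G' E' f'" "extends G' E' f' G'' E'' f''"
  shows "extends G E f G'' E'' f''"
proof -
  have sub: "x \<in> carrier G'" if "x \<in> carrier G" for x using assms(1) that by (auto simp: extends_def)
  show ?thesis
    unfolding extends_def
  proof (intro conjI ballI)
    show "f'' x = f x" if "x \<in> carrier G" for x
      using assms that sub[OF that] by (simp add: extends_def)
    show "x \<otimes>\<^bsub>G''\<^esub> y = x \<otimes>\<^bsub>G\<^esub> y" if "x \<in> carrier G" "y \<in> carrier G" for x y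
      using assms that sub[OF that(1)] sub[OF that(2)] by (simp add: extends_def)
  qed (use assms in \<open>auto simp: extends_def\<close>)
qed

section \<open>The union of the stages\<close>

locale stage_chain =
  fixes R :: "('a, 'r) ring_scheme" and B :: "('b, 'n) monoid_scheme" and actB
    and Gs :: "nat \<Rightarrow> 'g monoid" and Es :: "nat \<Rightarrow> ('a \<Rightarrow> 'g) set" and fs :: "nat \<Rightarrow> 'g \<Rightarrow> 'b"
  assumes stages: "stage R B actB (Gs n) (Es n) (fs n)"
    and steps: "extends (Gs n) (Es n) (fs n) (Gs (Suc n)) (Es (Suc n)) (fs (Suc n))"
    and axial_Suc: "x \<in> carrier (Gs n) \<Longrightarrow> x \<noteq> \<one>\<^bsub>Gs n\<^esub> \<Longrightarrow> axial R (Gs (Suc n)) (Es (Suc n)) x"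
begin

text \<open>The least common stage only fixes a choice; by the literal inclusions every stage that
  contains both factors gives the same product.\<close>

definition lim :: "'g monoid" where
  "lim = \<lparr>carrier = (\<Union>n. carrier (Gs n)),
     mult = (\<lambda>x y. x \<otimes>\<^bsub>Gs (LEAST n. x \<in> carrier (Gs n) \<and> y \<in> carrier (Gs n))\<^esub> y), one = \<one>\<^bsub>Gs 0\<^esub>\<rparr>"

definition flim :: "'g \<Rightarrow> 'b" where
  "flim x = fs (LEAST n. x \<in> carrier (Gs n)) x"

lemma chain: "m \<le> n \<Longrightarrow> extends (Gs m) (Es m) (fs m) (Gs n) (Es n) (fs n)"
  by (induction n rule: dec_induct) (auto intro: extends_refl extends_trans steps)

lemma axis_family_Gs: "axis_family R (Gs n) (Es n)"
  using stages by (simp add: stage_def)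

lemma group_Gs: "group (Gs n)"
  using axis_family_Gs by (simp add: axis_family_def)

lemma carrier_mono: "m \<le> n \<Longrightarrow> x \<in> carrier (Gs m) \<Longrightarrow> x \<in> carrier (Gs n)"
  using chain unfolding extends_def by blast

lemma carrier_lim: "x \<in> carrier lim \<longleftrightarrow> (\<exists>n. x \<in> carrier (Gs n))"
  by (simp add: lim_def)

lemma common_stage:
  assumes "finite X" "X \<subseteq> carrier lim"
  shows "\<exists>n. X \<subseteq> carrier (Gs n)"
  using assms
proof (induction X rule: finite_induct)
  case (insert x X)
  then obtain n m where nm: "X \<subseteq> carrier (Gs n)" "x \<in> carrier (Gs m)" by (auto simp: carrier_lim)
  have "y \<in> carrier (Gs (max n m))" if "y \<in> insert x X" for y
    using that nm carrier_mono[of n "max n m" y] carrier_mono[of m "max n m" y] by auto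
  then show ?case by blast
qed simp

lemma one_lim: "\<one>\<^bsub>lim\<^esub> = \<one>\<^bsub>Gs n\<^esub>"
  using chain[of 0 n] by (simp add: lim_def extends_def)

lemma mult_lim:
  assumes "x \<in> carrier (Gs n)" "y \<in> carrier (Gs n)"
  shows "x \<otimes>\<^bsub>lim\<^esub> y = x \<otimes>\<^bsub>Gs n\<^esub> y"
proof -
  let ?P = "\<lambda>n. x \<in> carrier (Gs n) \<and> y \<in> carrier (Gs n)"
  have "?P (Least ?P)" "Least ?P \<le> n" using LeastI[of ?P n] Least_le[of ?P n] assms by auto
  then show ?thesis using chain[of "Least ?P" n] unfolding lim_def extends_def by auto
qed

lemma flim_eq: assumes "x \<in> carrier (Gs n)" shows "flim x = fs n x"
proof -
  let ?P = "\<lambda>n. x \<in> carrier (Gs n)"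
  have "?P (Least ?P)" "Least ?P \<le> n" using LeastI[of ?P n] Least_le[of ?P n] assms by auto
  then show ?thesis using chain[of "Least ?P" n] unfolding flim_def extends_def by auto
qed

lemma group_lim: "group lim"
proof (rule groupI)
  fix x y assume "x \<in> carrier lim" "y \<in> carrier lim"
  then obtain n where n: "x \<in> carrier (Gs n)" "y \<in> carrier (Gs n)" using common_stage[of "{x, y}"] by auto
  then show "x \<otimes>\<^bsub>lim\<^esub> y \<in> carrier lim"
    using mult_lim[OF n] group.is_monoid[OF group_Gs[of n]] monoid.m_closed carrier_lim by fastforce
  fix z assume "z \<in> carrier lim"
  then obtain m where m: "x \<in> carrier (Gs m)" "y \<in> carrier (Gs m)" "z \<in> carrier (Gs m)"
    using common_stage[of "{x, y, z}"] \<open>x \<in> carrier lim\<close> \<open>y \<in> carrier lim\<close> by auto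
  interpret G: group "Gs m" by (rule group_Gs)
  show "x \<otimes>\<^bsub>lim\<^esub> y \<otimes>\<^bsub>lim\<^esub> z = x \<otimes>\<^bsub>lim\<^esub> (y \<otimes>\<^bsub>lim\<^esub> z)"
    using m by (simp add: mult_lim[of _ m] G.m_assoc)
next
  show "\<one>\<^bsub>lim\<^esub> \<in> carrier lim"
    using group.is_monoid[OF group_Gs[of 0]] monoid.one_closed one_lim[of 0] carrier_lim by fastforce
  fix x assume "x \<in> carrier lim"
  then obtain n where n: "x \<in> carrier (Gs n)" by (auto simp: carrier_lim)
  interpret G: group "Gs n" by (rule group_Gs)
  show "\<one>\<^bsub>lim\<^esub> \<otimes>\<^bsub>lim\<^esub> x = x" using n by (simp add: one_lim[of n] mult_lim[of _ n])
  show "\<exists>y\<in>carrier lim. y \<otimes>\<^bsub>lim\<^esub> x = \<one>\<^bsub>lim\<^esub>"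
    using n by (intro bexI[of _ "inv\<^bsub>Gs n\<^esub> x"]) (auto simp: one_lim[of n] mult_lim[of _ n] carrier_lim)
qed

lemma inv_lim: assumes "x \<in> carrier (Gs n)" shows "inv\<^bsub>lim\<^esub> x = inv\<^bsub>Gs n\<^esub> x"
proof -
  interpret G: group "Gs n" by (rule group_Gs)
  show ?thesis using assms
    by (intro group.inv_equality[OF group_lim]) (auto simp: mult_lim[of _ n] one_lim[of n] carrier_lim)
qed

lemma conj_lim:
  assumes "x \<in> carrier (Gs n)" "g \<in> carrier (Gs n)"
  shows "g \<otimes>\<^bsub>lim\<^esub> x \<otimes>\<^bsub>lim\<^esub> inv\<^bsub>lim\<^esub> g = g \<otimes>\<^bsub>Gs n\<^esub> x \<otimes>\<^bsub>Gs n\<^esub> inv\<^bsub>Gs n\<^esub> g"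
proof -
  interpret G: group "Gs n" by (rule group_Gs)
  show ?thesis using assms by (simp add: inv_lim mult_lim[of _ n])
qed

lemma Es_mono: "m \<le> n \<Longrightarrow> e \<in> Es m \<Longrightarrow> e \<in> Es n"
  using chain unfolding extends_def by blast

lemma Es_closed: "e \<in> Es n \<Longrightarrow> a \<in> carrier R \<Longrightarrow> e a \<in> carrier (Gs n)"
  using axis_family.axis_closed[OF axis_family_Gs] .

lemma axis_family_lim: "axis_family R lim (\<Union>n. Es n)"
proof (intro axis_family.intro axis_family_axioms.intro group_lim)
  show "ring R" using axis_family_Gs[of 0] by (simp add: axis_family_def)
  fix e a assume "e \<in> (\<Union>n. Es n)" and a: "a \<in> carrier R"
  then obtain n where n: "e \<in> Es n" by blast
  show "e a \<in> carrier lim" using Es_closed[OF n a] carrier_lim by blast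
  show "a = \<zero>\<^bsub>R\<^esub>" if "e a = \<one>\<^bsub>lim\<^esub>"
    using axis_family.axis_inj[OF axis_family_Gs n a] that one_lim[of n] by simp
  fix b assume b: "b \<in> carrier R"
  show "e (a \<oplus>\<^bsub>R\<^esub> b) = e a \<otimes>\<^bsub>lim\<^esub> e b"
    using axis_family.axis_add[OF axis_family_Gs n a b] mult_lim[OF Es_closed[OF n a] Es_closed[OF n b]] by simp
next
  fix e e' g a b
  assume "e \<in> (\<Union>n. Es n)" "e' \<in> (\<Union>n. Es n)" "g \<in> carrier lim" and a: "a \<in> carrier R" "b \<in> carrier R"
    and eq: "g \<otimes>\<^bsub>lim\<^esub> e a \<otimes>\<^bsub>lim\<^esub> inv\<^bsub>lim\<^esub> g = e' b" "e' b \<noteq> \<one>\<^bsub>lim\<^esub>"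
  then obtain k l m where "e \<in> Es k" "e' \<in> Es l" "g \<in> carrier (Gs m)" by (auto simp: carrier_lim)
  then obtain n where n: "e \<in> Es n" "e' \<in> Es n" "g \<in> carrier (Gs n)"
    using Es_mono carrier_mono by (metis max.cobounded1 max.cobounded2 max.coboundedI1)
  show "e = e' \<and> (\<exists>c\<in>carrier R. g = e c)"
    by (rule axis_family.axis_malnormal[OF axis_family_Gs n a])
      (use conj_lim[OF Es_closed[OF n(1) a(1)] n(3)] eq one_lim[of n] in simp_all)
qed

lemma axial_lim:
  assumes "x \<in> carrier lim" "x \<noteq> \<one>\<^bsub>lim\<^esub>" shows "axial R lim (\<Union>n. Es n) x"
proof -
  obtain n where n: "x \<in> carrier (Gs n)" using assms by (auto simp: carrier_lim)
  then have "axial R (Gs (Suc n)) (Es (Suc n)) x" using axial_Suc assms one_lim[of n] by simp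
  then obtain p e a where p: "p \<in> carrier (Gs (Suc n))" "e \<in> Es (Suc n)" "a \<in> carrier R"
    "x = p \<otimes>\<^bsub>Gs (Suc n)\<^esub> e a \<otimes>\<^bsub>Gs (Suc n)\<^esub> inv\<^bsub>Gs (Suc n)\<^esub> p" by (auto simp: axial_def)
  then have "x = p \<otimes>\<^bsub>lim\<^esub> e a \<otimes>\<^bsub>lim\<^esub> inv\<^bsub>lim\<^esub> p" using conj_lim[OF Es_closed[OF p(2,3)] p(1)] by simp
  then show ?thesis using p carrier_lim unfolding axial_def by blast
qed

lemma flim_hom: "flim \<in> hom lim B"
proof (rule homI)
  fix x assume "x \<in> carrier lim"
  then obtain n where "x \<in> carrier (Gs n)" by (auto simp: carrier_lim)
  then show "flim x \<in> carrier B" using stages[of n] flim_eq[of x n] by (auto simp: stage_def hom_def)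
next
  fix x y assume "x \<in> carrier lim" "y \<in> carrier lim"
  then obtain n where n: "x \<in> carrier (Gs n)" "y \<in> carrier (Gs n)" using common_stage[of "{x, y}"] by auto
  interpret G: group "Gs n" by (rule group_Gs)
  show "flim (x \<otimes>\<^bsub>lim\<^esub> y) = flim x \<otimes>\<^bsub>B\<^esub> flim y"
    using stages[of n] n by (simp add: mult_lim[of _ n] flim_eq[of _ n] stage_def hom_mult)
qed

lemma flim_axis:
  assumes "ring R" "e \<in> (\<Union>n. Es n)" "a \<in> carrier R"
  shows "flim (e a) = actB (flim (e \<one>\<^bsub>R\<^esub>)) a"
proof -
  obtain n where n: "e \<in> Es n" using assms by blast
  have "fs n (e a) = actB (fs n (e \<one>\<^bsub>R\<^esub>)) a" using stages[of n] n assms(3) unfolding stage_def by blast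
  then show ?thesis
    using flim_eq[OF Es_closed[OF n]] assms(3) ring.ring_simprules(6)[OF assms(1)] by simp
qed

text \<open>A subgroup of the union is tested by its traces on the stages, each of which inherits
  the closure under axes.\<close>

lemma lim_generated:
  assumes gen0: "\<And>K. subgroup K (Gs 0) \<Longrightarrow> X \<subseteq> K \<Longrightarrow>
      \<forall>e\<in>Es 0. e \<one>\<^bsub>R\<^esub> \<in> K \<longrightarrow> (\<forall>a\<in>carrier R. e a \<in> K) \<Longrightarrow> carrier (Gs 0) \<subseteq> K"
    and genS: "\<And>n K. subgroup K (Gs (Suc n)) \<Longrightarrow> carrier (Gs n) \<subseteq> K \<Longrightarrow>
      \<forall>e\<in>Es (Suc n). e \<one>\<^bsub>R\<^esub> \<in> K \<longrightarrow> (\<forall>a\<in>carrier R. e a \<in> K) \<Longrightarrow> carrier (Gs (Suc n)) \<subseteq> K"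
    and X: "X \<subseteq> carrier (Gs 0)"
    and K: "subgroup K lim" "X \<subseteq> K" "\<And>n e a. e \<in> Es n \<Longrightarrow> e \<one>\<^bsub>R\<^esub> \<in> K \<Longrightarrow> a \<in> carrier R \<Longrightarrow> e a \<in> K"
  shows "carrier lim \<subseteq> K"
proof -
  have sub: "subgroup (K \<inter> carrier (Gs n)) (Gs n)" for n
  proof -
    interpret G: group "Gs n" by (rule group_Gs)
    show ?thesis
    proof (rule G.subgroupI)
      show "K \<inter> carrier (Gs n) \<noteq> {}" using subgroup.one_closed[OF K(1)] one_lim[of n] by auto
      fix a assume a: "a \<in> K \<inter> carrier (Gs n)"
      then show "inv\<^bsub>Gs n\<^esub> a \<in> K \<inter> carrier (Gs n)" using subgroup.m_inv_closed[OF K(1), of a] inv_lim[of a n] by auto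
      fix b assume "b \<in> K \<inter> carrier (Gs n)"
      then show "a \<otimes>\<^bsub>Gs n\<^esub> b \<in> K \<inter> carrier (Gs n)"
        using a subgroup.m_closed[OF K(1), of a b] mult_lim[of a n b] by auto
    qed auto
  qed
  have cl: "\<forall>e\<in>Es n. e \<one>\<^bsub>R\<^esub> \<in> K \<inter> carrier (Gs n) \<longrightarrow> (\<forall>a\<in>carrier R. e a \<in> K \<inter> carrier (Gs n))" for n
    using K(3) Es_closed by blast
  have "carrier (Gs n) \<subseteq> K" for n
  proof (induction n)
    case 0 then show ?case using gen0[OF sub _ cl] X K(2) by blast
  next
    case (Suc n)
    then have "carrier (Gs n) \<subseteq> K \<inter> carrier (Gs (Suc n))" using carrier_mono[of n "Suc n"] by auto
    then show ?case using genS[OF sub _ cl] by blast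
  qed
  then show ?thesis unfolding carrier_lim subset_iff by blast
qed

end

lemma full_axis_family_exists:
  fixes R :: "('a, 'r) ring_scheme" and B :: "('b, 'n) monoid_scheme" and S :: "'x set"
  assumes B: "A_group R B actB" and char: "ring_char_zero R" and tf: "additive_torsion_free R"
    and s: "s \<in> S \<rightarrow> carrier B"
  shows "\<exists>(H :: ('x, 'a) univ monoid) E f \<gamma>. axis_family R H E \<and>
    (\<forall>x\<in>carrier H. x \<noteq> \<one>\<^bsub>H\<^esub> \<longrightarrow> axial R H E x) \<and> f \<in> hom H B \<and>
    (\<forall>e\<in>E. \<forall>a\<in>carrier R. f (e a) = actB (f (e \<one>\<^bsub>R\<^esub>)) a) \<and>
    (\<forall>x\<in>S. \<gamma> x \<in> carrier H \<and> f (\<gamma> x) = s x) \<and>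
    (\<forall>K. subgroup K H \<and> \<gamma> ` S \<subseteq> K \<and> (\<forall>e\<in>E. e \<one>\<^bsub>R\<^esub> \<in> K \<longrightarrow> (\<forall>a\<in>carrier R. e a \<in> K)) \<longrightarrow>
       carrier H \<subseteq> K)"
proof -
  obtain G0 :: "('x, 'a) univ monoid" and E0 f0 \<gamma> where
    st0: "stage R B actB G0 E0 f0" and lev0: "carrier G0 \<subseteq> below (Suc 0)"
    and \<gamma>: "\<forall>x\<in>S. \<gamma> x \<in> carrier G0 \<and> f0 (\<gamma> x) = s x"
    and gen0: "\<forall>K. subgroup K G0 \<and> \<gamma> ` S \<subseteq> K \<and> (\<forall>e\<in>E0. e \<one>\<^bsub>R\<^esub> \<in> K \<longrightarrow> (\<forall>a\<in>carrier R. e a \<in> K)) \<longrightarrow>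
       carrier G0 \<subseteq> K"
    using stage_base[OF B tf s] by (elim exE conjE) (rule that; assumption)
  \<comment> \<open>The first stage is pinned because generation by the images of \<open>S\<close>
    is known for it alone; the level bound provides the fresh tag for the next stage.\<close>
  define P where "P n t \<longleftrightarrow> (case t of (G, E, f) \<Rightarrow> stage R B actB G E f \<and> carrier G \<subseteq> below (Suc n) \<and>
      (n = 0 \<longrightarrow> t = (G0, E0, f0)))" for n :: nat and t :: "('x, 'a) univ monoid \<times> ('a \<Rightarrow> ('x, 'a) univ) set \<times> (('x, 'a) univ \<Rightarrow> 'b)"
  define Q where "Q t t' \<longleftrightarrow> (case t of (G, E, f) \<Rightarrow> case t' of (G', E', f') \<Rightarrow> extends G E f G' E' f' \<and>
      (\<forall>x\<in>carrier G. x \<noteq> \<one>\<^bsub>G\<^esub> \<longrightarrow> axial R G' E' x) \<and>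
      (\<forall>K. subgroup K G' \<and> carrier G \<subseteq> K \<and> (\<forall>e\<in>E'. e \<one>\<^bsub>R\<^esub> \<in> K \<longrightarrow> (\<forall>a\<in>carrier R. e a \<in> K)) \<longrightarrow>
         carrier G' \<subseteq> K))" for t t' :: "('x, 'a) univ monoid \<times> ('a \<Rightarrow> ('x, 'a) univ) set \<times> (('x, 'a) univ \<Rightarrow> 'b)"
  have "\<exists>t. \<forall>n. P n (t n) \<and> Q (t n) (t (Suc n))"
  proof (rule dependent_nat_choice)
    show "\<exists>t. P 0 t" using st0 lev0 by (intro exI[of _ "(G0, E0, f0)"]) (simp add: P_def)
    fix t :: "('x, 'a) univ monoid \<times> ('a \<Rightarrow> ('x, 'a) univ) set \<times> (('x, 'a) univ \<Rightarrow> 'b)" and n assume "P n t"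
    then obtain G E f where t: "t = (G, E, f)" "stage R B actB G E f" "carrier G \<subseteq> below (Suc n)"
      by (cases t) (auto simp: P_def)
    obtain G' E' f' where "stage R B actB G' E' f'" "extends G E f G' E' f'" "carrier G' \<subseteq> below (Suc (Suc n))"
      "\<forall>x\<in>carrier G. x \<noteq> \<one>\<^bsub>G\<^esub> \<longrightarrow> axial R G' E' x"
      "\<forall>K. subgroup K G' \<and> carrier G \<subseteq> K \<and> (\<forall>e\<in>E'. e \<one>\<^bsub>R\<^esub> \<in> K \<longrightarrow> (\<forall>a\<in>carrier R. e a \<in> K)) \<longrightarrow> carrier G' \<subseteq> K"
      using stage_step[OF t(2) B char tf t(3)] by (elim exE conjE) (rule that; assumption)
    then show "\<exists>t'. P (Suc n) t' \<and> Q t t'"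
      by (intro exI[of _ "(G', E', f')"]) (simp add: P_def Q_def t)
  qed
  then obtain t where t: "\<And>n. P n (t n)" "\<And>n. Q (t n) (t (Suc n))" by blast
  define Gs Es fs where "Gs n = fst (t n)" and "Es n = fst (snd (t n))" and "fs n = snd (snd (t n))" for n
  have tn: "t n = (Gs n, Es n, fs n)" for n by (simp add: Gs_def Es_def fs_def)
  interpret stage_chain R B actB Gs Es fs
    using t unfolding tn P_def Q_def by unfold_locales auto
  have t0: "Gs 0 = G0" "Es 0 = E0" "fs 0 = f0" using t(1)[of 0] unfolding tn P_def by auto
  have genS: "carrier (Gs (Suc n)) \<subseteq> K"
    if "subgroup K (Gs (Suc n))" "carrier (Gs n) \<subseteq> K"
      "\<forall>e\<in>Es (Suc n). e \<one>\<^bsub>R\<^esub> \<in> K \<longrightarrow> (\<forall>a\<in>carrier R. e a \<in> K)" for n K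
    using t(2)[of n] that unfolding tn Q_def by simp
  have "ring R" using B by (simp add: A_group_def)
  have gens: "\<forall>x\<in>S. \<gamma> x \<in> carrier lim \<and> flim (\<gamma> x) = s x"
    using \<gamma> flim_eq[of _ 0] t0 carrier_lim by metis
  have gen: "carrier lim \<subseteq> K"
    if "subgroup K lim" "\<gamma> ` S \<subseteq> K" "\<forall>e\<in>(\<Union>n. Es n). e \<one>\<^bsub>R\<^esub> \<in> K \<longrightarrow> (\<forall>a\<in>carrier R. e a \<in> K)" for K
  proof (rule lim_generated[where X = "\<gamma> ` S", OF _ genS])
    show "carrier (Gs 0) \<subseteq> K" if "subgroup K (Gs 0)" "\<gamma> ` S \<subseteq> K"
      "\<forall>e\<in>Es 0. e \<one>\<^bsub>R\<^esub> \<in> K \<longrightarrow> (\<forall>a\<in>carrier R. e a \<in> K)" for K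
      using gen0 that unfolding t0 by blast
  qed (use that \<gamma> t0 in auto)
  show ?thesis
  proof (intro exI[of _ lim] exI[of _ "\<Union>n. Es n"] exI[of _ flim] exI[of _ \<gamma>] conjI)
    show "\<forall>x\<in>carrier lim. x \<noteq> \<one>\<^bsub>lim\<^esub> \<longrightarrow> axial R lim (\<Union>n. Es n) x" using axial_lim by blast
    show "\<forall>e\<in>\<Union>n. Es n. \<forall>a\<in>carrier R. flim (e a) = actB (flim (e \<one>\<^bsub>R\<^esub>)) a"
      by (intro ballI flim_axis[OF \<open>ring R\<close>])
    show "\<forall>K. subgroup K lim \<and> \<gamma> ` S \<subseteq> K \<and>
        (\<forall>e\<in>\<Union>n. Es n. e \<one>\<^bsub>R\<^esub> \<in> K \<longrightarrow> (\<forall>a\<in>carrier R. e a \<in> K)) \<longrightarrow> carrier lim \<subseteq> K"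
      by (intro allI impI, elim conjE) (rule gen)
  qed (rule axis_family_lim flim_hom gens)+
qed

section \<open>The free \<open>A\<close>-group\<close>

locale full_axis_family = axis_family R G E
  for R :: "('a, 'r) ring_scheme" and G :: "('g, 'm) monoid_scheme" (structure) and E +
  assumes axial_all: "x \<in> carrier G \<Longrightarrow> x \<noteq> \<one> \<Longrightarrow> axial R G E x"
begin

text \<open>The unit lies on every conjugate of every axis, and on none if \<open>E\<close> is
  empty, hence the separate clause. For other elements \<open>SOME\<close> ranges over a single
  value, by malnormality.\<close>

definition act :: "'g \<Rightarrow> 'a \<Rightarrow> 'g" where
  "act x \<alpha> = (if x = \<one> then \<one> else
     SOME y. \<exists>p\<in>carrier G. \<exists>e\<in>E. \<exists>a\<in>carrier R.
       x = p \<otimes> e a \<otimes> inv p \<and> y = p \<otimes> e (a \<otimes>\<^bsub>R\<^esub> \<alpha>) \<otimes> inv p)"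

lemma conj_one_iff: "p \<in> carrier G \<Longrightarrow> x \<in> carrier G \<Longrightarrow> p \<otimes> x \<otimes> inv p = \<one> \<longleftrightarrow> x = \<one>"
  using G.conj_eq_iff(1)[of p x \<one>] by simp

lemma axis_uminus: assumes "e \<in> E" "a \<in> carrier R" shows "e (\<ominus>\<^bsub>R\<^esub> a) = inv (e a)"
  using assms axis_add[of e "\<ominus>\<^bsub>R\<^esub> a" a] by (intro G.inv_equality[symmetric]) (simp_all add: R.l_neg)

lemma axis_eq_iff:
  assumes "e \<in> E" "a \<in> carrier R" "b \<in> carrier R" shows "e a = e b \<longleftrightarrow> a = b"
proof
  assume "e a = e b"
  then have "e (a \<oplus>\<^bsub>R\<^esub> (\<ominus>\<^bsub>R\<^esub> b)) = \<one>" using assms by (simp add: axis_add axis_uminus)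
  then have "a \<oplus>\<^bsub>R\<^esub> (\<ominus>\<^bsub>R\<^esub> b) = \<zero>\<^bsub>R\<^esub>" using axis_inj assms by simp
  then show "a = b" using assms by (metis R.add.inv_closed R.add.inv_inv R.minus_equality)
qed simp

lemma axis_commute: "e \<in> E \<Longrightarrow> a \<in> carrier R \<Longrightarrow> b \<in> carrier R \<Longrightarrow> e a \<otimes> e b = e b \<otimes> e a"
  using axis_add[of e a b] axis_add[of e b a] by (simp add: R.a_comm)

text \<open>Two ways of writing a nontrivial \<open>x\<close> differ by a conjugator
  \<open>g\<close> that malnormality places on the axis. The axis is abelian, so \<open>g\<close>
  moves none of its points, and both coefficient and result agree.\<close>

lemma act_axis:
  assumes p: "p \<in> carrier G" and e: "e \<in> E" and a: "a \<in> carrier R" and \<alpha>: "\<alpha> \<in> carrier R"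
  shows "act (p \<otimes> e a \<otimes> inv p) \<alpha> = p \<otimes> e (a \<otimes>\<^bsub>R\<^esub> \<alpha>) \<otimes> inv p"
proof (cases "e a = \<one>")
  case True
  then have "a = \<zero>\<^bsub>R\<^esub>" using axis_inj e a by blast
  then show ?thesis using p e \<alpha> by (simp add: act_def)
next
  case False
  let ?x = "p \<otimes> e a \<otimes> inv p"
  have x1: "?x \<noteq> \<one>" using False p e a by (simp add: conj_one_iff)
  let ?P = "\<lambda>y. \<exists>p\<in>carrier G. \<exists>e\<in>E. \<exists>a\<in>carrier R. ?x = p \<otimes> e a \<otimes> inv p \<and> y = p \<otimes> e (a \<otimes>\<^bsub>R\<^esub> \<alpha>) \<otimes> inv p"
  have "act ?x \<alpha> = (SOME y. ?P y)" using x1 by (simp add: act_def)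
  also have "\<dots> = p \<otimes> e (a \<otimes>\<^bsub>R\<^esub> \<alpha>) \<otimes> inv p"
  proof (rule some_equality)
    show "?P (p \<otimes> e (a \<otimes>\<^bsub>R\<^esub> \<alpha>) \<otimes> inv p)" using p e a by blast
    fix y assume "?P y"
    then obtain q d b where q: "q \<in> carrier G" "d \<in> E" "b \<in> carrier R"
      and eq: "?x = q \<otimes> d b \<otimes> inv q" and y: "y = q \<otimes> d (b \<otimes>\<^bsub>R\<^esub> \<alpha>) \<otimes> inv q" by blast
    define g where "g = inv q \<otimes> p"
    have g: "g \<in> carrier G" "p = q \<otimes> g" using p q by (simp_all add: g_def G.m_assoc[symmetric])
    have "g \<otimes> e a \<otimes> inv g = inv q \<otimes> ?x \<otimes> inv (inv q)"
      using G.conj_conj[of p "inv q" "e a"] p q e a by (simp add: g_def)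
    also have "\<dots> = d b" unfolding eq using q by (intro G.conj_cancel) simp_all
    finally have gd: "g \<otimes> e a \<otimes> inv g = d b" .
    have "d b \<noteq> \<one>" using x1 q unfolding eq by (simp add: conj_one_iff)
    then obtain c where ed: "e = d" and c: "c \<in> carrier R" "g = d c"
      using axis_malnormal[OF e q(2) g(1) a q(3) gd] by blast
    have conj: "g \<otimes> d z \<otimes> inv g = d z" if "z \<in> carrier R" for z
      unfolding c(2)
      by (subst G.conj_eq_iff(1)) (use that c(1) q(2) axis_commute[of d c z] in simp_all)
    have "d a = d b" using gd conj[OF a] ed by simp
    then have "a = b" using axis_eq_iff q a by blast
    then show "y = p \<otimes> e (a \<otimes>\<^bsub>R\<^esub> \<alpha>) \<otimes> inv p"
      using y g q e a \<alpha> conj[of "a \<otimes>\<^bsub>R\<^esub> \<alpha>"] G.conj_conj[of g q "d (a \<otimes>\<^bsub>R\<^esub> \<alpha>)"] by (simp add: ed)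
  qed
  finally show ?thesis .
qed

lemma axis_form:
  assumes "x \<in> carrier G" "x \<noteq> \<one>"
  obtains p e a where "p \<in> carrier G" "e \<in> E" "a \<in> carrier R" "x = p \<otimes> e a \<otimes> inv p"
  using axial_all[OF assms] by (auto simp: axial_def)

lemma act_one_left [simp]: "act \<one> \<alpha> = \<one>"
  by (simp add: act_def)

lemma act_closed:
  assumes "g \<in> carrier G" "\<alpha> \<in> carrier R" shows "act g \<alpha> \<in> carrier G"
proof (cases "g = \<one>")
  case False
  obtain p e a where "p \<in> carrier G" "e \<in> E" "a \<in> carrier R" "g = p \<otimes> e a \<otimes> inv p"
    using axis_form[OF assms(1) False] .
  then show ?thesis using assms(2) by (simp add: act_axis)
qed simp

lemma A_group_act: "A_group R G act"
proof (intro A_group.intro A_group_axioms.intro R.ring_axioms G.is_group)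
  fix g assume g: "g \<in> carrier G"
  have "act g \<one>\<^bsub>R\<^esub> = g \<and> act g \<zero>\<^bsub>R\<^esub> = \<one>"
  proof (cases "g = \<one>")
    case False
    obtain p e a where "p \<in> carrier G" "e \<in> E" "a \<in> carrier R" "g = p \<otimes> e a \<otimes> inv p"
      using axis_form[OF g False] .
    then show ?thesis by (simp add: act_axis)
  qed simp
  then show "act g \<one>\<^bsub>R\<^esub> = g" "act g \<zero>\<^bsub>R\<^esub> = \<one>" by simp_all
  fix \<alpha> assume \<alpha>: "\<alpha> \<in> carrier R"
  show "act g \<alpha> \<in> carrier G" using g \<alpha> by (rule act_closed)
  fix \<beta> assume \<beta>: "\<beta> \<in> carrier R"
  show "act g (\<alpha> \<oplus>\<^bsub>R\<^esub> \<beta>) = act g \<alpha> \<otimes> act g \<beta>"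
  proof (cases "g = \<one>")
    case False
    obtain p e a where p: "p \<in> carrier G" "e \<in> E" "a \<in> carrier R" "g = p \<otimes> e a \<otimes> inv p"
      using axis_form[OF g False] .
    have "p \<otimes> (x \<otimes> y) \<otimes> inv p = (p \<otimes> x \<otimes> inv p) \<otimes> (p \<otimes> y \<otimes> inv p)"
      if "x \<in> carrier G" "y \<in> carrier G" for x y
      using that p(1) by (simp add: G.m_assoc) (simp add: G.m_assoc[symmetric])
    then show ?thesis using p \<alpha> \<beta> by (simp add: act_axis R.r_distr axis_add)
  qed simp
  show "act g (\<alpha> \<otimes>\<^bsub>R\<^esub> \<beta>) = act (act g \<alpha>) \<beta>"
  proof (cases "g = \<one>")
    case False
    obtain p e a where "p \<in> carrier G" "e \<in> E" "a \<in> carrier R" "g = p \<otimes> e a \<otimes> inv p"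
      using axis_form[OF g False] .
    then show ?thesis using \<alpha> \<beta> by (simp add: act_axis R.m_assoc)
  qed simp
next
  show "act \<one> \<alpha> = \<one>" for \<alpha> by simp
next
  fix g h \<alpha> assume g: "g \<in> carrier G" and h: "h \<in> carrier G" and \<alpha>: "\<alpha> \<in> carrier R"
  show "act (inv h \<otimes> g \<otimes> h) \<alpha> = inv h \<otimes> act g \<alpha> \<otimes> h"
  proof (cases "g = \<one>")
    case True then show ?thesis using h by simp
  next
    case False
    obtain p e a where p: "p \<in> carrier G" "e \<in> E" "a \<in> carrier R" "g = p \<otimes> e a \<otimes> inv p"
      using axis_form[OF g False] .
    have "inv h \<otimes> (p \<otimes> x \<otimes> inv p) \<otimes> h = (inv h \<otimes> p) \<otimes> x \<otimes> inv (inv h \<otimes> p)" if "x \<in> carrier G" for x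
      using G.conj_conj[of p "inv h" x] p(1) h that by simp
    then show ?thesis using p h \<alpha> by (simp add: act_axis)
  qed
  assume c: "g \<otimes> h = h \<otimes> g"
  show "act (g \<otimes> h) \<alpha> = act g \<alpha> \<otimes> act h \<alpha>"
  proof (cases "g = \<one>")
    case True
    have "act h \<alpha> \<in> carrier G" using h \<alpha> by (rule act_closed)
    then show ?thesis using h True by simp
  next
    case False
    obtain p e a where p: "p \<in> carrier G" "e \<in> E" "a \<in> carrier R" "g = p \<otimes> e a \<otimes> inv p"
      using axis_form[OF g False] .
    \<comment> \<open>Commuting elements lie on one conjugate of an axis, where the action
      multiplies the coefficient on the right and is therefore additive in it.\<close>
    obtain d where d: "d \<in> carrier R" "h = p \<otimes> e d \<otimes> inv p"
      using axis_centralizer[OF p(1-4) False h c] .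
    have "p \<otimes> (x \<otimes> y) \<otimes> inv p = (p \<otimes> x \<otimes> inv p) \<otimes> (p \<otimes> y \<otimes> inv p)"
      if "x \<in> carrier G" "y \<in> carrier G" for x y
      using that p(1) by (simp add: G.m_assoc) (simp add: G.m_assoc[symmetric])
    note split = this[symmetric]
    have "g \<otimes> h = p \<otimes> e (a \<oplus>\<^bsub>R\<^esub> d) \<otimes> inv p"
      unfolding p(4) d(2) using p(1-3) d(1) by (simp add: split axis_add)
    then have "act (g \<otimes> h) \<alpha> = p \<otimes> e ((a \<oplus>\<^bsub>R\<^esub> d) \<otimes>\<^bsub>R\<^esub> \<alpha>) \<otimes> inv p"
      using p(1-3) d(1) \<alpha> by (simp add: act_axis)
    also have "\<dots> = act g \<alpha> \<otimes> act h \<alpha>"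
      unfolding p(4) d(2) using p(1-3) d(1) \<alpha> by (simp add: act_axis split axis_add R.l_distr)
    finally show ?thesis .
  qed
qed

end

text \<open>\<open>\<phi>\<close> comes with the construction for the target \<open>F\<close>,
  \<open>\<psi>\<close> from the universal property of \<open>F\<close>. Both composites fix the
  generators; the fixed elements are closed under the action in \<open>F\<close> and under axes in
  \<open>H\<close>.\<close>

lemma free_A_group_iso:
  fixes R :: "('a, 'r) ring_scheme" and F :: "('g, 'm) monoid_scheme"
  assumes char: "ring_char_zero R" and tf: "additive_torsion_free R" and free: "free_A_group R F act S"
  shows "\<exists>(H :: ('g, 'a) univ monoid) E actH \<psi> \<phi>. full_axis_family R H E \<and> actH = full_axis_family.act R H E \<and>
    \<psi> \<in> A_hom R F act H actH \<and> \<phi> \<in> A_hom R H actH F act \<and>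
    (\<forall>x\<in>carrier F. \<phi> (\<psi> x) = x) \<and> (\<forall>y\<in>carrier H. \<psi> (\<phi> y) = y)"
proof -
  have F: "A_group R F act" and gen: "A_generates R F act S" using free by (auto simp: free_A_group_def)
  interpret F: A_group R F act by (rule F)
  have S: "S \<subseteq> carrier F" using gen by (simp add: A_generates_def)
  have idS: "(\<lambda>x. x) \<in> S \<rightarrow> carrier F" using S by auto
  obtain H :: "('g, 'a) univ monoid" and E \<phi> \<gamma> where
    af: "axis_family R H E" and ax: "\<forall>x\<in>carrier H. x \<noteq> \<one>\<^bsub>H\<^esub> \<longrightarrow> axial R H E x" and \<phi>: "\<phi> \<in> hom H F"
    and \<phi>e: "\<forall>e\<in>E. \<forall>a\<in>carrier R. \<phi> (e a) = act (\<phi> (e \<one>\<^bsub>R\<^esub>)) a"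
    and \<gamma>: "\<forall>x\<in>S. \<gamma> x \<in> carrier H \<and> \<phi> (\<gamma> x) = x"
    and genH: "\<forall>K. subgroup K H \<and> \<gamma> ` S \<subseteq> K \<and> (\<forall>e\<in>E. e \<one>\<^bsub>R\<^esub> \<in> K \<longrightarrow> (\<forall>a\<in>carrier R. e a \<in> K)) \<longrightarrow> carrier H \<subseteq> K"
    using full_axis_family_exists[OF F char tf idS] by (elim exE conjE) (rule that; assumption)
  interpret H: full_axis_family R H E
    using af ax by (simp add: full_axis_family_def full_axis_family_axioms_def)
  interpret HA: A_group R H H.act by (rule H.A_group_act)
  interpret \<phi>: group_hom H F \<phi> using \<phi> by unfold_locales
  have \<phi>A: "\<phi> \<in> A_hom R H H.act F act"
    unfolding A_hom_def
  proof (intro CollectI conjI ballI \<phi>)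
    fix g \<alpha> assume g: "g \<in> carrier H" and \<alpha>: "\<alpha> \<in> carrier R"
    show "\<phi> (H.act g \<alpha>) = act (\<phi> g) \<alpha>"
    proof (cases "g = \<one>\<^bsub>H\<^esub>")
      case True then show ?thesis using \<alpha> F.one_act by simp
    next
      case False
      obtain p e a where p: "p \<in> carrier H" "e \<in> E" "a \<in> carrier R" "g = p \<otimes>\<^bsub>H\<^esub> e a \<otimes>\<^bsub>H\<^esub> inv\<^bsub>H\<^esub> p"
        using H.axis_form[OF g False] .
      have z: "\<phi> (e \<one>\<^bsub>R\<^esub>) \<in> carrier F" using p(2) by simp
      have e: "\<phi> (e b) = act (\<phi> (e \<one>\<^bsub>R\<^esub>)) b" if "b \<in> carrier R" for b using \<phi>e p(2) that by blast
      have "\<phi> (e (a \<otimes>\<^bsub>R\<^esub> \<alpha>)) = act (\<phi> (e a)) \<alpha>"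
        unfolding e[OF p(3)] e[OF F.R.m_closed[OF p(3) \<alpha>]] by (rule F.act_mult[OF z p(3) \<alpha>])
      moreover have "act (\<phi> p \<otimes>\<^bsub>F\<^esub> \<phi> (e a) \<otimes>\<^bsub>F\<^esub> inv\<^bsub>F\<^esub> (\<phi> p)) \<alpha> = \<phi> p \<otimes>\<^bsub>F\<^esub> act (\<phi> (e a)) \<alpha> \<otimes>\<^bsub>F\<^esub> inv\<^bsub>F\<^esub> (\<phi> p)"
        using F.act_conj[of "\<phi> (e a)" "inv\<^bsub>F\<^esub> (\<phi> p)" \<alpha>] p \<alpha> by simp
      ultimately show ?thesis using p(1-3) \<alpha> unfolding p(4) by (simp add: H.act_axis)
    qed
  qed
  obtain \<psi> where \<psi>: "\<psi> \<in> A_hom R F act H H.act" "\<forall>x\<in>S. \<psi> x = \<gamma> x"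
    using free_A_group_extends[OF free H.A_group_act, of \<gamma>] \<gamma> by auto
  have \<psi>act: "\<psi> (act x \<alpha>) = H.act (\<psi> x) \<alpha>" if "x \<in> carrier F" "\<alpha> \<in> carrier R" for x \<alpha>
    using \<psi>(1) that by (simp add: A_hom_def)
  have \<phi>act: "\<phi> (H.act x \<alpha>) = act (\<phi> x) \<alpha>" if "x \<in> carrier H" "\<alpha> \<in> carrier R" for x \<alpha>
    using \<phi>A that by (simp add: A_hom_def)
  interpret \<psi>: group_hom F H \<psi> using \<psi>(1) by unfold_locales (simp add: A_hom_def)
  let ?K = "{x \<in> carrier F. \<phi> (\<psi> x) = x}"
  have "A_subgroup R F act ?K"
    unfolding A_subgroup_def
  proof (intro conjI ballI)
    show "subgroup ?K F"
      by (rule F.G.subgroupI) (auto intro: exI[of _ "\<one>\<^bsub>F\<^esub>"])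
  qed (auto simp: F.act_closed \<psi>act \<phi>act)
  then have "?K = carrier F" using gen S \<psi>(2) \<gamma> unfolding A_generates_def by auto
  then have \<phi>\<psi>: "\<forall>x\<in>carrier F. \<phi> (\<psi> x) = x" by blast
  let ?L = "{y \<in> carrier H. \<psi> (\<phi> y) = y}"
  have "carrier H \<subseteq> ?L"
  proof (rule genH[rule_format], intro conjI ballI impI)
    show "subgroup ?L H"
      by (rule H.G.subgroupI) (auto intro: exI[of _ "\<one>\<^bsub>H\<^esub>"])
    show "\<gamma> ` S \<subseteq> ?L" using \<gamma> \<psi>(2) by auto
    fix e a assume e: "e \<in> E" "e \<one>\<^bsub>R\<^esub> \<in> ?L" and a: "a \<in> carrier R"
    \<comment> \<open>An axis consists of the powers of its point \<open>e \<one>\<close>, so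
      closure under axes follows from closure under the action.\<close>
    have "e a = H.act (e \<one>\<^bsub>R\<^esub>) a"
      using H.act_axis[of "\<one>\<^bsub>H\<^esub>" e "\<one>\<^bsub>R\<^esub>" a] e(1) a by simp
    then show "e a \<in> ?L" using e a by (simp add: \<psi>act \<phi>act HA.act_closed)
  qed
  then have "\<forall>y\<in>carrier H. \<psi> (\<phi> y) = y" by blast
  then show ?thesis using H.full_axis_family_axioms \<psi>(1) \<phi>A \<phi>\<psi>
    by (intro exI[of _ H] exI[of _ E] exI[of _ H.act] exI[of _ \<psi>] exI[of _ \<phi>] conjI refl)
qed

text \<open>\<open>z\<close> is the image of the point \<open>\<one>\<close> on the conjugate of an
  axis through \<open>\<psi> g\<close>. This conjugate contains the centralizer and is parametrized
  injectively by \<open>R\<close>; both facts transfer to \<open>F\<close>.\<close>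

lemma free_A_group_axis:
  fixes R :: "('a, 'r) ring_scheme" and F :: "('g, 'm) monoid_scheme"
  assumes char: "ring_char_zero R" and tf: "additive_torsion_free R" and free: "free_A_group R F act S"
    and g: "g \<in> carrier F" "g \<noteq> \<one>\<^bsub>F\<^esub>"
  obtains z where "z \<in> carrier F"
    "\<And>h. h \<in> carrier F \<Longrightarrow> g \<otimes>\<^bsub>F\<^esub> h = h \<otimes>\<^bsub>F\<^esub> g \<Longrightarrow> \<exists>c\<in>carrier R. h = act z c"
    "\<And>c. c \<in> carrier R \<Longrightarrow> act z c = \<one>\<^bsub>F\<^esub> \<Longrightarrow> c = \<zero>\<^bsub>R\<^esub>"
proof -
  interpret F: A_group R F act using free by (simp add: free_A_group_def)
  obtain H :: "('g, 'a) univ monoid" and E actH \<psi> \<phi> where fH: "full_axis_family R H E"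
    and actH: "actH = full_axis_family.act R H E"
    and \<psi>: "\<psi> \<in> A_hom R F act H actH" and \<phi>: "\<phi> \<in> A_hom R H actH F act"
    and \<phi>\<psi>: "\<forall>x\<in>carrier F. \<phi> (\<psi> x) = x" and \<psi>\<phi>: "\<forall>y\<in>carrier H. \<psi> (\<phi> y) = y"
    using free_A_group_iso[OF char tf free] by (elim exE conjE) (rule that; assumption)
  interpret H: full_axis_family R H E by (rule fH)
  interpret \<psi>: group_hom F H \<psi> using \<psi> by unfold_locales (simp add: A_hom_def)
  interpret \<phi>: group_hom H F \<phi> using \<phi> by unfold_locales (simp add: A_hom_def)
  have \<psi>g: "\<psi> g \<in> carrier H" "\<psi> g \<noteq> \<one>\<^bsub>H\<^esub>"
    using g \<phi>\<psi> \<phi>.hom_one by auto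
  obtain p e a where p: "p \<in> carrier H" "e \<in> E" "a \<in> carrier R" "\<psi> g = p \<otimes>\<^bsub>H\<^esub> e a \<otimes>\<^bsub>H\<^esub> inv\<^bsub>H\<^esub> p"
    using H.axis_form[OF \<psi>g] .
  define y where "y = p \<otimes>\<^bsub>H\<^esub> e \<one>\<^bsub>R\<^esub> \<otimes>\<^bsub>H\<^esub> inv\<^bsub>H\<^esub> p"
  have y: "y \<in> carrier H" using p by (simp add: y_def)
  have actz: "\<phi> (p \<otimes>\<^bsub>H\<^esub> e c \<otimes>\<^bsub>H\<^esub> inv\<^bsub>H\<^esub> p) = act (\<phi> y) c" if "c \<in> carrier R" for c
  proof -
    have "p \<otimes>\<^bsub>H\<^esub> e c \<otimes>\<^bsub>H\<^esub> inv\<^bsub>H\<^esub> p = actH y c"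
      using H.act_axis[OF p(1,2) F.R.one_closed that] that by (simp add: actH y_def)
    then show ?thesis using \<phi> y that by (simp add: A_hom_def)
  qed
  show thesis
  proof (rule that[of "\<phi> y"])
    show "\<phi> y \<in> carrier F" using y by simp
    fix h assume h: "h \<in> carrier F" "g \<otimes>\<^bsub>F\<^esub> h = h \<otimes>\<^bsub>F\<^esub> g"
    have comm: "\<psi> g \<otimes>\<^bsub>H\<^esub> \<psi> h = \<psi> h \<otimes>\<^bsub>H\<^esub> \<psi> g"
      using g h \<psi>.hom_mult by metis
    have "\<psi> h \<in> carrier H" using h(1) by simp
    then obtain c where c: "c \<in> carrier R" "\<psi> h = p \<otimes>\<^bsub>H\<^esub> e c \<otimes>\<^bsub>H\<^esub> inv\<^bsub>H\<^esub> p"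
      using H.axis_centralizer[OF p(1-4) \<psi>g(2) _ comm] by blast
    then have "h = act (\<phi> y) c" using actz[OF c(1)] \<phi>\<psi> h(1) by metis
    then show "\<exists>c\<in>carrier R. h = act (\<phi> y) c" using c by blast
  next
    fix c assume c: "c \<in> carrier R" "act (\<phi> y) c = \<one>\<^bsub>F\<^esub>"
    have "p \<otimes>\<^bsub>H\<^esub> e c \<otimes>\<^bsub>H\<^esub> inv\<^bsub>H\<^esub> p = \<psi> (act (\<phi> y) c)"
      unfolding actz[OF c(1), symmetric] using \<psi>\<phi> p(1,2) c(1) by (simp del: \<phi>.hom_mult)
    also have "\<dots> = \<one>\<^bsub>H\<^esub>" using c(2) by simp
    finally have "e c = \<one>\<^bsub>H\<^esub>" using p c H.conj_one_iff by simp
    then show "c = \<zero>\<^bsub>R\<^esub>" using H.axis_inj p c by blast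
  qed
qed

lemma (in A_group) act_commute:
  assumes "z \<in> carrier G" "a \<in> carrier R" "b \<in> carrier R"
  shows "act z a \<otimes>\<^bsub>G\<^esub> act z b = act z b \<otimes>\<^bsub>G\<^esub> act z a"
  using act_add[OF assms(1,2,3)] act_add[OF assms(1,3,2)] R.a_comm[OF assms(2,3)] by simp

lemma (in A_group) cyclic_free_rank_one:
  assumes z: "z \<in> carrier G" and K: "K = act z ` carrier R"
    and inj: "\<And>c. c \<in> carrier R \<Longrightarrow> act z c = \<one>\<^bsub>G\<^esub> \<Longrightarrow> c = \<zero>\<^bsub>R\<^esub>"
  shows "free_A_module_of_rank R (G\<lparr>carrier := K\<rparr>) act 1"
proof -
  let ?M = "G\<lparr>carrier := K\<rparr>"
  have inv_act: "inv\<^bsub>G\<^esub> (act z c) = act z (\<ominus>\<^bsub>R\<^esub> c)" if "c \<in> carrier R" for c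
    using that z by (intro G.inv_equality) (simp_all add: act_add[symmetric] R.l_neg act_zero act_closed)
  have sub: "subgroup K G"
  proof (rule G.subgroupI)
    show "K \<subseteq> carrier G" "K \<noteq> {}" using z act_closed R.zero_closed unfolding K by auto
    fix x assume "x \<in> K"
    then obtain c where c: "c \<in> carrier R" "x = act z c" by (auto simp: K)
    then show "inv\<^bsub>G\<^esub> x \<in> K" using inv_act by (simp add: K)
    fix y assume "y \<in> K"
    then obtain d where "d \<in> carrier R" "y = act z d" by (auto simp: K)
    then show "x \<otimes>\<^bsub>G\<^esub> y \<in> K" using c z by (auto simp: K act_add[symmetric])
  qed
  have Kc: "x \<in> carrier G" if "x \<in> K" for x using sub that by (rule subgroup.mem_carrier)
  have gM: "group ?M" by (rule G.subgroup_imp_group[OF sub])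
  have invM: "inv\<^bsub>?M\<^esub> x = inv\<^bsub>G\<^esub> x" if "x \<in> K" for x
    using G.m_inv_consistent[OF sub that] .
  have Kact: "act x \<alpha> \<in> K" if "x \<in> K" "\<alpha> \<in> carrier R" for x \<alpha>
    using that z by (auto simp: K act_mult[symmetric])
  have AM: "A_group R ?M act"
  proof (intro A_group.intro A_group_axioms.intro R.ring_axioms gM)
    fix g h \<alpha> assume "g \<in> carrier ?M" "h \<in> carrier ?M" "\<alpha> \<in> carrier R"
    then show "act (inv\<^bsub>?M\<^esub> h \<otimes>\<^bsub>?M\<^esub> g \<otimes>\<^bsub>?M\<^esub> h) \<alpha> = inv\<^bsub>?M\<^esub> h \<otimes>\<^bsub>?M\<^esub> act g \<alpha> \<otimes>\<^bsub>?M\<^esub> h"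
      using act_conj[of g h \<alpha>] Kc by (simp add: invM)
    assume "g \<otimes>\<^bsub>?M\<^esub> h = h \<otimes>\<^bsub>?M\<^esub> g"
    with \<open>g \<in> _\<close> \<open>h \<in> _\<close> \<open>\<alpha> \<in> _\<close> have "act (g \<otimes>\<^bsub>G\<^esub> h) \<alpha> = act g \<alpha> \<otimes>\<^bsub>G\<^esub> act h \<alpha>"
      by (intro act_commuting) (simp_all add: Kc)
    then show "act (g \<otimes>\<^bsub>?M\<^esub> h) \<alpha> = act g \<alpha> \<otimes>\<^bsub>?M\<^esub> act h \<alpha>" by simp
  qed (simp_all add: Kact Kc act_one act_zero one_act act_add act_mult)
  have cM: "comm_group ?M"
  proof (rule group.group_comm_groupI[OF gM])
    fix x y assume "x \<in> carrier ?M" "y \<in> carrier ?M"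
    then show "x \<otimes>\<^bsub>?M\<^esub> y = y \<otimes>\<^bsub>?M\<^esub> x" using act_commute[OF z] by (auto simp: K)
  qed
  interpret M: comm_group ?M by (rule cM)
  have zK: "z \<in> K" using act_one[OF z] R.one_closed unfolding K by (metis imageI)
  \<comment> \<open>A zero coefficient removes the only index, and the empty product agrees with
    \<open>act z \<zero>\<close>.\<close>
  have prod: "(\<Otimes>\<^bsub>?M\<^esub>b\<in>{b \<in> {z}. c b \<noteq> \<zero>\<^bsub>R\<^esub>}. act b (c b)) = act z (c z)" if "c z \<in> carrier R" for c
  proof (cases "c z = \<zero>\<^bsub>R\<^esub>")
    case True
    then have e: "{b \<in> {z}. c b \<noteq> \<zero>\<^bsub>R\<^esub>} = {}" by auto
    show ?thesis unfolding e using True act_zero[OF z] by simp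
  next
    case False
    then have e: "{b \<in> {z}. c b \<noteq> \<zero>\<^bsub>R\<^esub>} = {z}" by auto
    show ?thesis unfolding e using Kact[OF zK that] Kc by simp
  qed
  have eq: "a = b" if "act z a = act z b" "a \<in> carrier R" "b \<in> carrier R" for a b
  proof -
    have "act z (a \<oplus>\<^bsub>R\<^esub> (\<ominus>\<^bsub>R\<^esub> b)) = \<one>\<^bsub>G\<^esub>"
      using that z inv_act[of b] act_closed by (simp add: act_add inv_act[symmetric])
    then have "a \<oplus>\<^bsub>R\<^esub> (\<ominus>\<^bsub>R\<^esub> b) = \<zero>\<^bsub>R\<^esub>" using inj that by simp
    then show "a = b" using that by (metis R.add.inv_closed R.add.inv_inv R.minus_equality)
  qed
  have "A_module_basis R ?M act {z}"
    unfolding A_module_basis_def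
  proof (intro conjI ballI)
    fix m assume "m \<in> carrier ?M"
    then obtain a where a: "a \<in> carrier R" "m = act z a" by (auto simp: K)
    let ?P = "\<lambda>c. c \<in> {z} \<rightarrow>\<^sub>E carrier R \<and> finite {b \<in> {z}. c b \<noteq> \<zero>\<^bsub>R\<^esub>} \<and>
        m = (\<Otimes>\<^bsub>?M\<^esub>b\<in>{b \<in> {z}. c b \<noteq> \<zero>\<^bsub>R\<^esub>}. act b (c b))"
    show "\<exists>!c. ?P c"
    proof (rule ex1I[of _ "\<lambda>b\<in>{z}. a"])
      show "?P (\<lambda>b\<in>{z}. a)" using a prod[of "\<lambda>b\<in>{z}. a"] by (simp cong: conj_cong)
      fix c assume c: "?P c"
      then have cz: "c z \<in> carrier R" by auto
      then have "act z (c z) = act z a" using c prod[of c, OF cz] a(2) by metis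
      then have "c z = a" using eq cz a by blast
      then show "c = (\<lambda>b\<in>{z}. a)" using c by (auto simp: PiE_def extensional_def fun_eq_iff)
    qed
  qed (use zK in simp)
  then show ?thesis
    unfolding free_A_module_of_rank_def A_module_def using AM cM by (intro conjI exI[of _ "{z}"]) simp_all
qed

theorem proposition16:
  fixes R :: "('a, 'r) ring_scheme" and F :: "('g, 'm) monoid_scheme"
    and act :: "'g \<Rightarrow> 'a \<Rightarrow> 'g" and S :: "'g set"
  assumes "ring R"
    and "ring_char_zero R"
    and "additive_torsion_free R"
    and "free_A_group R F act S"
    and "\<not> comm_group F"
  shows "(\<forall>x\<in>carrier F. \<forall>y\<in>carrier F.
            x \<otimes>\<^bsub>F\<^esub> y = y \<otimes>\<^bsub>F\<^esub> x \<longleftrightarrow>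
            (\<exists>z\<in>carrier F. \<exists>a\<in>carrier R. \<exists>b\<in>carrier R. x = act z a \<and> y = act z b))
       \<and> (\<forall>g\<in>carrier F. g \<noteq> \<one>\<^bsub>F\<^esub> \<longrightarrow>
            free_A_module_of_rank R (F\<lparr>carrier := centralizer F g\<rparr>) act 1)"
proof (intro conjI ballI impI)
  interpret F: A_group R F act using assms(4) by (simp add: free_A_group_def)
  note axis = free_A_group_axis[OF assms(2-4)]
  fix x y assume x: "x \<in> carrier F" and y: "y \<in> carrier F"
  show "x \<otimes>\<^bsub>F\<^esub> y = y \<otimes>\<^bsub>F\<^esub> x \<longleftrightarrow>
      (\<exists>z\<in>carrier F. \<exists>a\<in>carrier R. \<exists>b\<in>carrier R. x = act z a \<and> y = act z b)"
  proof
    assume c: "x \<otimes>\<^bsub>F\<^esub> y = y \<otimes>\<^bsub>F\<^esub> x"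
    show "\<exists>z\<in>carrier F. \<exists>a\<in>carrier R. \<exists>b\<in>carrier R. x = act z a \<and> y = act z b"
    proof (cases "x = \<one>\<^bsub>F\<^esub>")
      case True
      \<comment> \<open>The centralizer argument needs a nontrivial element, so the unit is
        expressed through \<open>z = y\<close> with exponents zero and one.\<close>
      then have "x = act y \<zero>\<^bsub>R\<^esub>" "y = act y \<one>\<^bsub>R\<^esub>" using y by (simp_all add: F.act_zero F.act_one)
      then show ?thesis using y F.R.zero_closed F.R.one_closed by blast
    next
      case False
      obtain z where "z \<in> carrier F"
        "\<And>h. h \<in> carrier F \<Longrightarrow> x \<otimes>\<^bsub>F\<^esub> h = h \<otimes>\<^bsub>F\<^esub> x \<Longrightarrow> \<exists>c\<in>carrier R. h = act z c"
        using axis[OF x False] by blast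
      then show ?thesis using x y c by blast
    qed
  qed (use F.act_commute in blast)
next
  interpret F: A_group R F act using assms(4) by (simp add: free_A_group_def)
  fix g assume g: "g \<in> carrier F" "g \<noteq> \<one>\<^bsub>F\<^esub>"
  obtain z where z: "z \<in> carrier F"
    and cent: "\<And>h. h \<in> carrier F \<Longrightarrow> g \<otimes>\<^bsub>F\<^esub> h = h \<otimes>\<^bsub>F\<^esub> g \<Longrightarrow> \<exists>c\<in>carrier R. h = act z c"
    and inj: "\<And>c. c \<in> carrier R \<Longrightarrow> act z c = \<one>\<^bsub>F\<^esub> \<Longrightarrow> c = \<zero>\<^bsub>R\<^esub>"
    using free_A_group_axis[OF assms(2-4) g] by blast
  \<comment> \<open>\<open>g\<close> commutes with itself and so is a power of \<open>z\<close>,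
    which puts all powers of \<open>z\<close> into its centralizer.\<close>
  obtain a where a: "a \<in> carrier R" "g = act z a" using cent[OF g(1)] by blast
  have "centralizer F g = act z ` carrier R"
  proof
    show "centralizer F g \<subseteq> act z ` carrier R" using cent by (force simp: centralizer_def)
    show "act z ` carrier R \<subseteq> centralizer F g"
      using F.act_commute[OF z _ a(1)] F.act_closed[OF z] unfolding a(2) centralizer_def by blast
  qed
  then show "free_A_module_of_rank R (F\<lparr>carrier := centralizer F g\<rparr>) act 1"
    by (rule F.cyclic_free_rank_one[OF z]) (rule inj)
qed

end
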